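(* Let $d\in\mathbb N$, $\alpha\ge0$, and let $f$ be a probability density on $\mathbb R^d$ satisfying (C1). Let $\mathcal X_n$ consist of $n$ independent random vectors with density $f$. Then as $n\to\infty$, $$ n^{(\alpha-d)/d}\mathcal G^{d,\alpha}(\mathcal X_n)\xrightarrow{L^2}v_d^{-\alpha/d}\,2^{d+\alpha-1}\,\Gamma(1+\alpha/d)\int_{\mathrm{supp}(f)}f(\mathbf x)^{(d-\alpha)/d}d\mathbf x. $$
   Context: The Gabriel graph on a finite $\mathcal X\subset\mathbb R^d$ joins $\mathbf x,\mathbf y\in\mathcal X$ by an (undirected) edge iff the ball having the segment $\mathbf x\mathbf y$ as a diameter contains no other point of $\mathcal X$. $\mathcal G^{d,\alpha}(\mathcal X)$ is its total power-weighted edge length $\sum_{\text{edges }\{\mathbf u,\mathbf v\}}\|\mathbf u-\mathbf v\|^\alpha$ (Euclidean norm). $v_d=\pi^{d/2}/\Gamma(1+d/2)$ is the volume of the unit $d$-ball. Condition (C1): $f$ is supported by a convex polyhedron in $\mathbb R^d$ and is bounded away from $0$ and $\infty$ on its support; $\mathrm{supp}(f)$ is its support. *)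

theory Defs
  imports "HOL-Analysis.Analysis" "HOL-Probability.Probability"
begin

definition gabriel_adj :: "'a::euclidean_space set \<Rightarrow> 'a \<Rightarrow> 'a \<Rightarrow> bool" where
  "gabriel_adj S x y \<longleftrightarrow> x \<in> S \<and> y \<in> S \<and> x \<noteq> y \<and>
     (\<forall>z \<in> S - {x, y}. z \<notin> cball (midpoint x y) (dist x y / 2))"

definition gabriel_edges :: "'a::euclidean_space set \<Rightarrow> 'a set set" where
  "gabriel_edges S = {{x, y} | x y. gabriel_adj S x y}"

text \<open>Total power-weighted edge length; for an edge e = {u,v}, diameter e = norm (u - v).\<close>
definition gabriel_weight :: "real \<Rightarrow> 'a::euclidean_space set \<Rightarrow> real" where
  "gabriel_weight \<alpha> S = (\<Sum>e \<in> gabriel_edges S. (diameter e) powr \<alpha>)"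

definition L2_converges :: "'m measure \<Rightarrow> (nat \<Rightarrow> 'm \<Rightarrow> real) \<Rightarrow> real \<Rightarrow> bool" where
  "L2_converges M Y c \<longleftrightarrow>
     (\<forall>n. Y n \<in> borel_measurable M \<and> integrable M (\<lambda>\<omega>. (Y n \<omega>)\<^sup>2)) \<and>
     ((\<lambda>n. integral\<^sup>L M (\<lambda>\<omega>. (Y n \<omega> - c)\<^sup>2)) \<longlonglongrightarrow> 0)"

end

theory Submission
  imports Defs
begin

text \<open>
Second moment method. Almost surely the sample points are distinct and the weight is half the sum, over
ordered pairs \<open>(i, j)\<close>, of \<open>|X\<^sub>i - X\<^sub>j|\<^sup>\<alpha>\<close> times the indicator that no other point lies in the diametral
ball of \<open>X\<^sub>i\<close> and \<open>X\<^sub>j\<close>. Conditioning on \<open>X\<^sub>i = x\<close> and \<open>X\<^sub>j = y\<close>, the indicator has expectation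
\<open>(1 - p(x,y))\<^bsup>n-2\<^esup>\<close>, with \<open>p(x,y)\<close> the mass of the ball. Substituting \<open>y = x + n\<^bsup>-1/d\<^esup> u\<close>, the rescaled
expectation converges because translations are continuous in \<open>L\<^sup>1\<close>; the domination is uniform up to the
boundary because convexity of the support gives \<open>p(x,y) \<ge> c |x - y|\<^sup>d\<close>. In the second moment, two vertex
disjoint edges with disjoint balls contribute at most the square of the first moment, since
\<open>1 - p - p' \<le> (1 - p) (1 - p')\<close>, and all other pairs of edges contribute \<open>O(1/n)\<close> after rescaling.
\<close>

section \<open>Radial integrals and translation in the mean\<close>

text \<open>No continuity of \<open>f\<close> is available, so no limit is taken at a fixed
  \<open>x\<close>: for each fixed \<open>u\<close> the integral over \<open>x\<close> converges,
  with errors controlled by the L^1 modulus of continuity of \<open>f\<close>, and \<open>u\<close>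
  is integrated only afterwards. The support may a priori be unbounded; unit mass and the lower
  bound on \<open>f\<close> force it to be bounded, and boundedness makes the constant in p(x,y) >=
  c |x-y|^d uniform. The constant: the diametral ball of 0 and u has volume v_d (|u|/2)^d, and
  integrating |u|^alpha exp(-f(x) v_d |u|^d / 2^d) over u gives v_d^(-alpha/d) 2^(d+alpha)
  Gamma(1+alpha/d) f(x)^(-1-alpha/d). The densities of the two endpoints contribute f(x)^2 in the
  limit, and counting each edge once halves the result. Two edges xy and zw with intersecting balls
  have x and z within twice the longer length. Such closeness has mass O(|x-y|^d), or O(|z-w|^d),
  which is of order 1/n at the relevant scale. Only an upper bound on the second moment is needed:
  if E Y tends to c, then E(Y-c)^2 = E Y^2 - 2c E Y + c^2 is nonnegative and is squeezed to
  0.\<close>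

abbreviation ubv :: "'a::euclidean_space itself \<Rightarrow> real" where
  "ubv _ \<equiv> unit_ball_vol (real DIM('a))"

text \<open>The set is a ball of radius (t/v)^(1/d). In other words, the map sending u to v |u|^d
  carries Lebesgue measure to Lebesgue measure on the half line, which replaces polar
  coordinates.\<close>

lemma emeasure_lborel_norm_power_less:
  assumes "t > 0"
  shows "emeasure lborel {u::'a::euclidean_space. ubv TYPE('a) * norm u ^ DIM('a) < t} = ennreal t"
proof -
  let ?v = "ubv TYPE('a)" and ?d = "DIM('a)"
  have v: "?v > 0" by simp
  define r where "r = root ?d (t / ?v)"
  have r0: "r > 0" using assms v by (simp add: r_def)
  have rd: "r ^ ?d = t / ?v" using assms v by (simp add: r_def)
  have "?v * norm u ^ ?d < t \<longleftrightarrow> norm u < r" for u :: 'a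
  proof -
    have "?v * norm u ^ ?d < t \<longleftrightarrow> norm u ^ ?d < r ^ ?d"
      using v by (simp add: rd field_simps)
    also have "\<dots> \<longleftrightarrow> norm u < r"
      using r0 by (metis DIM_positive norm_ge_zero less_imp_le power_strict_mono power_less_imp_less_base)
    finally show ?thesis .
  qed
  then have "{u::'a. ?v * norm u ^ ?d < t} = ball 0 r" by (simp only: ball_def dist_0_norm)
  then show ?thesis
    using emeasure_ball[of r "0::'a"] r0 v by (simp add: rd)
qed

lemma nn_integral_radial:
  assumes [measurable]: "F \<in> borel_measurable borel"
  shows "(\<integral>\<^sup>+u. F (ubv TYPE('a) * norm u ^ DIM('a)) \<partial>(lborel :: 'a::euclidean_space measure))
       = (\<integral>\<^sup>+s. F s * indicator {0..} s \<partial>lborel)"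
proof -
  let ?v = "ubv TYPE('a)" and ?d = "DIM('a)"
  have v: "?v > 0" by simp
  \<comment> \<open>The sign is reversed so that the rays \<open>{x<..}\<close> have finite measure,
    as the uniqueness rule for measures determined by such rays requires.\<close>
  define M where "M = distr lborel borel (\<lambda>u::'a. - (?v * norm u ^ ?d))"
  define N where "N = density lborel (indicator {..0::real} :: real \<Rightarrow> ennreal)"
  have M: "emeasure M {x<..} = ennreal (if x < 0 then - x else 0)" for x
  proof -
    have "emeasure M {x<..} = emeasure lborel {u::'a. ?v * norm u ^ ?d < -x}"
      unfolding M_def by (subst emeasure_distr) (auto intro!: arg_cong[where f="emeasure lborel"])
    moreover have "{u::'a. ?v * norm u ^ ?d < -x} = {}" if "\<not> x < 0"
    proof -
      have "\<not> ?v * norm u ^ ?d < -x" for u :: 'a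
        using v that by (smt (verit) mult_nonneg_nonneg norm_ge_zero zero_le_power)
      then show ?thesis by auto
    qed
    ultimately show ?thesis
      using emeasure_lborel_norm_power_less[where 'a='a, of "-x"] by auto
  qed
  have N: "emeasure N {x<..} = ennreal (if x < 0 then - x else 0)" for x
  proof -
    have "emeasure N {x<..} = emeasure lborel {x<..0}"
      unfolding N_def by (subst emeasure_density)
        (auto intro!: nn_integral_cong arg_cong[where f="emeasure lborel"]
          simp flip: nn_integral_indicator simp: indicator_def)
    then show ?thesis by (cases "x < 0") auto
  qed
  have "M = N"
    by (rule measure_eqI_lessThan) (auto simp: M N, auto simp: M_def N_def)
  have "(\<integral>\<^sup>+u. F (?v * norm u ^ ?d) \<partial>(lborel :: 'a measure)) = (\<integral>\<^sup>+t. F (- t) \<partial>M)"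
    unfolding M_def by (subst nn_integral_distr) auto
  also have "\<dots> = (\<integral>\<^sup>+t. indicator {..0} t * F (- t) \<partial>lborel)"
    unfolding \<open>M = N\<close> N_def by (subst nn_integral_density) auto
  also have "\<dots> = (\<integral>\<^sup>+s. F s * indicator {0..} s \<partial>lborel)"
    by (subst nn_integral_real_affine[where c="-1" and t=0])
       (auto intro!: nn_integral_cong simp: indicator_def)
  finally show ?thesis .
qed

text \<open>In the variable s = v |u|^d this is a Gamma integral with rate \<kappa>/v. The factor
  \<kappa>/v is kept separate because later \<kappa> is itself a multiple of v.\<close>

lemma nn_integral_norm_powr_exp:
  fixes \<beta> \<kappa> :: real
  assumes "\<kappa> > 0" "\<beta> \<ge> 0"
  shows "(\<integral>\<^sup>+u. ennreal (norm u powr \<beta> * exp (- \<kappa> * norm u ^ DIM('a))) \<partial>(lborel :: 'a::euclidean_space measure))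
    = ennreal (ubv TYPE('a) powr (- \<beta> / DIM('a)) * (\<kappa> / ubv TYPE('a)) powr (- 1 - \<beta> / DIM('a))
        * Gamma (1 + \<beta> / DIM('a)))"
proof -
  let ?v = "ubv TYPE('a)" and ?d = "DIM('a)"
  define b where "b = \<beta> / ?d"
  define k where "k = \<kappa> / ?v"
  have v: "?v > 0" by simp
  have k: "k > 0" and b: "b \<ge> 0" using assms v by (auto simp: k_def b_def)
  define F where "F = (\<lambda>s. ennreal ((s / ?v) powr b * exp (- k * s)))"
  have [measurable]: "F \<in> borel_measurable borel" by (simp add: F_def)
  have "(norm u ^ ?d) powr b = norm u powr \<beta>" for u :: 'a
    by (cases "u = 0") (auto simp: b_def powr_powr simp flip: powr_realpow)
  then have "(\<integral>\<^sup>+u. ennreal (norm u powr \<beta> * exp (- \<kappa> * norm u ^ ?d)) \<partial>(lborel :: 'a measure))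
     = (\<integral>\<^sup>+u. F (?v * norm u ^ ?d) \<partial>(lborel :: 'a measure))"
    using less_imp_neq[OF v, symmetric] by (intro nn_integral_cong) (simp add: F_def k_def)
  also have "\<dots> = (\<integral>\<^sup>+s. F s * indicator {0..} s \<partial>lborel)"
    by (rule nn_integral_radial[of F]) measurable
  also have "\<dots> = ennreal (1/k) * (\<integral>\<^sup>+s. F (s / k) * indicator {0..} (s / k) \<partial>lborel)"
    using k by (subst nn_integral_real_affine[where c="1/k" and t=0]) auto
  also have "(\<integral>\<^sup>+s. F (s / k) * indicator {0..} (s / k) \<partial>lborel)
      = (\<integral>\<^sup>+t. ennreal (?v powr (-b) * k powr (-b)) *
             ennreal (indicator {0..} t * t powr ((1 + b) - 1) / exp t) \<partial>lborel)"
  proof (rule nn_integral_cong)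
    fix s :: real
    show "F (s / k) * indicator {0..} (s / k)
       = ennreal (?v powr (-b) * k powr (-b)) * ennreal (indicator {0..} s * s powr ((1 + b) - 1) / exp s)"
    proof (cases "s \<ge> 0")
      case True
      then have 1: "(s / k / ?v) powr b = ?v powr (-b) * k powr (-b) * s powr b"
        using k v by (simp add: powr_divide powr_minus powr_mult divide_inverse inverse_powr)
      have "(s / k / ?v) powr b * exp (- k * (s / k))
          = (?v powr (-b) * k powr (-b)) * (indicator {0..} s * s powr ((1 + b) - 1) / exp s)"
      proof -
        have "- k * (s / k) = - s" using k by simp
        then show ?thesis unfolding 1 using True by (simp add: exp_minus divide_inverse)
      qed
      moreover have "0 \<le> ?v powr (-b) * k powr (-b)" by simp
      moreover have "indicator {0..} (s / k) = (1 :: ennreal)" using True k by simp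
      ultimately show ?thesis
        unfolding F_def by (simp only: ennreal_mult' mult_1_right)
    next
      case False
      then show ?thesis using k by (simp add: zero_le_divide_iff)
    qed
  qed
  also have "\<dots> = ennreal (?v powr (-b) * k powr (-b)) * ennreal (Gamma (1 + b))"
    using Gamma_conv_nn_integral_real[of "1+b"] b by (subst nn_integral_cmult) auto
  also have "ennreal (1/k) * \<dots> = ennreal (?v powr (-b) * k powr (-1 - b) * Gamma (1 + b))"
  proof -
    have "k powr (-1 - b) = k powr (-b) / k"
      using k by (simp add: powr_diff powr_minus divide_simps)
    then show ?thesis
      using k v b by (simp add: Gamma_real_nonneg mult_ac flip: ennreal_mult)
  qed
  finally show ?thesis by (simp add: b_def k_def)
qed

section \<open>Continuity of translations in L^1\<close>

lemma integrable_lborel_translate: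
  fixes f :: "'a::euclidean_space \<Rightarrow> real"
  assumes "integrable lborel f"
  shows "integrable lborel (\<lambda>x. f (x + z))"
proof -
  have [measurable]: "f \<in> borel_measurable borel" using assms by auto
  show ?thesis
    using assms by (subst (asm) lborel_distr_plus[of z, symmetric])
      (subst (asm) integrable_distr_eq, auto simp: add.commute)
qed

lemma integral_lborel_translate:
  fixes f :: "'a::euclidean_space \<Rightarrow> real"
  assumes [measurable]: "f \<in> borel_measurable borel"
  shows "(LINT x|lborel. f (x + z)) = (LINT x|lborel. f x)"
  using integral_distr[of "(+) z" lborel borel f] by (simp add: lborel_distr_plus add.commute)

text \<open>Only the positive part of the difference needs a pointwise limit: on \<open>A\<close> it
  vanishes, and off \<open>A\<close> it vanishes eventually because the complement is open.
  Translation invariance makes the difference integrate to zero, so its L^1 norm is twice the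
  integral of the positive part. The boundary of \<open>A\<close> needs no attention.\<close>

lemma L1_translation_compact:
  fixes z :: "nat \<Rightarrow> 'a::euclidean_space"
  assumes A: "compact A" and z: "z \<longlonglongrightarrow> 0"
  shows "(\<lambda>n. LINT x|lborel. \<bar>indicator A (x + z n) - indicator A x\<bar> :: real) \<longlonglongrightarrow> 0"
proof -
  define g where "g = (\<lambda>n x. indicator A (x + z n) - indicator A x :: real)"
  have [measurable]: "A \<in> sets borel" using A by (simp add: borel_compact)
  have iA: "integrable lborel (indicator A :: 'a \<Rightarrow> real)"
    using emeasure_compact_finite[OF A] by (simp add: integrable_indicator_iff)
  have iAz: "integrable lborel (\<lambda>x. indicator A (x + z n) :: real)" for n
    using integrable_lborel_translate[OF iA] .
  have g: "integrable lborel (g n)" for n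
    unfolding g_def using iA iAz by simp
  have g0: "(LINT x|lborel. g n x) = 0" for n
    unfolding g_def using iA iAz[of n] integral_lborel_translate[of "indicator A" "z n"]
    by (subst Bochner_Integration.integral_diff) auto
  have "bounded (range z)" using z convergent_imp_bounded by blast
  then obtain R where R: "\<And>n. norm (z n) \<le> R" by (auto simp: bounded_iff)
  obtain B where B: "\<And>x. x \<in> A \<Longrightarrow> norm x \<le> B"
    using compact_imp_bounded[OF A] by (auto simp: bounded_iff)
  have "(\<lambda>n. LINT x|lborel. max 0 (g n x)) \<longlonglongrightarrow> integral\<^sup>L (lborel :: 'a measure) (\<lambda>x. 0::real)"
  proof (rule integral_dominated_convergence[where w="indicator (cball 0 (B + R) :: 'a set)"])
    show "integrable lborel (indicator (cball 0 (B + R) :: 'a set) :: 'a \<Rightarrow> real)"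
      using emeasure_compact_finite[OF compact_cball[of "0::'a" "B+R"]]
      by (simp add: integrable_indicator_iff)
    show "AE x in lborel. (\<lambda>n. max 0 (g n x)) \<longlonglongrightarrow> 0"
    proof (rule AE_I2)
      fix x :: 'a
      show "(\<lambda>n. max 0 (g n x)) \<longlonglongrightarrow> 0"
      proof (cases "x \<in> A")
        case True
        then have "max 0 (g n x) = 0" for n by (auto simp: g_def indicator_def)
        then show ?thesis by simp
      next
        case False
        have "open (- A)" using A compact_imp_closed by auto
        moreover have "(\<lambda>n. x + z n) \<longlonglongrightarrow> x" using tendsto_add[OF tendsto_const z, of x] by simp
        ultimately have "\<forall>\<^sub>F n in sequentially. x + z n \<in> - A"
          using False by (intro topological_tendstoD) auto
        then have "\<forall>\<^sub>F n in sequentially. max 0 (g n x) = 0"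
          by eventually_elim (auto simp: g_def)
        then show ?thesis by (simp add: tendsto_eventually)
      qed
    qed
    fix n
    show "AE x in lborel. norm (max 0 (g n x)) \<le> indicator (cball 0 (B + R)) x"
    proof (rule AE_I2)
      fix x :: 'a
      have "norm x \<le> B + R" if "x + z n \<in> A"
        using B[OF that] R[of n] norm_triangle_ineq4[of "x + z n" "z n"] by simp
      then show "norm (max 0 (g n x)) \<le> indicator (cball 0 (B + R)) x"
        by (auto simp: g_def indicator_def)
    qed
  qed (auto simp: g_def)
  then have "(\<lambda>n. 2 * (LINT x|lborel. max 0 (g n x))) \<longlonglongrightarrow> 0"
    using tendsto_mult_right_zero by fastforce
  moreover have "(LINT x|lborel. \<bar>g n x\<bar>) = 2 * (LINT x|lborel. max 0 (g n x))" for n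
  proof -
    have "(LINT x|lborel. \<bar>g n x\<bar>) = (LINT x|lborel. 2 * max 0 (g n x) - g n x)"
      by (intro Bochner_Integration.integral_cong) auto
    also have "\<dots> = (LINT x|lborel. 2 * max 0 (g n x)) - (LINT x|lborel. g n x)"
      using g[of n] by (intro Bochner_Integration.integral_diff) auto
    finally show ?thesis by (simp add: g0)
  qed
  ultimately show ?thesis by (simp add: g_def)
qed

lemma L1_translation_triangle:
  fixes f g :: "'a::euclidean_space \<Rightarrow> real"
  assumes f: "integrable lborel f" and g: "integrable lborel g"
  shows "(LINT x|lborel. \<bar>f (x + z) - f x\<bar>)
    \<le> (LINT x|lborel. \<bar>g (x + z) - g x\<bar>) + 2 * (LINT x|lborel. \<bar>f x - g x\<bar>)"
proof -
  note fz = integrable_lborel_translate[OF f, of z] and gz = integrable_lborel_translate[OF g, of z]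
  have "(LINT x|lborel. \<bar>f (x + z) - f x\<bar>)
     \<le> (LINT x|lborel. \<bar>g (x + z) - g x\<bar> + (\<bar>f (x + z) - g (x + z)\<bar> + \<bar>f x - g x\<bar>))"
    using f g fz gz by (intro integral_mono) auto
  also have "\<dots> = (LINT x|lborel. \<bar>g (x + z) - g x\<bar>)
      + ((LINT x|lborel. \<bar>f (x + z) - g (x + z)\<bar>) + (LINT x|lborel. \<bar>f x - g x\<bar>))"
    using f g fz gz by simp
  also have "(LINT x|lborel. \<bar>f (x + z) - g (x + z)\<bar>) = (LINT x|lborel. \<bar>f x - g x\<bar>)"
    using f g by (subst integral_lborel_translate[of "\<lambda>x. \<bar>f x - g x\<bar>" z]) auto
  finally show ?thesis by simp
qed

text \<open>Translation is an L^1 isometry, so approximating \<open>f\<close> by \<open>g\<close>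
  costs twice their L^1 distance; hence the functions with the desired continuity form an L^1 closed
  set.\<close>

lemma L1_translation_approx:
  fixes f :: "'a::euclidean_space \<Rightarrow> real"
  assumes f: "integrable lborel f"
    and approx: "\<And>e. e > 0 \<Longrightarrow> \<exists>g. integrable lborel g \<and> (LINT x|lborel. \<bar>f x - g x\<bar>) < e \<and>
       (\<lambda>n. LINT x|lborel. \<bar>g (x + z n) - g x\<bar>) \<longlonglongrightarrow> 0"
  shows "(\<lambda>n. LINT x|lborel. \<bar>f (x + z n) - f x\<bar>) \<longlonglongrightarrow> 0"
proof (rule LIMSEQ_I)
  fix e :: real assume "e > 0"
  then obtain g where g: "integrable lborel g" "(LINT x|lborel. \<bar>f x - g x\<bar>) < e / 4"
    "(\<lambda>n. LINT x|lborel. \<bar>g (x + z n) - g x\<bar>) \<longlonglongrightarrow> 0"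
    using approx[of "e/4"] by auto
  obtain N where N: "\<And>n. n \<ge> N \<Longrightarrow> norm ((LINT x|lborel. \<bar>g (x + z n) - g x\<bar>) - 0) < e / 2"
    using LIMSEQ_D[OF g(3), of "e/2"] \<open>e > 0\<close> by auto
  show "\<exists>N. \<forall>n\<ge>N. norm ((LINT x|lborel. \<bar>f (x + z n) - f x\<bar>) - 0) < e"
  proof (intro exI allI impI)
    fix n assume "n \<ge> N"
    have "0 \<le> (LINT x|lborel. \<bar>f (x + z n) - f x\<bar>)" by simp
    then show "norm ((LINT x|lborel. \<bar>f (x + z n) - f x\<bar>) - 0) < e"
      using L1_translation_triangle[OF f g(1), of "z n"] N[OF \<open>n \<ge> N\<close>] g(2) by simp
  qed
qed

lemma compact_inner_approx:
  fixes A :: "'a::euclidean_space set"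
  assumes A[measurable]: "A \<in> sets borel" and fin: "emeasure lborel A < \<infinity>" and e: "e > 0"
  obtains T where "compact T" "T \<subseteq> A" "emeasure lborel A < emeasure lborel T + ennreal e"
proof -
  \<comment> \<open>Inner regularity is applied to a finite measure, hence the restriction of
    Lebesgue measure to \<open>A\<close>.\<close>
  define N where "N = density lborel (indicator A :: 'a \<Rightarrow> ennreal)"
  have N: "emeasure N B = emeasure lborel (A \<inter> B)" if "B \<in> sets borel" for B
    using that unfolding N_def
    by (subst emeasure_density) (auto simp: indicator_inter_arith simp flip: nn_integral_indicator)
  have "emeasure N A = (SUP K \<in> {K. K \<subseteq> A \<and> compact K}. emeasure N K)"
    by (rule inner_regular) (use fin N[of UNIV] in \<open>auto simp: N_def\<close>)
  moreover have "(SUP K \<in> {K. K \<subseteq> A \<and> compact K}. emeasure N K) = (SUP K \<in> {K. K \<subseteq> A \<and> compact K}. emeasure lborel K)"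
    by (intro SUP_cong) (auto simp: N borel_compact Int_absorb1)
  ultimately have eq: "emeasure lborel A = (SUP K \<in> {K. K \<subseteq> A \<and> compact K}. emeasure lborel K)"
    by (simp add: N)
  show thesis
  proof (cases "emeasure lborel A = 0")
    case True
    then show ?thesis using e by (intro that[of "{}"]) auto
  next
    case False
    then have "emeasure lborel A - ennreal e < emeasure lborel A"
      using fin e by (intro ennreal_between) (auto simp: zero_less_iff_neq_zero)
    then obtain T where T: "T \<subseteq> A" "compact T" "emeasure lborel A - ennreal e < emeasure lborel T"
      unfolding eq less_SUP_iff by auto
    have "emeasure lborel A < emeasure lborel T + ennreal e"
    \<comment> \<open>Subtraction in \<open>ennreal\<close> truncates at 0, so moving
      \<open>e\<close> to the other side needs \<open>e\<close> to be at most the measure of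
      \<open>A\<close>; otherwise the claim is immediate.\<close>
    proof (cases "ennreal e \<le> emeasure lborel A")
      case True
      then show ?thesis using T(3) by (simp add: minus_less_iff_ennreal)
    next
      case False
      then have "emeasure lborel A < ennreal e" by simp
      also have "ennreal e \<le> emeasure lborel T + ennreal e" by simp
      finally show ?thesis .
    qed
    then show ?thesis using T by (intro that[of T]) auto
  qed
qed

lemma L1_translation:
  fixes f :: "'a::euclidean_space \<Rightarrow> real"
  assumes f: "integrable lborel f" and z: "z \<longlonglongrightarrow> 0"
  shows "(\<lambda>n. LINT x|lborel. \<bar>f (x + z n) - f x\<bar>) \<longlonglongrightarrow> 0"
  using f
proof (induction rule: integrable_induct)
  case (base A c)
  have i: "integrable lborel (indicator A :: 'a \<Rightarrow> real)"
    using base by (auto simp: integrable_indicator_iff)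
  have [measurable]: "A \<in> sets borel" using base by simp
  have "(\<lambda>n. LINT x|lborel. \<bar>indicator A (x + z n) - indicator A x :: real\<bar>) \<longlonglongrightarrow> 0"
  proof (rule L1_translation_approx[OF i])
    fix e :: real assume e: "e > 0"
    obtain T where T: "compact T" "T \<subseteq> A" "emeasure lborel A < emeasure lborel T + ennreal e"
      using compact_inner_approx[OF _ base(2) e] base(1) by auto
    have [measurable]: "T \<in> sets borel" using T by (simp add: borel_compact)
    have "(LINT x|lborel. \<bar>indicator A x - indicator T x\<bar>) = measure lborel (A - T)"
    proof -
      have "(\<lambda>x. \<bar>indicator A x - indicator T x\<bar>) = (indicator (A - T) :: 'a \<Rightarrow> real)"
        using T(2) by (auto simp: indicator_def fun_eq_iff)
      then show ?thesis by simp
    qed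
    also have "\<dots> = measure lborel A - measure lborel T"
      using T(2) base(2) by (intro measure_Diff) auto
    also have "\<dots> < e"
    proof -
      have "emeasure lborel T < \<infinity>" using T(1) emeasure_compact_finite by blast
      then have "ennreal (measure lborel A) < ennreal (measure lborel T + e)"
        using T(3) base(2) e by (simp add: emeasure_eq_ennreal_measure ennreal_plus)
      then show ?thesis by (simp add: ennreal_less_iff)
    qed
    finally show "\<exists>g. integrable lborel g \<and> (LINT x|lborel. \<bar>indicator A x - g x\<bar>) < e \<and>
       (\<lambda>n. LINT x|lborel. \<bar>g (x + z n) - g x :: real\<bar>) \<longlonglongrightarrow> 0"
      using L1_translation_compact[OF T(1) z] emeasure_compact_finite[OF T(1)]
      by (intro exI[of _ "indicator T"]) (auto simp: integrable_indicator_iff)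
  qed
  from tendsto_mult_left_zero[OF this, of "\<bar>c\<bar>"] show ?case
    by (simp add: abs_mult flip: left_diff_distrib)
next
  case (add f g)
  show ?case
  proof (rule Lim_null_comparison[OF always_eventually tendsto_add_zero[OF add(3,4)]], rule allI)
    fix n
    note fz = integrable_lborel_translate[OF add(1), of "z n"]
      and gz = integrable_lborel_translate[OF add(2), of "z n"]
    have "(LINT x|lborel. \<bar>f (x + z n) + g (x + z n) - (f x + g x)\<bar>)
      \<le> (LINT x|lborel. \<bar>f (x + z n) - f x\<bar> + \<bar>g (x + z n) - g x\<bar>)"
      using add(1,2) fz gz by (intro integral_mono) auto
    then show "norm (LINT x|lborel. \<bar>f (x + z n) + g (x + z n) - (f x + g x)\<bar>)
      \<le> (LINT x|lborel. \<bar>f (x + z n) - f x\<bar>) + (LINT x|lborel. \<bar>g (x + z n) - g x\<bar>)"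
      using add(1,2) fz gz by simp
  qed
next
  case (lim f s)
  show ?case
  proof (rule L1_translation_approx[OF lim(4)])
    fix e :: real assume e: "e > 0"
    have "(\<lambda>i. LINT x|lborel. \<bar>f x - s i x\<bar>) \<longlonglongrightarrow> integral\<^sup>L (lborel :: 'a measure) (\<lambda>x. 0::real)"
    \<comment> \<open>The approximating functions satisfy |s| <= 2 |f|, whence the factor 3.\<close>
    proof (rule integral_dominated_convergence[where w="\<lambda>x. 3 * \<bar>f x\<bar>"])
      show "AE x in lborel. (\<lambda>i. \<bar>f x - s i x\<bar>) \<longlonglongrightarrow> 0"
        using lim(2) by (auto intro!: AE_I2 tendsto_rabs_zero tendsto_eq_intros)
      show "AE x in lborel. norm \<bar>f x - s i x\<bar> \<le> 3 * \<bar>f x\<bar>" for i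
        using lim(3)[of _ i] by (intro AE_I2) (smt (verit) real_norm_def space_lborel UNIV_I)
    qed (use lim in auto)
    then obtain i where "\<bar>LINT x|lborel. \<bar>f x - s i x\<bar>\<bar> < e"
      using LIMSEQ_D[of _ 0 e] e by fastforce
    then show "\<exists>g. integrable lborel g \<and> (LINT x|lborel. \<bar>f x - g x\<bar>) < e \<and>
       (\<lambda>n. LINT x|lborel. \<bar>g (x + z n) - g x :: real\<bar>) \<longlonglongrightarrow> 0"
      using lim(1,5) by (intro exI[of _ "s i"]) auto
  qed
qed

section \<open>The Gabriel weight of a finite sequence of points\<close>

lemma diameter_doubleton: "diameter {x, y :: 'a::euclidean_space} = dist x y"
proof (rule antisym)
  show "diameter {x, y} \<le> dist x y"
    by (rule diameter_le) (auto simp: dist_norm norm_minus_commute)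
  show "dist x y \<le> diameter {x, y}"
    by (rule diameter_bounded_bound) auto
qed

lemma gabriel_adj_commute: "gabriel_adj S x y \<longleftrightarrow> gabriel_adj S y x"
proof -
  have "S - {x, y} = S - {y, x}" by blast
  then show ?thesis
    unfolding gabriel_adj_def midpoint_sym[of x y] dist_commute[of x y] by blast
qed

text \<open>The map from an ordered pair to its edge is two-to-one, since adjacent points differ.
  Ordered pairs turn the weight into a double sum over sample indices.\<close>

lemma gabriel_weight_ordered_pairs:
  assumes "finite S"
  shows "gabriel_weight \<alpha> S = (\<Sum>x\<in>S. \<Sum>y\<in>S. if gabriel_adj S x y then dist x y powr \<alpha> else 0) / 2"
proof -
  define P where "P = {(x, y). gabriel_adj S x y}"
  let ?h = "\<lambda>(x, y). {x, y}"
  have "P \<subseteq> S \<times> S" by (auto simp: P_def gabriel_adj_def)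
  then have fin: "finite P" by (rule finite_subset) (use assms in auto)
  have edges: "gabriel_edges S = ?h ` P"
    by (auto simp: gabriel_edges_def P_def)
  have "(\<Sum>x\<in>S. \<Sum>y\<in>S. if gabriel_adj S x y then dist x y powr \<alpha> else 0)
     = (\<Sum>(x, y)\<in>S \<times> S. if gabriel_adj S x y then dist x y powr \<alpha> else 0)"
    by (rule sum.cartesian_product)
  also have "\<dots> = (\<Sum>(x, y)\<in>P. dist x y powr \<alpha>)"
    using assms \<open>P \<subseteq> S \<times> S\<close> by (intro sum.mono_neutral_cong_right) (auto simp: P_def split: if_splits)
  also have "\<dots> = (\<Sum>e\<in>gabriel_edges S. \<Sum>(x, y)\<in>{p. p \<in> P \<and> ?h p = e}. dist x y powr \<alpha>)"
    unfolding edges by (rule sum.image_gen[OF fin])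
  also have "\<dots> = (\<Sum>e\<in>gabriel_edges S. 2 * diameter e powr \<alpha>)"
  proof (rule sum.cong[OF refl])
    fix e assume "e \<in> gabriel_edges S"
    then obtain x y where e: "e = {x, y}" "gabriel_adj S x y" by (auto simp: gabriel_edges_def)
    then have "x \<noteq> y" by (auto simp: gabriel_adj_def)
    have "{p. p \<in> P \<and> ?h p = e} = {(x, y), (y, x)}"
    proof (rule set_eqI)
      fix p :: "'a \<times> 'a"
      obtain a b where p: "p = (a, b)" by (cases p)
      have "gabriel_adj S y x" using e(2) gabriel_adj_commute by blast
      then show "p \<in> {p. p \<in> P \<and> ?h p = e} \<longleftrightarrow> p \<in> {(x, y), (y, x)}"
        using e(2) unfolding p P_def e(1) by (auto simp: doubleton_eq_iff)
    qed
    then show "(\<Sum>(x, y)\<in>{p. p \<in> P \<and> ?h p = e}. dist x y powr \<alpha>) = 2 * diameter e powr \<alpha>"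
      using \<open>x \<noteq> y\<close> by (simp add: e diameter_doubleton dist_commute)
  qed
  also have "\<dots> = 2 * gabriel_weight \<alpha> S"
    by (simp add: gabriel_weight_def sum_distrib_left)
  finally show ?thesis by simp
qed

text \<open>The smallest index with a given value represents that value, so the formula also covers
  samples with repeated points. This unconditional form is what measurability of the weight rests
  on.\<close>

lemma gabriel_weight_image:
  fixes X :: "nat \<Rightarrow> 'a::euclidean_space"
  shows "gabriel_weight \<alpha> (X ` {0..<n}) = (\<Sum>i<n. \<Sum>j<n.
    if gabriel_adj (X ` {0..<n}) (X i) (X j) \<and> (\<forall>k<i. X k \<noteq> X i) \<and> (\<forall>k<j. X k \<noteq> X j)
    then dist (X i) (X j) powr \<alpha> else 0) / 2"
proof -
  define F where "F = {i. i < n \<and> (\<forall>k<i. X k \<noteq> X i)}"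
  let ?S = "X ` {0..<n}"
  have "F \<subseteq> {..<n}" by (auto simp: F_def)
  have inj: "inj_on X F"
    unfolding F_def by (rule inj_onI) (metis (mono_tags, lifting) linorder_neqE_nat mem_Collect_eq)
  have "\<exists>j\<in>F. X i = X j" if "i < n" for i
  proof -
    define j where "j = (LEAST j. X j = X i)"
    have "X j = X i" unfolding j_def by (rule LeastI) simp
    moreover have "j \<le> i" unfolding j_def by (rule Least_le) simp
    moreover have "X k \<noteq> X i" if "k < j" for k
      using that unfolding j_def by (rule not_less_Least)
    ultimately show ?thesis using that by (intro bexI[of _ j]) (auto simp: F_def)
  qed
  then have S: "?S = X ` F" using \<open>F \<subseteq> {..<n}\<close> by fastforce
  have inner: "(\<Sum>j<n. if gabriel_adj ?S (X i) (X j) \<and> (\<forall>k<i. X k \<noteq> X i) \<and> (\<forall>k<j. X k \<noteq> X j)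
        then dist (X i) (X j) powr \<alpha> else 0)
     = (if \<forall>k<i. X k \<noteq> X i
        then (\<Sum>j\<in>F. if gabriel_adj ?S (X i) (X j) then dist (X i) (X j) powr \<alpha> else 0) else 0)" for i
  proof (cases "\<forall>k<i. X k \<noteq> X i")
    case True
    then show ?thesis
      by (simp, intro sum.mono_neutral_cong_right) (auto simp: F_def)
  next
    case False
    then show ?thesis by (simp only: simp_thms if_False sum.neutral_const)
  qed
  have "(\<Sum>x\<in>?S. \<Sum>y\<in>?S. if gabriel_adj ?S x y then dist x y powr \<alpha> else 0)
     = (\<Sum>i\<in>F. \<Sum>j\<in>F. if gabriel_adj ?S (X i) (X j) then dist (X i) (X j) powr \<alpha> else 0)"
    by (subst (1 2) S) (simp add: sum.reindex[OF inj])
  also have "\<dots> = (\<Sum>i<n. if \<forall>k<i. X k \<noteq> X i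
        then (\<Sum>j\<in>F. if gabriel_adj ?S (X i) (X j) then dist (X i) (X j) powr \<alpha> else 0) else 0)"
    by (intro sum.mono_neutral_cong_left) (auto simp: F_def)
  finally show ?thesis
    by (simp add: gabriel_weight_ordered_pairs inner)
qed

lemma gabriel_weight_image_inj:
  fixes X :: "nat \<Rightarrow> 'a::euclidean_space"
  assumes inj: "inj_on X {0..<n}"
  shows "gabriel_weight \<alpha> (X ` {0..<n}) = (\<Sum>i<n. \<Sum>j<n. 
    if i \<noteq> j \<and> (\<forall>k\<in>{..<n} - {i, j}. X k \<notin> cball (midpoint (X i) (X j)) (dist (X i) (X j) / 2))
    then dist (X i) (X j) powr \<alpha> else 0) / 2"
proof -
  have *: "X i = X j \<longleftrightarrow> i = j" if "i < n" "j < n" for i j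
    using inj that by (auto simp: inj_on_def)
  show ?thesis
    unfolding gabriel_weight_image
    by (intro arg_cong2[where f="(/)"] sum.cong refl if_cong)
       (use * in \<open>auto simp: gabriel_adj_def\<close>)
qed

section \<open>Conditioning on finitely many coordinates of a product measure\<close>

context
  fixes \<mu> :: "'a measure"
  assumes \<mu>: "prob_space \<mu>"
begin

interpretation prob_space \<mu> by (rule \<mu>)
interpretation product_sigma_finite "\<lambda>_. \<mu>" ..

text \<open>Given the coordinates in \<open>E\<close>, the remaining ones are still independent with
  law \<mu>, so the integral of the product factors into a power. Here \<open>E\<close> will hold
  the endpoints of one or two edges, and \<open>\<phi>\<close> will indicate that a further point
  misses their balls.\<close>

lemma nn_integral_PiM_split:
  fixes I E :: "'i set"
  assumes I: "finite I" "E \<subseteq> I"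
    and h[measurable]: "h \<in> borel_measurable (Pi\<^sub>M E (\<lambda>_. \<mu>))"
    and \<phi>[measurable]: "(\<lambda>(e, z). \<phi> e z) \<in> borel_measurable (Pi\<^sub>M E (\<lambda>_. \<mu>) \<Otimes>\<^sub>M \<mu>)"
  shows "(\<integral>\<^sup>+\<omega>. h (restrict \<omega> E) * (\<Prod>k\<in>I - E. \<phi> (restrict \<omega> E) (\<omega> k)) \<partial>Pi\<^sub>M I (\<lambda>_. \<mu>))
    = (\<integral>\<^sup>+e. h e * (\<integral>\<^sup>+z. \<phi> e z \<partial>\<mu>) ^ card (I - E) \<partial>Pi\<^sub>M E (\<lambda>_. \<mu>))"
proof -
  let ?F = "\<lambda>\<omega>. h (restrict \<omega> E) * (\<Prod>k\<in>I - E. \<phi> (restrict \<omega> E) (\<omega> k))"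
  have IE: "E \<union> (I - E) = I" "E \<inter> (I - E) = {}" using I by auto
  have fin: "finite E" "finite (I - E)" using I finite_subset by auto
  have r[measurable]: "(\<lambda>\<omega>. restrict \<omega> E) \<in> measurable (Pi\<^sub>M I (\<lambda>_. \<mu>)) (Pi\<^sub>M E (\<lambda>_. \<mu>))"
    by (rule measurable_restrict_subset) (use I in auto)
  have c: "(\<lambda>\<omega>. \<phi> (restrict \<omega> E) (\<omega> k)) \<in> borel_measurable (Pi\<^sub>M I (\<lambda>_. \<mu>))" if "k \<in> I - E" for k
  proof -
    have "k \<in> I" using that by simp
    then have [measurable]: "(\<lambda>\<omega>. \<omega> k) \<in> measurable (Pi\<^sub>M I (\<lambda>_. \<mu>)) \<mu>" by simp
    show ?thesis
      using measurable_compose[OF measurable_Pair[OF r \<open>(\<lambda>\<omega>. \<omega> k) \<in> _\<close>] \<phi>] by simp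
  qed
  have "?F \<in> borel_measurable (Pi\<^sub>M I (\<lambda>_. \<mu>))"
    by (intro borel_measurable_times_ennreal borel_measurable_prod_ennreal measurable_compose[OF r h] c)
  then have "(\<integral>\<^sup>+\<omega>. ?F \<omega> \<partial>Pi\<^sub>M I (\<lambda>_. \<mu>))
     = (\<integral>\<^sup>+e. (\<integral>\<^sup>+y. ?F (merge E (I - E) (e, y)) \<partial>Pi\<^sub>M (I - E) (\<lambda>_. \<mu>)) \<partial>Pi\<^sub>M E (\<lambda>_. \<mu>))"
    using product_nn_integral_fold[OF IE(2) fin, of ?F] unfolding IE(1) by simp
  also have "\<dots> = (\<integral>\<^sup>+e. h e * (\<integral>\<^sup>+z. \<phi> e z \<partial>\<mu>) ^ card (I - E) \<partial>Pi\<^sub>M E (\<lambda>_. \<mu>))"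
  proof (rule nn_integral_cong)
    fix e assume e: "e \<in> space (Pi\<^sub>M E (\<lambda>_. \<mu>))"
    then have re: "restrict (merge E (I - E) (e, y)) E = e" for y
      by (auto simp: merge_def space_PiM PiE_def extensional_def fun_eq_iff)
    have \<phi>e[measurable]: "\<phi> e \<in> borel_measurable \<mu>"
      using measurable_compose[OF measurable_Pair1'[OF e] \<phi>] by simp
    have "(\<integral>\<^sup>+y. ?F (merge E (I - E) (e, y)) \<partial>Pi\<^sub>M (I - E) (\<lambda>_. \<mu>))
      = (\<integral>\<^sup>+y. h e * (\<Prod>k\<in>I - E. \<phi> e (y k)) \<partial>Pi\<^sub>M (I - E) (\<lambda>_. \<mu>))"
      unfolding re by (intro nn_integral_cong arg_cong2[where f="(*)"] prod.cong) (auto simp: merge_def)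
    also have "\<dots> = h e * (\<integral>\<^sup>+y. (\<Prod>k\<in>I - E. \<phi> e (y k)) \<partial>Pi\<^sub>M (I - E) (\<lambda>_. \<mu>))"
      by (rule nn_integral_cmult)
         (intro borel_measurable_prod_ennreal measurable_compose[OF _ \<phi>e] measurable_component_singleton)
    also have "(\<integral>\<^sup>+y. (\<Prod>k\<in>I - E. \<phi> e (y k)) \<partial>Pi\<^sub>M (I - E) (\<lambda>_. \<mu>)) = (\<Prod>k\<in>I - E. \<integral>\<^sup>+z. \<phi> e z \<partial>\<mu>)"
      by (rule product_nn_integral_prod) (use fin \<phi>e in auto)
    finally show "(\<integral>\<^sup>+y. ?F (merge E (I - E) (e, y)) \<partial>Pi\<^sub>M (I - E) (\<lambda>_. \<mu>))
      = h e * (\<integral>\<^sup>+z. \<phi> e z \<partial>\<mu>) ^ card (I - E)" by (simp only: prod_constant)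
  qed
  finally show ?thesis .
qed

lemma nn_integral_PiM_2:
  assumes [measurable]: "(\<lambda>(x, y). F x y) \<in> borel_measurable (\<mu> \<Otimes>\<^sub>M \<mu>)" and ij: "i \<noteq> j"
  shows "(\<integral>\<^sup>+e. F (e i) (e j) \<partial>Pi\<^sub>M {i, j} (\<lambda>_. \<mu>)) = (\<integral>\<^sup>+x. \<integral>\<^sup>+y. F x y \<partial>\<mu> \<partial>\<mu>)"
proof -
  have "(\<integral>\<^sup>+e. F (e i) (e j) \<partial>Pi\<^sub>M {i, j} (\<lambda>_. \<mu>)) = (\<integral>\<^sup>+x. \<integral>\<^sup>+e. F x (e j) \<partial>Pi\<^sub>M {j} (\<lambda>_. \<mu>) \<partial>\<mu>)"
    using ij by (subst product_nn_integral_insert_rev) (auto intro!: nn_integral_cong)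
  also have "\<dots> = (\<integral>\<^sup>+x. \<integral>\<^sup>+y. F x y \<partial>\<mu> \<partial>\<mu>)"
    by (intro nn_integral_cong product_nn_integral_singleton) auto
  finally show ?thesis .
qed

lemma nn_integral_PiM_3:
  assumes [measurable]: "(\<lambda>(x, y, z). F x y z) \<in> borel_measurable (\<mu> \<Otimes>\<^sub>M \<mu> \<Otimes>\<^sub>M \<mu>)"
    and ij: "i \<noteq> j" "i \<noteq> k" "j \<noteq> k"
  shows "(\<integral>\<^sup>+e. F (e i) (e j) (e k) \<partial>Pi\<^sub>M {i, j, k} (\<lambda>_. \<mu>)) = (\<integral>\<^sup>+x. \<integral>\<^sup>+y. \<integral>\<^sup>+z. F x y z \<partial>\<mu> \<partial>\<mu> \<partial>\<mu>)"
proof -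
  have [measurable]: "(\<lambda>e. F (e i) (e j) (e k)) \<in> borel_measurable (Pi\<^sub>M {i, j, k} (\<lambda>_. \<mu>))"
  proof -
    have "(\<lambda>e. (e i, e j, e k)) \<in> measurable (Pi\<^sub>M {i, j, k} (\<lambda>_. \<mu>)) (\<mu> \<Otimes>\<^sub>M \<mu> \<Otimes>\<^sub>M \<mu>)" by simp
    from measurable_compose[OF this assms(1)] show ?thesis by simp
  qed
  have F: "(\<lambda>(y, z). F x y z) \<in> borel_measurable (\<mu> \<Otimes>\<^sub>M \<mu>)" if "x \<in> space \<mu>" for x
    using measurable_compose[OF measurable_Pair1'[OF that] assms(1)] by simp
  have "(\<integral>\<^sup>+e. F (e i) (e j) (e k) \<partial>Pi\<^sub>M {i, j, k} (\<lambda>_. \<mu>))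
      = (\<integral>\<^sup>+x. \<integral>\<^sup>+e. F x (e j) (e k) \<partial>Pi\<^sub>M {j, k} (\<lambda>_. \<mu>) \<partial>\<mu>)"
    using ij by (subst product_nn_integral_insert_rev) (auto intro!: nn_integral_cong)
  also have "\<dots> = (\<integral>\<^sup>+x. \<integral>\<^sup>+y. \<integral>\<^sup>+z. F x y z \<partial>\<mu> \<partial>\<mu> \<partial>\<mu>)"
    using ij F by (intro nn_integral_cong nn_integral_PiM_2) auto
  finally show ?thesis .
qed

lemma nn_integral_PiM_4:
  assumes [measurable]: "(\<lambda>(x, y, z, w). F x y z w) \<in> borel_measurable (\<mu> \<Otimes>\<^sub>M \<mu> \<Otimes>\<^sub>M \<mu> \<Otimes>\<^sub>M \<mu>)"
    and ij: "i \<noteq> j" "i \<noteq> k" "j \<noteq> k" "i \<noteq> l" "j \<noteq> l" "k \<noteq> l"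
  shows "(\<integral>\<^sup>+e. F (e i) (e j) (e k) (e l) \<partial>Pi\<^sub>M {i, j, k, l} (\<lambda>_. \<mu>))
     = (\<integral>\<^sup>+x. \<integral>\<^sup>+y. \<integral>\<^sup>+z. \<integral>\<^sup>+w. F x y z w \<partial>\<mu> \<partial>\<mu> \<partial>\<mu> \<partial>\<mu>)"
proof -
  have [measurable]: "(\<lambda>e. F (e i) (e j) (e k) (e l)) \<in> borel_measurable (Pi\<^sub>M {i, j, k, l} (\<lambda>_. \<mu>))"
  proof -
    have "(\<lambda>e. (e i, e j, e k, e l)) \<in> measurable (Pi\<^sub>M {i, j, k, l} (\<lambda>_. \<mu>)) (\<mu> \<Otimes>\<^sub>M \<mu> \<Otimes>\<^sub>M \<mu> \<Otimes>\<^sub>M \<mu>)" by simp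
    from measurable_compose[OF this assms(1)] show ?thesis by simp
  qed
  have F: "(\<lambda>(y, z, w). F x y z w) \<in> borel_measurable (\<mu> \<Otimes>\<^sub>M \<mu> \<Otimes>\<^sub>M \<mu>)" if "x \<in> space \<mu>" for x
    using measurable_compose[OF measurable_Pair1'[OF that] assms(1)] by simp
  have "(\<integral>\<^sup>+e. F (e i) (e j) (e k) (e l) \<partial>Pi\<^sub>M {i, j, k, l} (\<lambda>_. \<mu>))
      = (\<integral>\<^sup>+x. \<integral>\<^sup>+e. F x (e j) (e k) (e l) \<partial>Pi\<^sub>M {j, k, l} (\<lambda>_. \<mu>) \<partial>\<mu>)"
    using ij by (subst product_nn_integral_insert_rev) (auto intro!: nn_integral_cong)
  also have "\<dots> = (\<integral>\<^sup>+x. \<integral>\<^sup>+y. \<integral>\<^sup>+z. \<integral>\<^sup>+w. F x y z w \<partial>\<mu> \<partial>\<mu> \<partial>\<mu> \<partial>\<mu>)"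
    using ij F by (intro nn_integral_cong nn_integral_PiM_3) auto
  finally show ?thesis .
qed

end

section \<open>Densities on a convex body\<close>

text \<open>The ball is the image of \<open>ball a r\<close> under the homothety with centre
  \<open>m\<close> and ratio \<open>t\<close>.\<close>

lemma convex_ball_shrink:
  fixes K :: "'a::real_normed_vector set"
  assumes "convex K" "ball a r \<subseteq> K" "m \<in> K" "0 \<le> t" "t \<le> 1"
  shows "ball (m + t *\<^sub>R (a - m)) (t * r) \<subseteq> K"
proof
  fix z assume z: "z \<in> ball (m + t *\<^sub>R (a - m)) (t * r)"
  then have t: "t > 0" using \<open>0 \<le> t\<close> by (cases "t = 0") auto
  \<comment> \<open>The preimage of \<open>z\<close> under the homothety.\<close>
  define w where "w = a + (1 / t) *\<^sub>R (z - (m + t *\<^sub>R (a - m)))"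
  have "norm (z - (m + t *\<^sub>R (a - m))) < t * r"
    using z by (simp add: dist_norm norm_minus_commute)
  moreover have "dist a w = norm (z - (m + t *\<^sub>R (a - m))) / t"
    using t unfolding w_def dist_norm by (simp del: scaleR_right_diff_distrib)
  ultimately have "dist a w < r" using t by (simp add: divide_less_eq mult.commute)
  then have "w \<in> K" using assms(2) by auto
  then have "(1 - t) *\<^sub>R m + t *\<^sub>R w \<in> K" using assms by (intro convexD_alt) auto
  also have "(1 - t) *\<^sub>R m + t *\<^sub>R w = z"
    using t by (simp add: w_def algebra_simps)
  finally show "z \<in> K" .
qed

text \<open>If \<open>K\<close> contains a point far from a ball inside it, the convex hull of that
  point and the ball already contains many disjoint balls of half the radius, too many for the
  finite volume.\<close>

lemma convex_finite_measure_imp_bounded: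
  fixes K :: "'a::euclidean_space set"
  assumes K: "convex K" "interior K \<noteq> {}" and [measurable]: "K \<in> sets borel"
    and fin: "emeasure lborel K < \<infinity>"
  shows "bounded K"
proof -
  obtain a r where r: "r > 0" "ball a r \<subseteq> K"
    using K(2) by (metis all_not_in_conv mem_interior)
  define v where "v = unit_ball_vol (real DIM('a)) * (r / 2) ^ DIM('a)"
  have v: "v > 0" using r by (simp add: v_def)
  obtain N :: nat where N: "measure lborel K < N * v"
    using reals_Archimedean3[OF v] by blast
  have N0: "N > 0" using N measure_nonneg[of lborel K] by (cases "N = 0") (auto simp: not_less)
  have "dist a y \<le> 2 * N * r" if y: "y \<in> K" for y
  proof (rule ccontr)
    assume "\<not> ?thesis"
    then have L: "2 * N * r < dist a y" by simp
    \<comment> \<open>The ratios stay in [1/2, 1], so each shrunken ball has radius at least r/2.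
      Neighbouring ratios differ by 1/(2N), so over a length exceeding 2Nr the centres are at least
      r apart and the balls of radius r/2 are disjoint.\<close>
    define t where "t = (\<lambda>i::nat. 1 - real i / (2 * N))"
    define c where "c = (\<lambda>i. y + t i *\<^sub>R (a - y))"
    have t: "1/2 \<le> t i" "t i \<le> 1" if "i < N" for i
      using that by (auto simp: t_def field_simps)
    have sub: "ball (c i) (r / 2) \<subseteq> K" if "i < N" for i
    proof -
      have "r / 2 \<le> t i * r" using t[OF that] r by (simp add: mult_right_mono[of "1/2" "t i" r, simplified])
      then have "ball (c i) (r / 2) \<subseteq> ball (c i) (t i * r)" by (rule subset_ball)
      also have "\<dots> \<subseteq> K" unfolding c_def
        by (rule convex_ball_shrink[OF K(1) r(2) y]) (use t[OF that] in auto)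
      finally show ?thesis .
    qed
    have disj: "disjoint_family_on (\<lambda>i. ball (c i) (r / 2)) {..<N}"
    proof (clarsimp simp: disjoint_family_on_def)
      fix i j assume ij: "i < N" "j < N" "i \<noteq> j"
      have "c i - c j = (t i - t j) *\<^sub>R (a - y)" by (simp add: c_def algebra_simps)
      then have "dist (c i) (c j) = \<bar>t i - t j\<bar> * dist a y" by (simp add: dist_norm)
      also have "\<bar>t i - t j\<bar> = \<bar>real i - real j\<bar> / (2 * N)"
        using N0 by (simp add: t_def field_simps abs_minus_commute flip: diff_divide_distrib)
      also have "\<bar>real i - real j\<bar> / (2 * N) * dist a y \<ge> 1 / (2 * N) * (2 * N * r)"
        using ij L r by (intro mult_mono divide_right_mono) auto
      finally have "dist (c i) (c j) \<ge> r" using N0 by simp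
      then show "ball (c i) (r / 2) \<inter> ball (c j) (r / 2) = {}"
        by (intro disjoint_ballI) auto
    qed
    have "N * ennreal v = (\<Sum>i<N. emeasure lborel (ball (c i) (r / 2)))"
      using r by (simp add: emeasure_ball v_def)
    also have "\<dots> = emeasure lborel (\<Union>i<N. ball (c i) (r / 2))"
      using disj by (intro sum_emeasure) auto
    also have "\<dots> \<le> emeasure lborel K" using sub by (intro emeasure_mono) auto
    also have "\<dots> = ennreal (measure lborel K)" using fin by (simp add: emeasure_eq_ennreal_measure)
    finally have "ennreal (N * v) \<le> ennreal (measure lborel K)"
      by (simp add: ennreal_mult' ennreal_of_nat_eq_real_of_nat)
    then show False using N measure_nonneg[of lborel K] by (subst (asm) ennreal_le_iff) auto
  qed
  then show ?thesis unfolding bounded_def by blast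
qed

section \<open>The density, its support and the mass of diametral balls\<close>

locale convex_density =
  fixes f :: "'a::euclidean_space \<Rightarrow> real" and K :: "'a set" and c1 c2 :: real
  assumes f_measurable[measurable]: "f \<in> borel_measurable borel"
    and K_convex: "convex K" and K_closed: "closed K"
    and f_outside: "\<And>x. x \<notin> K \<Longrightarrow> f x = 0"
    and c1_pos: "0 < c1"
    and f_lower: "\<And>x. x \<in> K \<Longrightarrow> c1 \<le> f x"
    and f_upper: "\<And>x. x \<in> K \<Longrightarrow> f x \<le> c2"
    and f_density: "(\<integral>\<^sup>+x. ennreal (f x) \<partial>lborel) = 1"
begin

lemma K_measurable[measurable]: "K \<in> sets borel"
  using K_closed by simp

lemma f_nonneg: "0 \<le> f x"
  using f_outside[of x] f_lower[of x] c1_pos by (cases "x \<in> K") auto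

lemma K_nonempty: "K \<noteq> {}"
proof
  assume "K = {}"
  then have "f x = 0" for x using f_outside by auto
  then show False using f_density by simp
qed

lemma c2_pos: "0 < c2"
  using K_nonempty c1_pos f_lower f_upper by (meson all_not_in_conv less_le_trans)

lemma f_le: "f x \<le> c2"
  using f_outside[of x] f_upper[of x] c2_pos by (cases "x \<in> K") auto

lemma K_finite: "emeasure lborel K < \<infinity>"
proof -
  have "ennreal c1 * emeasure lborel K = (\<integral>\<^sup>+x. ennreal c1 * indicator K x \<partial>lborel)"
    by (subst nn_integral_cmult_indicator) auto
  also have "\<dots> \<le> (\<integral>\<^sup>+x. ennreal (f x) \<partial>lborel)"
    using f_lower by (intro nn_integral_mono) (auto simp: indicator_def intro!: ennreal_leI)
  finally have "ennreal c1 * emeasure lborel K \<le> 1" by (simp add: f_density)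
  then show ?thesis
    using c1_pos by (cases "emeasure lborel K = \<infinity>") (auto simp: ennreal_mult_top less_top top_unique)
qed

text \<open>A convex set with empty interior is Lebesgue null, and a density vanishing off it would
  have total mass 0.\<close>

lemma K_interior: "interior K \<noteq> {}"
proof
  assume "interior K = {}"
  then have "negligible K" using negligible_convex_interior[OF K_convex] by simp
  then have "K \<in> null_sets lborel" by (simp add: negligible_iff_null_sets null_sets_completion_iff)
  then have "AE x in lborel. x \<notin> K" by (rule AE_not_in)
  then have "AE x in lborel. ennreal (f x) = 0" by eventually_elim (simp add: f_outside)
  then have "(\<integral>\<^sup>+x. ennreal (f x) \<partial>lborel) = 0" by (subst nn_integral_0_iff_AE) auto
  then show False using f_density by simp
qed

lemma K_bounded: "bounded K"
  using convex_finite_measure_imp_bounded[OF K_convex K_interior _ K_finite] by simp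

definition \<mu> where "\<mu> = density lborel (\<lambda>x. ennreal (f x))"

lemma sets_\<mu>[simp, measurable_cong]: "sets \<mu> = sets borel" and space_\<mu>[simp]: "space \<mu> = UNIV"
  by (auto simp: \<mu>_def)

lemma prob_space_\<mu>: "prob_space \<mu>"
  by (rule prob_spaceI) (simp add: \<mu>_def emeasure_density f_density)

sublocale \<mu>: prob_space \<mu> by (rule prob_space_\<mu>)

lemma nn_integral_\<mu>: "g \<in> borel_measurable borel \<Longrightarrow> (\<integral>\<^sup>+x. g x \<partial>\<mu>) = (\<integral>\<^sup>+x. ennreal (f x) * g x \<partial>lborel)"
  unfolding \<mu>_def by (subst nn_integral_density) auto

lemma AE_\<mu>_K: "AE x in \<mu>. x \<in> K"
  unfolding \<mu>_def by (subst AE_density) (auto intro!: AE_I2 intro: ccontr simp: f_outside)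

definition gball :: "'a \<Rightarrow> 'a \<Rightarrow> 'a set" where
  "gball x y = cball (midpoint x y) (dist x y / 2)"

lemma gball_commute: "gball x y = gball y x"
  by (simp add: gball_def midpoint_sym dist_commute)

lemma gball_measurable[measurable]: "gball x y \<in> sets borel"
  by (simp add: gball_def)

definition p :: "'a \<Rightarrow> 'a \<Rightarrow> real" where
  "p x y = measure \<mu> (gball x y)"

lemma p_le_1: "p x y \<le> 1" and p_nonneg: "0 \<le> p x y"
  by (auto simp: p_def)

text \<open>A homothety of ratio of order \<open>dist x y\<close> centred at the midpoint carries a fixed ball
  inside \<open>K\<close> into \<open>K \<inter> gball x y\<close>.\<close>

lemma p_lower:
  obtains c where "c > 0" "\<And>x y. x \<in> K \<Longrightarrow> y \<in> K \<Longrightarrow> c * dist x y ^ DIM('a) \<le> p x y"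
proof -
  obtain a r where r: "r > 0" "ball a r \<subseteq> K"
    using K_interior by (metis all_not_in_conv mem_interior)
  obtain D where D: "\<And>x. x \<in> K \<Longrightarrow> dist a x \<le> D"
    using K_bounded unfolding bounded_any_center[of K a] by blast
  have "a \<in> K" using r by auto
  then have D0: "D \<ge> 0" using D[of a] by simp
  define s where "s = r / (D + r) / 2"
  have s: "s > 0" using r D0 by (simp add: s_def)
  define c where "c = c1 * (unit_ball_vol (real DIM('a)) * s ^ DIM('a))"
  show thesis
  proof (rule that)
    show "c > 0" using c1_pos s by (simp add: c_def)
    fix x y assume xy: "x \<in> K" "y \<in> K"
    define m where "m = midpoint x y"
    have m: "m \<in> K" unfolding m_def midpoint_def
      using convexD_alt[OF K_convex xy, of "1/2"] by (simp add: algebra_simps)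
    \<comment> \<open>The image ball has radius t r and its centre lies within t D of the midpoint,
      so this ratio makes it fit exactly into the radius \<open>dist x y / 2\<close>.\<close>
    define t where "t = dist x y / 2 / (D + r)"
    have "dist x y \<le> 2 * D" using D[OF xy(1)] D[OF xy(2)] dist_triangle3[of x y a] by simp
    then have t: "0 \<le> t" "t \<le> 1" using D0 r by (auto simp: t_def field_simps)
    define B where "B = ball (m + t *\<^sub>R (a - m)) (t * r)"
    have BK: "B \<subseteq> K" unfolding B_def
      by (rule convex_ball_shrink[OF K_convex r(2) m t])
    have Bg: "B \<subseteq> gball x y"
    proof
      fix z assume "z \<in> B"
      then have "dist (m + t *\<^sub>R (a - m)) z < t * r" by (simp add: B_def)
      moreover have "dist m (m + t *\<^sub>R (a - m)) \<le> t * D"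
        using D[OF m] t by (simp add: dist_norm mult_left_mono)
      ultimately have "dist m z \<le> t * (D + r)"
        using dist_triangle[of m z "m + t *\<^sub>R (a - m)"] by (simp add: algebra_simps)
      also have "\<dots> = dist x y / 2"
      proof -
        have "D + r \<noteq> 0" using D0 r by simp
        then show ?thesis unfolding t_def by (rule nonzero_eq_divide_eq[THEN iffD1, OF _ refl])
      qed
      finally show "z \<in> gball x y" by (simp add: gball_def m_def)
    qed
    have tr: "t * r = s * dist x y" 
      unfolding t_def s_def by (simp only: times_divide_eq_left times_divide_eq_right mult.commute divide_divide_eq_left)
    have "emeasure lborel B = ennreal (unit_ball_vol (real DIM('a)) * (t * r) ^ DIM('a))"
      unfolding B_def using t r by (intro emeasure_ball) simp
    then have "ennreal (c * dist x y ^ DIM('a)) = ennreal c1 * emeasure lborel B"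
      using c1_pos unfolding tr c_def power_mult_distrib
      by (simp only: ennreal_mult'[symmetric] less_imp_le mult.assoc)
    also have "\<dots> = (\<integral>\<^sup>+z. ennreal c1 * indicator B z \<partial>lborel)"
      by (subst nn_integral_cmult_indicator) (auto simp: B_def)
    also have "\<dots> \<le> (\<integral>\<^sup>+z. ennreal (f z) * indicator (gball x y) z \<partial>lborel)"
      using BK Bg f_lower by (intro nn_integral_mono) (auto simp: indicator_def intro!: ennreal_leI)
    also have "\<dots> = emeasure \<mu> (gball x y)"
      unfolding \<mu>_def by (subst emeasure_density) auto
    also have "\<dots> = ennreal (p x y)" by (simp add: p_def \<mu>.emeasure_eq_measure)
    finally show "c * dist x y ^ DIM('a) \<le> p x y" by (simp add: p_nonneg)
  qed
qed

end

section \<open>Exponential approximation and zooming in at a point\<close>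

lemma nn_integral_lborel_affine:
  fixes g :: "'a::euclidean_space \<Rightarrow> ennreal"
  assumes [measurable]: "g \<in> borel_measurable borel" and h: "h > 0"
  shows "(\<integral>\<^sup>+y. g y \<partial>lborel) = ennreal (h ^ DIM('a)) * (\<integral>\<^sup>+u. g (x + h *\<^sub>R u) \<partial>lborel)"
proof -
  have "(\<integral>\<^sup>+y. g y \<partial>lborel)
      = (\<integral>\<^sup>+y. g y \<partial>density (distr lborel borel (\<lambda>u. x + h *\<^sub>R u)) (\<lambda>_. ennreal (\<bar>h\<bar> ^ DIM('a))))"
    using h by (subst lborel_affine[of h x]) auto
  also have "\<dots> = ennreal (h ^ DIM('a)) * (\<integral>\<^sup>+u. g (x + h *\<^sub>R u) \<partial>lborel)"
    using h by (subst nn_integral_density) (auto simp: nn_integral_cmult nn_integral_distr)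
  finally show ?thesis .
qed

lemma abs_exp_minus_diff_le:
  fixes x y :: real
  assumes "0 \<le> x" "0 \<le> y"
  shows "\<bar>exp (- x) - exp (- y)\<bar> \<le> \<bar>x - y\<bar>"
proof -
  have *: "\<bar>exp (- x) - exp (- y)\<bar> \<le> \<bar>x - y\<bar>" if "0 \<le> x" "x \<le> y" for x y :: real
  proof -
    have e: "1 - exp (- (y - x)) \<le> y - x"
      using exp_ge_add_one_self[of "- (y - x)"] by linarith
    have "exp (- x) - exp (- y) = exp (- x) * (1 - exp (- (y - x)))"
      by (simp add: right_diff_distrib flip: exp_add)
    also have "\<dots> \<le> 1 * (y - x)"
      by (intro mult_mono e) (use that in auto)
    finally show ?thesis using that by simp
  qed
  show ?thesis
    using *[of x y] *[of y x] assms by (cases "x \<le> y") (auto simp: abs_minus_commute)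
qed

text \<open>Two errors add up: replacing 1 - q/n by exp(-q/n) in each factor costs at most q^2/n,
  and replacing the exponent n - j by n costs at most j q/n. The offset j is the number of points
  used up as edge endpoints.\<close>

lemma abs_power_minus_exp_le:
  fixes q :: real and n j :: nat
  assumes q: "0 \<le> q" "q \<le> n" and n: "n > 0"
  shows "\<bar>(1 - q / n) ^ (n - j) - exp (- q)\<bar> \<le> (q\<^sup>2 + j * q) / n"
proof (cases "j < n")
  \<comment> \<open>Here natural subtraction gives \<open>n - j = 0\<close>, the power is 1, and the
    second error term alone suffices because j/n >= 1.\<close>
  case False
  have "\<bar>1 - exp (- q)\<bar> \<le> q"
    using abs_exp_minus_diff_le[of 0 q] q by simp
  also have "q \<le> j * q / n"
    using False q n by (simp add: field_simps mult_left_mono)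
  also have "\<dots> \<le> (q\<^sup>2 + j * q) / n" by (simp add: divide_right_mono)
  finally show ?thesis using False by simp
next
  case True
  define t where "t = q / n"
  have t: "0 \<le> t" "t \<le> 1" using q n by (auto simp: t_def)
  have "exp (- t) \<le> 1 / (1 + t)"
    using exp_ge_add_one_self[of t] t le_imp_inverse_le[of "1 + t" "exp t"]
    by (simp add: exp_minus inverse_eq_divide)
  also have "\<dots> \<le> 1 - t + t\<^sup>2"
  proof -
    have "1 \<le> 1 + t ^ 3" using t by simp
    also have "\<dots> = (1 - t + t\<^sup>2) * (1 + t)"
      by (simp add: algebra_simps power2_eq_square power3_eq_cube)
    finally show ?thesis using t by (simp add: pos_divide_le_eq)
  qed
  finally have "\<bar>(1 - t) - exp (- t)\<bar> \<le> t\<^sup>2"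
    using exp_ge_add_one_self[of "-t"] by simp
  moreover have "norm ((1 - t) ^ (n - j) - exp (- t) ^ (n - j)) \<le> (n - j) * norm ((1 - t) - exp (- t))"
    by (rule norm_power_diff) (use t in auto)
  ultimately have "\<bar>(1 - t) ^ (n - j) - exp (- t) ^ (n - j)\<bar> \<le> (n - j) * t\<^sup>2"
    by (smt (verit) mult_left_mono of_nat_0_le_iff real_norm_def)
  also have "\<dots> \<le> n * t\<^sup>2" by (intro mult_right_mono) auto
  also have "\<dots> = q\<^sup>2 / n" using n by (simp add: t_def power2_eq_square)
  finally have 1: "\<bar>(1 - t) ^ (n - j) - exp (- t) ^ (n - j)\<bar> \<le> q\<^sup>2 / n" .
  have "exp (- t) ^ (n - j) = exp (- ((n - j) * t))"
    by (simp flip: exp_of_nat_mult)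
  moreover have "\<bar>exp (- ((n - j) * t)) - exp (- q)\<bar> \<le> \<bar>(n - j) * t - q\<bar>"
    using t q by (intro abs_exp_minus_diff_le) auto
  moreover have "\<bar>(n - j) * t - q\<bar> = j * q / n"
  proof -
    have "(n - j) * t - q = - (j * q / n)"
      using True n by (simp add: t_def of_nat_diff field_simps)
    then show ?thesis using q by simp
  qed
  ultimately have "\<bar>exp (- t) ^ (n - j) - exp (- q)\<bar> \<le> j * q / n" by simp
  with 1 show ?thesis unfolding t_def by (simp add: add_divide_distrib)
qed

context convex_density
begin

lemma f_integrable: "integrable lborel f"
  by (rule integrableI_nonneg) (auto simp: f_nonneg f_density)

lemma f_integral: "(LINT x|lborel. f x) = 1"
  by (subst integral_eq_nn_integral) (auto simp: f_nonneg f_density)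

lemma integrable_bounded_outside_K:
  fixes g :: "'a \<Rightarrow> real"
  assumes [measurable]: "g \<in> borel_measurable borel"
    and "\<And>x. x \<notin> K \<Longrightarrow> g x = 0" "\<And>x. x \<in> K \<Longrightarrow> \<bar>g x\<bar> \<le> B"
  shows "integrable lborel g"
proof (rule Bochner_Integration.integrable_bound)
  show "integrable lborel (\<lambda>x. B * indicator K x)"
    using K_finite by (intro integrable_mult_right) (simp add: integrable_indicator_iff)
  show "AE x in lborel. norm (g x) \<le> norm (B * indicator K x)"
    using assms by (intro AE_I2) (fastforce simp: indicator_def)
qed simp

text \<open>The relation that \<open>z\<close> lies in the diametral ball of \<open>x\<close> and
  \<open>y\<close> is closed in the triple, so the masses of its sections depend measurably on
  \<open>x\<close> and \<open>y\<close>.\<close>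

lemma p_measurable[measurable]: "(\<lambda>z. p (fst z) (snd z)) \<in> borel_measurable (borel \<Otimes>\<^sub>M borel)"
proof -
  have "(\<lambda>z. emeasure \<mu> (gball (fst z) (snd z))) \<in> borel_measurable (borel :: ('a \<times> 'a) measure)"
  proof (rule \<mu>.measurable_emeasure)
    have "closed {z :: ('a \<times> 'a) \<times> 'a. dist (midpoint (fst (fst z)) (snd (fst z))) (snd z)
       \<le> dist (fst (fst z)) (snd (fst z)) / 2}"
      unfolding midpoint_def by (intro closed_Collect_le) (auto intro!: continuous_intros)
    then have "{z :: ('a \<times> 'a) \<times> 'a. snd z \<in> gball (fst (fst z)) (snd (fst z))} \<in> sets borel"
      by (auto simp: gball_def intro: borel_closed)
    moreover have "sets ((borel :: ('a \<times> 'a) measure) \<Otimes>\<^sub>M \<mu>) = sets borel"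
      using sets_pair_measure_cong[OF refl sets_\<mu>, of "borel :: ('a \<times> 'a) measure"]
      by (simp only: borel_prod)
    ultimately show "{z \<in> space (borel \<Otimes>\<^sub>M \<mu>). snd z \<in> gball (fst (fst z)) (snd (fst z))}
        \<in> sets ((borel :: ('a \<times> 'a) measure) \<Otimes>\<^sub>M \<mu>)"
      by (simp add: space_pair_measure)
  qed simp
  then show ?thesis
    unfolding p_def measure_def by (simp add: borel_prod)
qed

lemma p_measurable'[measurable (raw)]:
  assumes "g \<in> borel_measurable M" "h \<in> borel_measurable M"
  shows "(\<lambda>z. p (g z) (h z)) \<in> borel_measurable M"
  using measurable_compose[OF measurable_Pair[OF assms] p_measurable] by simp

text \<open>The Lebesgue volume of \<open>gball 0 u\<close>. The halved norm is the origin of the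
  power of 2 in the limit.\<close>

definition V :: "'a \<Rightarrow> real" where
  "V u = ubv TYPE('a) * (norm u / 2) ^ DIM('a)"

lemma V_nonneg: "0 \<le> V u" by (simp add: V_def)

lemma V_measurable[measurable]: "V \<in> borel_measurable borel"
  unfolding V_def by measurable

lemma gball_0: "gball 0 u = cball (u /\<^sub>R 2) (norm u / 2)"
  by (simp add: gball_def midpoint_def)

lemma measure_gball_0: "measure lborel (gball 0 u) = V u"
  unfolding gball_0 V_def by (subst content_cball) auto

lemma emeasure_gball_0: "emeasure lborel (gball 0 u) = ennreal (V u)"
  unfolding gball_0 V_def by (subst emeasure_cball) auto

lemma gball_affine:
  assumes "h > 0"
  shows "x + h *\<^sub>R w \<in> gball x (x + h *\<^sub>R u) \<longleftrightarrow> w \<in> gball 0 u"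
proof -
  have "midpoint x (x + h *\<^sub>R u) - (x + h *\<^sub>R w) = h *\<^sub>R (u /\<^sub>R 2 - w)"
    by (simp add: midpoint_def algebra_simps flip: scaleR_add_left)
  then have "dist (midpoint x (x + h *\<^sub>R u)) (x + h *\<^sub>R w) = h * dist (u /\<^sub>R 2) w"
    using assms by (simp add: dist_norm)
  moreover have "dist x (x + h *\<^sub>R u) = h * norm u" using assms by (simp add: dist_norm)
  ultimately show ?thesis using assms by (simp add: gball_0 gball_def[of x])
qed

text \<open>The mass of the diametral ball of \<open>x\<close> and \<open>x + h *\<^sub>R u\<close>
  per unit of h^d, that is, after zooming in at \<open>x\<close> by the factor 1/h. As h tends to 0
  it approaches \<open>f x * V u\<close> in L^1 as a function of \<open>x\<close>.\<close>

definition q :: "real \<Rightarrow> 'a \<Rightarrow> 'a \<Rightarrow> real" where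
  "q h u x = (LINT w|lborel. indicator (gball 0 u) w * f (x + h *\<^sub>R w))"

lemma indicator_gball_integrable: "integrable lborel (indicator (gball 0 u) :: 'a \<Rightarrow> real)"
  by (simp add: integrable_indicator_iff emeasure_gball_0)

lemma q_integrable: "integrable lborel (\<lambda>w. indicator (gball 0 u) w * f (x + h *\<^sub>R w))"
  by (rule Bochner_Integration.integrable_bound[OF integrable_mult_right[OF indicator_gball_integrable[of u], of c2]])
     (auto intro!: AE_I2 simp: indicator_def f_nonneg f_le abs_of_pos[OF c2_pos])

lemma p_eq_q:
  assumes h: "h > 0"
  shows "p x (x + h *\<^sub>R u) = h ^ DIM('a) * q h u x"
proof -
  have "ennreal (p x (x + h *\<^sub>R u)) = emeasure \<mu> (gball x (x + h *\<^sub>R u))"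
    by (simp add: p_def \<mu>.emeasure_eq_measure)
  also have "\<dots> = (\<integral>\<^sup>+z. ennreal (f z) * indicator (gball x (x + h *\<^sub>R u)) z \<partial>lborel)"
    unfolding \<mu>_def by (subst emeasure_density) auto
  also have "\<dots> = ennreal (h ^ DIM('a)) * (\<integral>\<^sup>+w. ennreal (f (x + h *\<^sub>R w)) * indicator (gball x (x + h *\<^sub>R u)) (x + h *\<^sub>R w) \<partial>lborel)"
    by (rule nn_integral_lborel_affine) (use h in auto)
  also have "(\<integral>\<^sup>+w. ennreal (f (x + h *\<^sub>R w)) * indicator (gball x (x + h *\<^sub>R u)) (x + h *\<^sub>R w) \<partial>lborel)
      = (\<integral>\<^sup>+w. ennreal (indicator (gball 0 u) w * f (x + h *\<^sub>R w)) \<partial>lborel)"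
    by (intro nn_integral_cong) (auto simp: indicator_def gball_affine[OF h])
  also have "\<dots> = ennreal (q h u x)"
    unfolding q_def using q_integrable by (intro nn_integral_eq_integral) (auto simp: f_nonneg)
  finally show ?thesis
    using h by (simp add: p_nonneg q_def f_nonneg flip: ennreal_mult)
qed

lemma q_nonneg: "0 \<le> q h u x"
  unfolding q_def by (intro Bochner_Integration.integral_nonneg) (auto simp: f_nonneg)

lemma q_le: "q h u x \<le> c2 * V u"
proof -
  have "q h u x \<le> (LINT w|lborel. indicator (gball 0 u) w * c2)"
    unfolding q_def
    by (intro integral_mono q_integrable integrable_mult_left[OF indicator_gball_integrable])
       (auto simp: indicator_def f_le)
  then show ?thesis by (simp add: measure_gball_0 mult.commute)
qed

lemma q_minus_le:
  "ennreal \<bar>q h u x - f x * V u\<bar> \<le> (\<integral>\<^sup>+w. indicator (gball 0 u) w * ennreal \<bar>f (x + h *\<^sub>R w) - f x\<bar> \<partial>lborel)"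
proof -
  have i: "integrable lborel (\<lambda>w. indicator (gball 0 u) w * f x)"
    using indicator_gball_integrable by simp
  have "f x * V u = (LINT w|lborel. indicator (gball 0 u) w * f x)"
    by (simp add: measure_gball_0)
  then have "q h u x - f x * V u = (LINT w|lborel. indicator (gball 0 u) w * f (x + h *\<^sub>R w) - indicator (gball 0 u) w * f x)"
    unfolding q_def using Bochner_Integration.integral_diff[OF q_integrable i] by simp
  then have "ennreal \<bar>q h u x - f x * V u\<bar>
     \<le> (\<integral>\<^sup>+w. ennreal (norm (indicator (gball 0 u) w * f (x + h *\<^sub>R w) - indicator (gball 0 u) w * f x)) \<partial>lborel)"
    using integral_norm_bound_ennreal[OF Bochner_Integration.integrable_diff[OF q_integrable i], of u x h] by simp
  also have "\<dots> = (\<integral>\<^sup>+w. indicator (gball 0 u) w * ennreal \<bar>f (x + h *\<^sub>R w) - f x\<bar> \<partial>lborel)"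
    by (intro nn_integral_cong) (auto simp: indicator_def)
  finally show ?thesis .
qed

text \<open>The L^1 modulus of continuity of \<open>f\<close>.\<close>

definition shift_L1 :: "'a \<Rightarrow> real" where
  "shift_L1 z = (LINT x|lborel. \<bar>f (x + z) - f x\<bar>)"

lemma shift_L1_nonneg: "0 \<le> shift_L1 z" by (simp add: shift_L1_def)

lemma shift_L1_nn_integral: "(\<integral>\<^sup>+x. ennreal \<bar>f (x + z) - f x\<bar> \<partial>lborel) = ennreal (shift_L1 z)"
  unfolding shift_L1_def using f_integrable integrable_lborel_translate[OF f_integrable, of z]
  by (intro nn_integral_eq_integral) auto

lemma shift_L1_le: "shift_L1 z \<le> 2"
proof -
  note * = f_integrable integrable_lborel_translate[OF f_integrable, of z]
  have "shift_L1 z \<le> (LINT x|lborel. f (x + z) + f x)"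
    unfolding shift_L1_def using * by (intro integral_mono) (auto simp: f_nonneg abs_le_iff add_increasing add_increasing2)
  also have "\<dots> = 2" using * f_integral by (simp add: integral_lborel_translate)
  finally show ?thesis .
qed

text \<open>Integrating \<open>q_minus_le\<close> over \<open>x\<close> and exchanging the integrals
  leaves the L^1 modulus of \<open>f\<close> at h w, averaged over the bounded ball of w. The
  modulus tends to 0 for each w and is at most 2, so dominated convergence applies.\<close>

lemma q_L1:
  assumes h: "h \<longlonglongrightarrow> 0"
  shows "(\<lambda>n. \<integral>\<^sup>+x. ennreal \<bar>q (h n) u x - f x * V u\<bar> \<partial>lborel) \<longlonglongrightarrow> 0"
proof (rule tendsto_sandwich[OF _ _ tendsto_const])
  show "\<forall>\<^sub>F n in sequentially. (\<integral>\<^sup>+x. ennreal \<bar>q (h n) u x - f x * V u\<bar> \<partial>lborel)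
     \<le> (\<integral>\<^sup>+w. indicator (gball 0 u) w * ennreal (shift_L1 (h n *\<^sub>R w)) \<partial>lborel)"
  proof (intro always_eventually allI)
    fix n
    have "(\<integral>\<^sup>+x. ennreal \<bar>q (h n) u x - f x * V u\<bar> \<partial>lborel)
      \<le> (\<integral>\<^sup>+x. (\<integral>\<^sup>+w. indicator (gball 0 u) w * ennreal \<bar>f (x + h n *\<^sub>R w) - f x\<bar> \<partial>lborel) \<partial>lborel)"
      by (intro nn_integral_mono q_minus_le)
    also have "\<dots> = (\<integral>\<^sup>+w. (\<integral>\<^sup>+x. indicator (gball 0 u) w * ennreal \<bar>f (x + h n *\<^sub>R w) - f x\<bar> \<partial>lborel) \<partial>lborel)"
      by (rule lborel_pair.Fubini') measurable
    also have "\<dots> = (\<integral>\<^sup>+w. indicator (gball 0 u) w * ennreal (shift_L1 (h n *\<^sub>R w)) \<partial>lborel)"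
      by (subst nn_integral_cmult) (auto simp: shift_L1_nn_integral)
    finally show "(\<integral>\<^sup>+x. ennreal \<bar>q (h n) u x - f x * V u\<bar> \<partial>lborel) \<le> \<dots>" .
  qed
  have [measurable]: "shift_L1 \<in> borel_measurable borel"
    unfolding shift_L1_def by (rule lborel.borel_measurable_lebesgue_integral) measurable
  have "(\<lambda>n. \<integral>\<^sup>+w. indicator (gball 0 u) w * ennreal (shift_L1 (h n *\<^sub>R w)) \<partial>lborel)
     \<longlonglongrightarrow> integral\<^sup>N (lborel :: 'a measure) (\<lambda>_. 0)"
  proof (rule nn_integral_dominated_convergence[where w="\<lambda>w. 2 * indicator (gball 0 u) w"])
    show "(\<integral>\<^sup>+w. 2 * indicator (gball 0 u) w \<partial>lborel) < \<infinity>"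
      by (subst nn_integral_cmult_indicator) (auto simp: emeasure_gball_0 ennreal_mult_less_top)
    show "AE w in lborel. indicator (gball 0 u) w * ennreal (shift_L1 (h n *\<^sub>R w)) \<le> 2 * indicator (gball 0 u) w" for n
      using ennreal_leI[OF shift_L1_le] by (intro AE_I2) (auto simp: indicator_def)
    show "AE w in lborel. (\<lambda>n. indicator (gball 0 u) w * ennreal (shift_L1 (h n *\<^sub>R w))) \<longlonglongrightarrow> 0"
    proof (rule AE_I2)
      fix w :: 'a
      have "(\<lambda>n. h n *\<^sub>R w) \<longlonglongrightarrow> 0" using tendsto_scaleR[OF h tendsto_const[of w]] by simp
      then have "(\<lambda>n. shift_L1 (h n *\<^sub>R w)) \<longlonglongrightarrow> 0"
        unfolding shift_L1_def by (rule L1_translation[OF f_integrable])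
      then have "(\<lambda>n. ennreal (shift_L1 (h n *\<^sub>R w))) \<longlonglongrightarrow> 0"
        using tendsto_ennrealI by fastforce
      then show "(\<lambda>n. indicator (gball 0 u) w * ennreal (shift_L1 (h n *\<^sub>R w))) \<longlonglongrightarrow> 0"
        by (cases "w \<in> gball 0 u") auto
    qed
  qed auto
  then show "(\<lambda>n. \<integral>\<^sup>+w. indicator (gball 0 u) w * ennreal (shift_L1 (h n *\<^sub>R w)) \<partial>lborel) \<longlonglongrightarrow> 0"
    by simp
qed auto

end

section \<open>Limit of the one-edge moment\<close>

context convex_density
begin

text \<open>A fixed choice of the constant of \<open>p_lower\<close>, so that later definitions can
  refer to it.\<close>

definition cone_const :: real where
  "cone_const = (SOME c. c > 0 \<and> (\<forall>x\<in>K. \<forall>y\<in>K. c * dist x y ^ DIM('a) \<le> p x y))"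

lemma cone_const: "cone_const > 0 \<and> (\<forall>x\<in>K. \<forall>y\<in>K. cone_const * dist x y ^ DIM('a) \<le> p x y)"
proof -
  obtain c where "c > 0" "\<And>x y. x \<in> K \<Longrightarrow> y \<in> K \<Longrightarrow> c * dist x y ^ DIM('a) \<le> p x y"
    using p_lower by blast
  then have "\<exists>c. c > 0 \<and> (\<forall>x\<in>K. \<forall>y\<in>K. c * dist x y ^ DIM('a) \<le> p x y)" by blast
  then show ?thesis unfolding cone_const_def by (rule someI_ex)
qed

lemma cone_const_pos: "cone_const > 0" using cone_const by simp

lemma one_minus_p_power_le:
  assumes "x \<in> K" "y \<in> K"
  shows "(1 - p x y) ^ m \<le> exp (- (cone_const * m * dist x y ^ DIM('a)))"
proof -
  have "(1 - p x y) ^ m \<le> exp (- p x y) ^ m"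
    using exp_ge_add_one_self[of "- p x y"] p_le_1[of x y] by (intro power_mono) auto
  also have "\<dots> = exp (- (m * p x y))" by (simp flip: exp_of_nat_mult)
  also have "\<dots> \<le> exp (- (cone_const * m * dist x y ^ DIM('a)))"
    using mult_left_mono[of "cone_const * dist x y ^ DIM('a)" "p x y" m] cone_const assms by (simp add: mult_ac)
  finally show ?thesis .
qed

text \<open>The typical distance between neighbouring points among n: a cell of side
  \<open>h n\<close> has volume 1/n.\<close>

definition h :: "nat \<Rightarrow> real" where "h n = real n powr (- 1 / DIM('a))"

lemma h_pos: "n > 0 \<Longrightarrow> h n > 0" by (simp add: h_def)

lemma h_powr: "h n powr \<beta> = real n powr (- \<beta> / DIM('a))"
  by (simp add: h_def powr_powr)

lemma h_power_DIM:
  assumes "n > 0"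
  shows "h n ^ DIM('a) = 1 / n"
proof -
  have "h n ^ DIM('a) = h n powr real DIM('a)"
    by (rule powr_realpow[symmetric]) (rule h_pos[OF assms])
  also have "\<dots> = real n powr (- 1)" unfolding h_powr by simp
  finally show ?thesis using assms by (simp add: powr_minus_divide)
qed

lemma h_tendsto: "h \<longlonglongrightarrow> 0"
  unfolding h_def
  by (rule tendsto_neg_powr[OF _ filterlim_real_sequentially]) simp

text \<open>The contribution of the rescaled displacement \<open>u\<close> to the one-edge moment,
  integrated over the base point. The first moment uses j = 2, and the product of two disjoint edges
  uses j = 4.\<close>

definition J :: "nat \<Rightarrow> nat \<Rightarrow> 'a \<Rightarrow> real" where
  "J j n u = (LINT x|lborel. f x * f (x + h n *\<^sub>R u) * (1 - p x (x + h n *\<^sub>R u)) ^ (n - j))"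

lemma J_integrable: "integrable lborel (\<lambda>x. f x * f (x + h n *\<^sub>R u) * (1 - p x (x + h n *\<^sub>R u)) ^ (n - j))"
proof (rule integrable_bounded_outside_K[where B="c2 * c2 * 1"])
  fix x
  have "0 \<le> 1 - p x (x + h n *\<^sub>R u)" "1 - p x (x + h n *\<^sub>R u) \<le> 1"
    using p_le_1 p_nonneg by auto
  then have "0 \<le> (1 - p x (x + h n *\<^sub>R u)) ^ (n - j)" "(1 - p x (x + h n *\<^sub>R u)) ^ (n - j) \<le> 1"
    by (auto intro: power_le_one)
  then show "\<bar>f x * f (x + h n *\<^sub>R u) * (1 - p x (x + h n *\<^sub>R u)) ^ (n - j)\<bar> \<le> c2 * c2 * 1"
    using f_nonneg f_le c2_pos unfolding abs_mult by (intro mult_mono) auto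
qed (auto simp: f_outside)

lemma J_nonneg: "0 \<le> J j n u"
  unfolding J_def using p_le_1
  by (intro Bochner_Integration.integral_nonneg) (auto simp: f_nonneg)

lemma J_nn_integral:
  "ennreal (J j n u) = (\<integral>\<^sup>+x. ennreal (f x * f (x + h n *\<^sub>R u) * (1 - p x (x + h n *\<^sub>R u)) ^ (n - j)) \<partial>lborel)"
  unfolding J_def using J_integrable p_le_1
  by (subst nn_integral_eq_integral) (auto simp: f_nonneg)

lemma Jlim_integrable: "integrable lborel (\<lambda>x. (f x)\<^sup>2 * exp (- (f x * V u)))"
proof (rule integrable_bounded_outside_K[where B="c2\<^sup>2 * 1"])
  fix x
  show "\<bar>(f x)\<^sup>2 * exp (- (f x * V u))\<bar> \<le> c2\<^sup>2 * 1"
    using f_nonneg f_le c2_pos V_nonneg unfolding abs_mult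
    by (intro mult_mono) (auto intro!: power_mono)
qed (auto simp: f_outside)

lemma q_measurable[measurable]: "(\<lambda>x. q t u x) \<in> borel_measurable borel"
  unfolding q_def by (rule lborel.borel_measurable_lebesgue_integral) measurable

text \<open>With F and T the densities at the two endpoints, P the emptiness probability and E its
  limit, F T P - F^2 E = F P (T - F) + F^2 (P - E). Each resulting error is integrable in
  \<open>x\<close>, with an integral that tends to 0 for fixed \<open>u\<close>.\<close>

lemma J_integrand_diff_le:
  fixes u x :: 'a
  assumes n: "n > 0"
  defines "Q \<equiv> c2 * V u"
  shows "\<bar>f x * f (x + h n *\<^sub>R u) * (1 - p x (x + h n *\<^sub>R u)) ^ (n - j) - (f x)\<^sup>2 * exp (- (f x * V u))\<bar>
    \<le> c2 * \<bar>f (x + h n *\<^sub>R u) - f x\<bar> + (c2 * ((Q\<^sup>2 + j * Q) / n)) * f x + c2\<^sup>2 * \<bar>q (h n) u x - f x * V u\<bar>"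
proof -
  define F where "F = f x"
  define T where "T = f (x + h n *\<^sub>R u)"
  define q' where "q' = q (h n) u x"
  define P where "P = (1 - p x (x + h n *\<^sub>R u)) ^ (n - j)"
  define E where "E = exp (- (F * V u))"
  have F: "0 \<le> F" "F \<le> c2" using f_nonneg f_le by (auto simp: F_def)
  have p: "p x (x + h n *\<^sub>R u) = q' / n"
    using p_eq_q[OF h_pos[OF n]] n by (simp add: q'_def h_power_DIM)
  have P: "0 \<le> P" "P \<le> 1" unfolding P_def using p_le_1 p_nonneg by (auto intro: power_le_one)
  have q': "0 \<le> q'" "q' \<le> Q" unfolding q'_def Q_def by (auto simp: q_nonneg q_le)
  have qn: "q' \<le> n" using p_le_1[of x "x + h n *\<^sub>R u"] n by (simp add: p divide_le_eq)
  have "\<bar>P - exp (- q')\<bar> \<le> (q'\<^sup>2 + j * q') / n"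
    unfolding P_def p using q' qn n by (intro abs_power_minus_exp_le) auto
  also have "\<dots> \<le> (Q\<^sup>2 + j * Q) / n"
    using q' by (intro divide_right_mono add_mono power_mono mult_left_mono) auto
  finally have 1: "\<bar>P - exp (- q')\<bar> \<le> (Q\<^sup>2 + j * Q) / n" .
  have "\<bar>exp (- q') - E\<bar> \<le> \<bar>q' - F * V u\<bar>"
    unfolding E_def using q' F V_nonneg by (intro abs_exp_minus_diff_le) auto
  with 1 have 2: "\<bar>P - E\<bar> \<le> (Q\<^sup>2 + j * Q) / n + \<bar>q' - F * V u\<bar>" by simp
  have "F * T * P - F\<^sup>2 * E = F * P * (T - F) + F * F * (P - E)"
    by (simp add: algebra_simps power2_eq_square)
  then have "\<bar>F * T * P - F\<^sup>2 * E\<bar> \<le> F * P * \<bar>T - F\<bar> + F * F * \<bar>P - E\<bar>"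
    using F P abs_triangle_ineq[of "F * P * (T - F)" "F * F * (P - E)"] by (simp add: abs_mult)
  also have "F * P * \<bar>T - F\<bar> \<le> c2 * 1 * \<bar>T - F\<bar>"
    using F P c2_pos by (intro mult_mono) auto
  also have "F * F * \<bar>P - E\<bar> \<le> F * F * ((Q\<^sup>2 + j * Q) / n + \<bar>q' - F * V u\<bar>)"
    using 2 F by (intro mult_left_mono) auto
  also have "\<dots> = F * F * ((Q\<^sup>2 + j * Q) / n) + F * F * \<bar>q' - F * V u\<bar>"
    by (simp only: distrib_left)
  \<comment> \<open>One factor F stays: a term constant in \<open>x\<close> would not be integrable,
    whereas F integrates to 1.\<close>
  also have "F * F * ((Q\<^sup>2 + j * Q) / n) \<le> F * c2 * ((Q\<^sup>2 + j * Q) / n)"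
    using F q' by (intro mult_mono) auto
  also have "F * F * \<bar>q' - F * V u\<bar> \<le> c2 * c2 * \<bar>q' - F * V u\<bar>"
    using F by (intro mult_mono) auto
  finally show ?thesis
    unfolding F_def T_def P_def E_def q'_def by (simp add: power2_eq_square mult_ac add_ac)
qed

lemma J_tendsto:
  "(\<lambda>n. J j n u) \<longlonglongrightarrow> (LINT x|lborel. (f x)\<^sup>2 * exp (- (f x * V u)))"
proof -
  define L where "L = (LINT x|lborel. (f x)\<^sup>2 * exp (- (f x * V u)))"
  define Q where "Q = c2 * V u"
  define R where "R = (\<lambda>n. \<integral>\<^sup>+x. ennreal \<bar>q (h n) u x - f x * V u\<bar> \<partial>lborel)"
  define A where "A = (\<lambda>n::nat. c2 * ((Q\<^sup>2 + j * Q) / n))"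
  have Q: "0 \<le> Q" using c2_pos V_nonneg by (simp add: Q_def)
  have A: "0 \<le> A n" for n using Q c2_pos by (simp add: A_def)
  have bound: "ennreal \<bar>J j n u - L\<bar> \<le> ennreal (c2 * shift_L1 (h n *\<^sub>R u) + A n) + ennreal (c2\<^sup>2) * R n"
    if n: "n > 0" for n
  proof -
    have "J j n u - L = (LINT x|lborel. f x * f (x + h n *\<^sub>R u) * (1 - p x (x + h n *\<^sub>R u)) ^ (n - j)
        - (f x)\<^sup>2 * exp (- (f x * V u)))"
      unfolding J_def L_def
      by (rule Bochner_Integration.integral_diff[OF J_integrable Jlim_integrable, symmetric])
    then have "ennreal \<bar>J j n u - L\<bar> \<le> (\<integral>\<^sup>+x. ennreal \<bar>f x * f (x + h n *\<^sub>R u) * (1 - p x (x + h n *\<^sub>R u)) ^ (n - j)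
        - (f x)\<^sup>2 * exp (- (f x * V u))\<bar> \<partial>lborel)"
      using integral_norm_bound_ennreal[OF Bochner_Integration.integrable_diff[OF J_integrable Jlim_integrable], of n u j u] by simp
    also have "\<dots> \<le> (\<integral>\<^sup>+x. ennreal (c2 * \<bar>f (x + h n *\<^sub>R u) - f x\<bar> + (c2 * ((Q\<^sup>2 + j * Q) / n)) * f x
        + c2\<^sup>2 * \<bar>q (h n) u x - f x * V u\<bar>) \<partial>lborel)"
      using J_integrand_diff_le[OF n] unfolding Q_def by (intro nn_integral_mono ennreal_leI) auto
    also have "\<dots> = (\<integral>\<^sup>+x. ennreal (c2 * \<bar>f (x + h n *\<^sub>R u) - f x\<bar> + A n * f x
        + c2\<^sup>2 * \<bar>q (h n) u x - f x * V u\<bar>) \<partial>lborel)"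
      unfolding A_def ..
    also have "\<dots> = (\<integral>\<^sup>+x. ennreal c2 * ennreal \<bar>f (x + h n *\<^sub>R u) - f x\<bar> + ennreal (A n) * ennreal (f x)
        + ennreal (c2\<^sup>2) * ennreal \<bar>q (h n) u x - f x * V u\<bar> \<partial>lborel)"
      using c2_pos A f_nonneg
      by (intro nn_integral_cong) (simp add: ennreal_mult)
    also have "\<dots> = ennreal c2 * ennreal (shift_L1 (h n *\<^sub>R u)) + ennreal (A n) * 1 + ennreal (c2\<^sup>2) * R n"
      unfolding R_def
      by (simp add: nn_integral_add nn_integral_cmult shift_L1_nn_integral f_density)
    also have "\<dots> = ennreal (c2 * shift_L1 (h n *\<^sub>R u) + A n) + ennreal (c2\<^sup>2) * R n"
      using c2_pos A shift_L1_nonneg by (simp add: ennreal_mult)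
    finally show ?thesis .
  qed
  have lim: "(\<lambda>n. ennreal (c2 * shift_L1 (h n *\<^sub>R u) + A n) + ennreal (c2\<^sup>2) * R n)
     \<longlonglongrightarrow> ennreal (c2 * 0 + c2 * 0) + ennreal (c2\<^sup>2) * 0"
    unfolding A_def
  proof (intro tendsto_add tendsto_ennrealI tendsto_mult tendsto_const ennreal_tendsto_cmult)
    have "(\<lambda>n. h n *\<^sub>R u) \<longlonglongrightarrow> 0" using tendsto_scaleR[OF h_tendsto tendsto_const[of u]] by simp
    then show "(\<lambda>n. shift_L1 (h n *\<^sub>R u)) \<longlonglongrightarrow> 0"
      unfolding shift_L1_def by (rule L1_translation[OF f_integrable])
    show "(\<lambda>n. (Q\<^sup>2 + j * Q) / n) \<longlonglongrightarrow> 0"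
      by (rule lim_const_over_n)
    show "R \<longlonglongrightarrow> 0" unfolding R_def by (rule q_L1[OF h_tendsto])
  qed auto
  have "\<forall>\<^sub>F n in sequentially. ennreal \<bar>J j n u - L\<bar> \<le> ennreal (c2 * shift_L1 (h n *\<^sub>R u) + A n) + ennreal (c2\<^sup>2) * R n"
    using eventually_gt_at_top[of 0] by eventually_elim (rule bound)
  then have "(\<lambda>n. ennreal \<bar>J j n u - L\<bar>) \<longlonglongrightarrow> 0"
    using lim by (intro tendsto_sandwich[where f="\<lambda>_. 0::ennreal" and g="\<lambda>n. ennreal \<bar>J j n u - L\<bar>"]) auto
  then have "(\<lambda>n. \<bar>J j n u - L\<bar>) \<longlonglongrightarrow> 0"
    by (subst (asm) ennreal_tendsto_0_iff) auto
  then have "(\<lambda>n. J j n u - L) \<longlonglongrightarrow> 0" by (rule tendsto_rabs_zero_cancel)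
  then show ?thesis unfolding L_def[symmetric] by (rule LIM_zero_cancel)
qed

text \<open>This provides the dominating function for the limit in \<open>u\<close>. The condition
  \<open>2 * j \<le> n\<close> makes the exponent n - j at least n/2, whence
  \<open>cone_const / 2\<close>; the density at \<open>x\<close> is kept and integrates to 1, and
  the other one is bounded by \<open>c2\<close>.\<close>

lemma J_le:
  assumes n: "n > 0" "2 * j \<le> n"
  shows "J j n u \<le> c2 * exp (- (cone_const / 2) * norm u ^ DIM('a))"
proof -
  have "J j n u \<le> (LINT x|lborel. (c2 * exp (- (cone_const / 2) * norm u ^ DIM('a))) * f x)"
    unfolding J_def
  proof (rule integral_mono[OF J_integrable])
    fix x
    let ?y = "x + h n *\<^sub>R u"
    show "f x * f ?y * (1 - p x ?y) ^ (n - j) \<le> (c2 * exp (- (cone_const / 2) * norm u ^ DIM('a))) * f x"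
    proof (cases "x \<in> K \<and> ?y \<in> K")
      case True
      have d: "dist x ?y ^ DIM('a) = norm u ^ DIM('a) / n"
        using n(1) h_pos[OF n(1)] by (simp add: dist_norm power_mult_distrib h_power_DIM)
      have "(1 - p x ?y) ^ (n - j) \<le> exp (- (cone_const * (n - j) * dist x ?y ^ DIM('a)))"
        using one_minus_p_power_le True by blast
      also have "\<dots> \<le> exp (- (cone_const / 2) * norm u ^ DIM('a))"
      proof -
        have "1 / 2 * (cone_const * norm u ^ DIM('a)) \<le> real (n - j) / n * (cone_const * norm u ^ DIM('a))"
          using n cone_const_pos by (intro mult_right_mono) (auto simp: field_simps of_nat_diff)
        then show ?thesis unfolding d by (simp add: mult_ac)
      qed
      finally have "f ?y * (1 - p x ?y) ^ (n - j) \<le> c2 * exp (- (cone_const / 2) * norm u ^ DIM('a))"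
        using f_nonneg f_le c2_pos p_le_1 by (intro mult_mono) auto
      from mult_left_mono[OF this f_nonneg[of x]] show ?thesis by (simp add: mult_ac)
    next
      case False
      then have "f x = 0 \<or> f ?y = 0" using f_outside by auto
      then show ?thesis using f_nonneg c2_pos by auto
    qed
  qed (simp add: f_integrable)
  also have "\<dots> = c2 * exp (- (cone_const / 2) * norm u ^ DIM('a))" using f_integral by simp
  finally show ?thesis .
qed

text \<open>The expected term of one ordered pair when m further points must miss its ball. The
  power of the distance is a parameter because the exponent 2 \<alpha> also occurs, in the second
  moment.\<close>

definition pair_moment :: "real \<Rightarrow> nat \<Rightarrow> ennreal" where
  "pair_moment \<beta> m = (\<integral>\<^sup>+x. \<integral>\<^sup>+y. ennreal (dist x y powr \<beta> * (1 - p x y) ^ m) \<partial>\<mu> \<partial>\<mu>)"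

text \<open>Substituting y = x + h u produces h^d h^\<beta> = n^(-1-\<beta>/d), which the prefactor
  cancels; exchanging the integrals then puts \<open>x\<close> inside.\<close>

lemma pair_moment_J:
  assumes n: "n > 0"
  shows "ennreal (real n powr (1 + \<beta> / DIM('a))) * pair_moment \<beta> (n - j)
     = (\<integral>\<^sup>+u. ennreal (norm u powr \<beta>) * ennreal (J j n u) \<partial>lborel)"
proof -
  define N where "N = real n powr (1 + \<beta> / DIM('a))"
  let ?g = "\<lambda>x y. dist x y powr \<beta> * (1 - p x y) ^ (n - j)"
  have N: "N > 0" "N * (h n ^ DIM('a) * h n powr \<beta>) = 1"
    using n by (auto simp: N_def h_powr h_power_DIM powr_add powr_minus)
  have inner: "(\<integral>\<^sup>+y. ennreal (f y) * ennreal (?g x y) \<partial>lborel)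
      = ennreal (1 / N) * (\<integral>\<^sup>+u. ennreal (norm u powr \<beta> * (f (x + h n *\<^sub>R u) * (1 - p x (x + h n *\<^sub>R u)) ^ (n - j))) \<partial>lborel)" for x
  proof -
    have "(\<integral>\<^sup>+y. ennreal (f y) * ennreal (?g x y) \<partial>lborel)
        = ennreal (h n ^ DIM('a)) * (\<integral>\<^sup>+u. ennreal (f (x + h n *\<^sub>R u)) * ennreal (?g x (x + h n *\<^sub>R u)) \<partial>lborel)"
      by (rule nn_integral_lborel_affine) (use h_pos[OF n] in auto)
    also have "(\<integral>\<^sup>+u. ennreal (f (x + h n *\<^sub>R u)) * ennreal (?g x (x + h n *\<^sub>R u)) \<partial>lborel)
      = (\<integral>\<^sup>+u. ennreal (h n powr \<beta>) * ennreal (norm u powr \<beta> * (f (x + h n *\<^sub>R u) * (1 - p x (x + h n *\<^sub>R u)) ^ (n - j))) \<partial>lborel)"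
      using f_nonneg p_le_1 h_pos[OF n]
      by (intro nn_integral_cong) (simp add: dist_norm powr_mult mult_ac flip: ennreal_mult)
    also have "\<dots> = ennreal (h n powr \<beta>) * (\<integral>\<^sup>+u. ennreal (norm u powr \<beta> * (f (x + h n *\<^sub>R u) * (1 - p x (x + h n *\<^sub>R u)) ^ (n - j))) \<partial>lborel)"
      by (rule nn_integral_cmult) measurable
    also have "ennreal (h n ^ DIM('a)) * \<dots> = ennreal (1 / N) * (\<integral>\<^sup>+u. ennreal (norm u powr \<beta> * (f (x + h n *\<^sub>R u) * (1 - p x (x + h n *\<^sub>R u)) ^ (n - j))) \<partial>lborel)"
    proof -
      have "h n ^ DIM('a) * h n powr \<beta> = 1 / N" using N by (simp add: field_simps)
      then show ?thesis using h_pos[OF n] by (simp flip: mult.assoc ennreal_mult)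
    qed
    finally show ?thesis .
  qed
  have "pair_moment \<beta> (n - j) = (\<integral>\<^sup>+x. ennreal (f x) * (\<integral>\<^sup>+y. ennreal (f y) * ennreal (?g x y) \<partial>lborel) \<partial>lborel)"
    unfolding pair_moment_def by (simp add: nn_integral_\<mu>)
  also have "\<dots> = (\<integral>\<^sup>+x. ennreal (1 / N) * (\<integral>\<^sup>+u. ennreal (norm u powr \<beta>) * ennreal (f x * f (x + h n *\<^sub>R u) * (1 - p x (x + h n *\<^sub>R u)) ^ (n - j)) \<partial>lborel) \<partial>lborel)"
  proof (rule nn_integral_cong)
    fix x
    have "ennreal (f x) * (\<integral>\<^sup>+u. ennreal (norm u powr \<beta> * (f (x + h n *\<^sub>R u) * (1 - p x (x + h n *\<^sub>R u)) ^ (n - j))) \<partial>lborel)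
      = (\<integral>\<^sup>+u. ennreal (f x) * ennreal (norm u powr \<beta> * (f (x + h n *\<^sub>R u) * (1 - p x (x + h n *\<^sub>R u)) ^ (n - j))) \<partial>lborel)"
      by (rule nn_integral_cmult[symmetric]) measurable
    also have "\<dots> = (\<integral>\<^sup>+u. ennreal (norm u powr \<beta>) * ennreal (f x * f (x + h n *\<^sub>R u) * (1 - p x (x + h n *\<^sub>R u)) ^ (n - j)) \<partial>lborel)"
      using f_nonneg p_le_1 by (intro nn_integral_cong) (simp add: mult_ac flip: ennreal_mult)
    finally have X: "ennreal (f x) * (\<integral>\<^sup>+u. ennreal (norm u powr \<beta> * (f (x + h n *\<^sub>R u) * (1 - p x (x + h n *\<^sub>R u)) ^ (n - j))) \<partial>lborel) = \<dots>" .
    show "ennreal (f x) * (\<integral>\<^sup>+y. ennreal (f y) * ennreal (?g x y) \<partial>lborel)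
      = ennreal (1 / N) * (\<integral>\<^sup>+u. ennreal (norm u powr \<beta>) * ennreal (f x * f (x + h n *\<^sub>R u) * (1 - p x (x + h n *\<^sub>R u)) ^ (n - j)) \<partial>lborel)"
      unfolding inner mult.left_commute[of "ennreal (f x)"] X ..
  qed
  also have "\<dots> = ennreal (1 / N) * (\<integral>\<^sup>+x. (\<integral>\<^sup>+u. ennreal (norm u powr \<beta>) * ennreal (f x * f (x + h n *\<^sub>R u) * (1 - p x (x + h n *\<^sub>R u)) ^ (n - j)) \<partial>lborel) \<partial>lborel)"
    by (rule nn_integral_cmult) measurable
  also have "(\<integral>\<^sup>+x. (\<integral>\<^sup>+u. ennreal (norm u powr \<beta>) * ennreal (f x * f (x + h n *\<^sub>R u) * (1 - p x (x + h n *\<^sub>R u)) ^ (n - j)) \<partial>lborel) \<partial>lborel)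
     = (\<integral>\<^sup>+u. (\<integral>\<^sup>+x. ennreal (norm u powr \<beta>) * ennreal (f x * f (x + h n *\<^sub>R u) * (1 - p x (x + h n *\<^sub>R u)) ^ (n - j)) \<partial>lborel) \<partial>lborel)"
    by (rule lborel_pair.Fubini') measurable
  also have "\<dots> = (\<integral>\<^sup>+u. ennreal (norm u powr \<beta>) * ennreal (J j n u) \<partial>lborel)"
    by (intro nn_integral_cong) (simp add: J_nn_integral nn_integral_cmult)
  finally have "pair_moment \<beta> (n - j) = ennreal (1 / N) * (\<integral>\<^sup>+u. ennreal (norm u powr \<beta>) * ennreal (J j n u) \<partial>lborel)" .
  then show ?thesis
    using N by (simp add: N_def[symmetric] flip: mult.assoc ennreal_mult)
qed

lemma J_measurable[measurable]: "J j n \<in> borel_measurable borel"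
  unfolding J_def by (rule lborel.borel_measurable_lebesgue_integral) measurable

text \<open>After exchanging the integrals, the one over \<open>u\<close> is a Gamma integral for
  each \<open>x\<close> in \<open>K\<close>. Its factor f(x)^(-1-\<beta>/d) combines with f(x)^2 to
  the exponent (d-\<beta>)/d.\<close>

lemma nn_integral_Jlim:
  fixes \<beta> :: real
  assumes \<beta>: "\<beta> \<ge> 0"
  shows "(\<integral>\<^sup>+u. ennreal (norm u powr \<beta>) * ennreal (LINT x|lborel. (f x)\<^sup>2 * exp (- (f x * V u))) \<partial>lborel)
     = ennreal (ubv TYPE('a) powr (- \<beta> / DIM('a)) * 2 powr (DIM('a) + \<beta>) * Gamma (1 + \<beta> / DIM('a))
         * (LINT x:K|lborel. f x powr ((DIM('a) - \<beta>) / DIM('a))))"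
proof -
  let ?v = "ubv TYPE('a)" and ?d = "DIM('a)"
  define C where "C = ?v powr (- \<beta> / ?d) * 2 powr (?d + \<beta>) * Gamma (1 + \<beta> / ?d)"
  define e where "e = (?d - \<beta>) / ?d"
  have v: "?v > 0" by simp
  have C: "C \<ge> 0" 
    using \<beta> unfolding C_def by (intro mult_nonneg_nonneg Gamma_real_nonneg add_pos_nonneg) auto
  have "(\<integral>\<^sup>+u. ennreal (norm u powr \<beta>) * ennreal (LINT x|lborel. (f x)\<^sup>2 * exp (- (f x * V u))) \<partial>lborel)
     = (\<integral>\<^sup>+u. (\<integral>\<^sup>+x. ennreal (norm u powr \<beta>) * ennreal ((f x)\<^sup>2 * exp (- (f x * V u))) \<partial>lborel) \<partial>lborel)"
    using Jlim_integrable
    by (intro nn_integral_cong) (simp add: nn_integral_cmult nn_integral_eq_integral)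
  also have "\<dots> = (\<integral>\<^sup>+x. (\<integral>\<^sup>+u. ennreal (norm u powr \<beta>) * ennreal ((f x)\<^sup>2 * exp (- (f x * V u))) \<partial>lborel) \<partial>lborel)"
    by (rule lborel_pair.Fubini') measurable
  also have "\<dots> = (\<integral>\<^sup>+x. ennreal (C * (indicator K x * f x powr e)) \<partial>lborel)"
  proof (rule nn_integral_cong)
    fix x
    show "(\<integral>\<^sup>+u. ennreal (norm u powr \<beta>) * ennreal ((f x)\<^sup>2 * exp (- (f x * V u))) \<partial>lborel)
        = ennreal (C * (indicator K x * f x powr e))"
    proof (cases "x \<in> K")
      case False
      then show ?thesis by (simp add: f_outside)
    next
      case True
      then have fx: "f x > 0" using f_lower[of x] c1_pos by simp
      \<comment> \<open>Chosen so that \<open>f x * V u\<close> becomes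
        \<open>\<kappa> * norm u ^ DIM('a)\<close>; then \<kappa>/v = f(x)/2^d, which yields
        2^(d+\<beta>).\<close>
      define \<kappa> where "\<kappa> = f x * ?v / 2 ^ ?d"
      have \<kappa>: "\<kappa> > 0" using fx v by (simp add: \<kappa>_def)
      have "(\<integral>\<^sup>+u. ennreal (norm u powr \<beta>) * ennreal ((f x)\<^sup>2 * exp (- (f x * V u))) \<partial>lborel)
        = (\<integral>\<^sup>+u. ennreal ((f x)\<^sup>2) * ennreal (norm u powr \<beta> * exp (- \<kappa> * norm u ^ ?d)) \<partial>(lborel :: 'a measure))"
      proof (intro nn_integral_cong)
        fix u :: 'a
        have "f x * V u = \<kappa> * norm u ^ ?d" by (simp add: V_def \<kappa>_def power_divide)
        then show "ennreal (norm u powr \<beta>) * ennreal ((f x)\<^sup>2 * exp (- (f x * V u)))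
          = ennreal ((f x)\<^sup>2) * ennreal (norm u powr \<beta> * exp (- \<kappa> * norm u ^ ?d))"
          by (simp add: mult_ac flip: ennreal_mult)
      qed
      also have "\<dots> = ennreal ((f x)\<^sup>2) * (\<integral>\<^sup>+u. ennreal (norm u powr \<beta> * exp (- \<kappa> * norm u ^ ?d)) \<partial>(lborel :: 'a measure))"
        by (rule nn_integral_cmult) measurable
      also have "\<dots> = ennreal ((f x)\<^sup>2 * (?v powr (- \<beta> / ?d) * (\<kappa> / ?v) powr (- 1 - \<beta> / ?d) * Gamma (1 + \<beta> / ?d)))"
        unfolding nn_integral_norm_powr_exp[OF \<kappa> \<beta>] by (simp add: ennreal_mult')
      also have "(f x)\<^sup>2 * (?v powr (- \<beta> / ?d) * (\<kappa> / ?v) powr (- 1 - \<beta> / ?d) * Gamma (1 + \<beta> / ?d)) = C * f x powr e"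
      proof -
        have "(\<kappa> / ?v) powr (- 1 - \<beta> / ?d) = (f x / 2 powr ?d) powr (- 1 - \<beta> / ?d)"
          using less_imp_neq[OF v, symmetric] by (simp add: \<kappa>_def powr_realpow)
        also have "\<dots> = f x powr (- 1 - \<beta> / ?d) * 2 powr (?d + \<beta>)"
          using fx by (simp add: powr_divide powr_powr powr_minus field_simps flip: powr_add)
        finally have 1: "(\<kappa> / ?v) powr (- 1 - \<beta> / ?d) = f x powr (- 1 - \<beta> / ?d) * 2 powr (?d + \<beta>)" .
        have "(f x)\<^sup>2 * f x powr (- 1 - \<beta> / ?d) = f x powr (2 + (- 1 - \<beta> / ?d))"
          using fx by (subst powr_add) (simp add: powr_numeral)
        also have "2 + (- 1 - \<beta> / ?d) = e" by (simp add: e_def diff_divide_distrib)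
        finally show ?thesis unfolding 1 C_def by (simp add: mult_ac)
      qed
      finally show ?thesis using True by simp
    qed
  qed
  also have "\<dots> = ennreal (LINT x|lborel. C * (indicator K x * f x powr e))"
  proof (rule nn_integral_eq_integral)
    show "integrable lborel (\<lambda>x. C * (indicator K x * f x powr e))"
    \<comment> \<open>The exponent \<open>e\<close> is negative when \<beta> exceeds the dimension,
      so either bound of \<open>f\<close> may give the maximum.\<close>
    proof (rule integrable_bounded_outside_K[where B="C * (1 * max (c1 powr e) (c2 powr e))"])
      fix x assume x: "x \<in> K"
      have "f x powr e \<le> max (c1 powr e) (c2 powr e)"
        using f_lower[OF x] f_upper[OF x] c1_pos
        by (cases "e \<ge> 0") (auto simp: le_max_iff_disj intro: powr_mono2 powr_mono2')
      then show "\<bar>C * (indicator K x * f x powr e)\<bar> \<le> C * (1 * max (c1 powr e) (c2 powr e))"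
        using x C by (simp add: abs_mult mult_left_mono)
    qed auto
  qed (use C in auto)
  finally show ?thesis
    by (simp add: C_def e_def set_lebesgue_integral_def)
qed

lemma pair_moment_tendsto:
  fixes \<beta> :: real
  assumes \<beta>: "\<beta> \<ge> 0"
  shows "(\<lambda>n. ennreal (real n powr (1 + \<beta> / DIM('a))) * pair_moment \<beta> (n - j))
    \<longlonglongrightarrow> ennreal (ubv TYPE('a) powr (- \<beta> / DIM('a)) * 2 powr (DIM('a) + \<beta>) * Gamma (1 + \<beta> / DIM('a))
         * (LINT x:K|lborel. f x powr ((DIM('a) - \<beta>) / DIM('a))))"
proof -
  \<comment> \<open>Dominated convergence needs the bound for every term, and \<open>J_le\<close>
    holds only from this index on; the shift is undone at the end by
    \<open>LIMSEQ_offset\<close>.\<close>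
  define m where "m = max 1 (2 * j)"
  have "(\<lambda>n. \<integral>\<^sup>+u. ennreal (norm u powr \<beta>) * ennreal (J j (n + m) u) \<partial>lborel)
    \<longlonglongrightarrow> (\<integral>\<^sup>+u. ennreal (norm u powr \<beta>) * ennreal (LINT x|lborel. (f x)\<^sup>2 * exp (- (f x * V u))) \<partial>lborel)"
  proof (rule nn_integral_dominated_convergence[where w="\<lambda>u. ennreal c2 * ennreal (norm u powr \<beta> * exp (- (cone_const / 2) * norm u ^ DIM('a)))"])
    have "(\<integral>\<^sup>+u. ennreal c2 * ennreal (norm u powr \<beta> * exp (- (cone_const / 2) * norm u ^ DIM('a))) \<partial>(lborel :: 'a measure))
      = ennreal c2 * (\<integral>\<^sup>+u. ennreal (norm u powr \<beta> * exp (- (cone_const / 2) * norm u ^ DIM('a))) \<partial>(lborel :: 'a measure))"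
      by (rule nn_integral_cmult) measurable
    also have "\<dots> < \<infinity>"
      by (subst nn_integral_norm_powr_exp) (use cone_const_pos \<beta> in \<open>auto simp: ennreal_mult_less_top\<close>)
    finally show "(\<integral>\<^sup>+u. ennreal c2 * ennreal (norm u powr \<beta> * exp (- (cone_const / 2) * norm u ^ DIM('a))) \<partial>(lborel :: 'a measure)) < \<infinity>" .
    show "AE u in lborel. ennreal (norm u powr \<beta>) * ennreal (J j (n + m) u)
        \<le> ennreal c2 * ennreal (norm u powr \<beta> * exp (- (cone_const / 2) * norm u ^ DIM('a)))" for n
    proof (rule AE_I2)
      fix u :: 'a
      have "J j (n + m) u \<le> c2 * exp (- (cone_const / 2) * norm u ^ DIM('a))"
        by (rule J_le) (auto simp: m_def)
      then have "norm u powr \<beta> * J j (n + m) u \<le> norm u powr \<beta> * (c2 * exp (- (cone_const / 2) * norm u ^ DIM('a)))"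
        by (intro mult_left_mono) auto
      then show "ennreal (norm u powr \<beta>) * ennreal (J j (n + m) u)
        \<le> ennreal c2 * ennreal (norm u powr \<beta> * exp (- (cone_const / 2) * norm u ^ DIM('a)))"
        using c2_pos J_nonneg by (simp add: mult_ac ennreal_leI flip: ennreal_mult)
    qed
    show "AE u in lborel. (\<lambda>n. ennreal (norm u powr \<beta>) * ennreal (J j (n + m) u))
       \<longlonglongrightarrow> ennreal (norm u powr \<beta>) * ennreal (LINT x|lborel. (f x)\<^sup>2 * exp (- (f x * V u)))"
      by (intro AE_I2 ennreal_tendsto_cmult tendsto_ennrealI LIMSEQ_ignore_initial_segment[OF J_tendsto]) auto
  qed (auto intro!: lborel.borel_measurable_lebesgue_integral)
  then have "(\<lambda>n. ennreal (real (n + m) powr (1 + \<beta> / DIM('a))) * pair_moment \<beta> (n + m - j))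
    \<longlonglongrightarrow> ennreal (ubv TYPE('a) powr (- \<beta> / DIM('a)) * 2 powr (DIM('a) + \<beta>) * Gamma (1 + \<beta> / DIM('a))
         * (LINT x:K|lborel. f x powr ((DIM('a) - \<beta>) / DIM('a))))"
    unfolding nn_integral_Jlim[OF \<beta>] by (subst pair_moment_J) (auto simp: m_def)
  then show ?thesis by (rule LIMSEQ_offset)
qed

end

section \<open>Products of two edge functions\<close>

lemma prod_indicator_ennreal:
  assumes "finite A"
  shows "(\<Prod>k\<in>A. indicator B (\<omega> k) :: ennreal) = (if \<forall>k\<in>A. \<omega> k \<in> B then 1 else 0)"
  using assms by (induction A rule: finite_induct) (auto simp: indicator_def)

context convex_density
begin

text \<open>An explicit envelope of an edge term for endpoints in \<open>K\<close>: the emptiness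
  probability is replaced by the exponential that the lower bound on \<open>p\<close> yields, with
  \<open>s\<close> in the role of the number of points.\<close>

definition W :: "real \<Rightarrow> real \<Rightarrow> 'a \<Rightarrow> 'a \<Rightarrow> real" where
  "W \<beta> s x y = dist x y powr \<beta> * exp (- (cone_const * s * dist x y ^ DIM('a)))"

lemma W_nonneg: "0 \<le> W \<beta> s x y" by (simp add: W_def)

lemma W_measurable[measurable]: "(\<lambda>z. W \<beta> s (fst z) (snd z)) \<in> borel_measurable (borel \<Otimes>\<^sub>M borel)"
  unfolding W_def by measurable

lemma W_measurable'[measurable (raw)]:
  assumes "a \<in> borel_measurable M" "b \<in> borel_measurable M"
  shows "(\<lambda>z. W \<beta> s (a z) (b z)) \<in> borel_measurable M"
  using measurable_compose[OF measurable_Pair[OF assms] W_measurable] by simp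

definition W_const :: "real \<Rightarrow> real" where
  "W_const \<beta> = c2 * (ubv TYPE('a) powr (- \<beta> / DIM('a)) * (cone_const / ubv TYPE('a)) powr (- 1 - \<beta> / DIM('a))
      * Gamma (1 + \<beta> / DIM('a)))"

lemma W_const_nonneg: "0 \<le> \<beta> \<Longrightarrow> 0 \<le> W_const \<beta>"
  unfolding W_const_def using c2_pos by (intro mult_nonneg_nonneg Gamma_real_nonneg add_pos_nonneg) auto

text \<open>Bounding the density by \<open>c2\<close> reduces this to the Gamma integral with rate
  \<open>cone_const * s\<close>. The bound is uniform in \<open>x\<close>, which is what allows
  integrating out one endpoint at a time.\<close>

lemma nn_integral_W_le:
  assumes s: "s > 0" and \<beta>: "\<beta> \<ge> 0"
  shows "(\<integral>\<^sup>+y. ennreal (W \<beta> s x y) \<partial>\<mu>) \<le> ennreal (W_const \<beta> * s powr (- 1 - \<beta> / DIM('a)))"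
proof -
  let ?v = "ubv TYPE('a)"
  have ps: "cone_const * s > 0" using cone_const_pos s by simp
  have "(\<integral>\<^sup>+y. ennreal (W \<beta> s x y) \<partial>\<mu>) = (\<integral>\<^sup>+y. ennreal (f y) * ennreal (W \<beta> s x y) \<partial>lborel)"
    by (rule nn_integral_\<mu>) measurable
  also have "\<dots> \<le> (\<integral>\<^sup>+y. ennreal c2 * ennreal (W \<beta> s x y) \<partial>lborel)"
    using f_le by (intro nn_integral_mono mult_right_mono ennreal_leI) auto
  also have "\<dots> = ennreal c2 * (\<integral>\<^sup>+y. ennreal (W \<beta> s x y) \<partial>lborel)"
    by (rule nn_integral_cmult) measurable
  also have "(\<integral>\<^sup>+y. ennreal (W \<beta> s x y) \<partial>lborel) = (\<integral>\<^sup>+u. ennreal (W \<beta> s x (x + 1 *\<^sub>R u)) \<partial>lborel)"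
    using nn_integral_lborel_affine[of "\<lambda>y. ennreal (W \<beta> s x y)" 1 x] by simp
  also have "\<dots> = (\<integral>\<^sup>+u. ennreal (norm u powr \<beta> * exp (- (cone_const * s) * norm u ^ DIM('a))) \<partial>(lborel :: 'a measure))"
    by (simp add: W_def dist_norm)
  also have "\<dots> = ennreal (?v powr (- \<beta> / DIM('a)) * (cone_const * s / ?v) powr (- 1 - \<beta> / DIM('a)) * Gamma (1 + \<beta> / DIM('a)))"
    by (rule nn_integral_norm_powr_exp[OF ps \<beta>])
  also have "(cone_const * s / ?v) powr (- 1 - \<beta> / DIM('a)) = (cone_const / ?v) powr (- 1 - \<beta> / DIM('a)) * s powr (- 1 - \<beta> / DIM('a))"
  proof -
    have "cone_const * s / ?v = (cone_const / ?v) * s" by simp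
    then show ?thesis by (simp only: powr_mult)
  qed
  also have "ennreal c2 * ennreal (?v powr (- \<beta> / DIM('a)) * ((cone_const / ?v) powr (- 1 - \<beta> / DIM('a)) * s powr (- 1 - \<beta> / DIM('a))) * Gamma (1 + \<beta> / DIM('a)))
     = ennreal (W_const \<beta> * s powr (- 1 - \<beta> / DIM('a)))"
    unfolding W_const_def using c2_pos by (subst ennreal_mult'[symmetric]) (auto simp: mult_ac)
  finally show ?thesis .
qed

section \<open>Edge terms as functions of the sample, and their expectations\<close>

text \<open>The endpoints are excluded by index instead of by value, so that the remaining
  coordinates are independent of them; for distinct points this agrees with adjacency when the
  indices differ.\<close>

definition g :: "nat \<Rightarrow> real \<Rightarrow> nat \<Rightarrow> nat \<Rightarrow> (nat \<Rightarrow> 'a) \<Rightarrow> real" where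
  "g n \<beta> i j \<omega> = (if \<forall>k\<in>{..<n} - {i, j}. \<omega> k \<notin> gball (\<omega> i) (\<omega> j) then dist (\<omega> i) (\<omega> j) powr \<beta> else 0)"

lemma g_nonneg: "0 \<le> g n \<beta> i j \<omega>" by (simp add: g_def)

lemma g_commute: "g n \<beta> i j \<omega> = g n \<beta> j i \<omega>"
  unfolding g_def gball_commute[of "\<omega> i"] dist_commute[of "\<omega> i"] insert_commute[of i j] by (rule refl)

lemma mem_gball_iff: "z \<in> gball x y \<longleftrightarrow> dist ((1/2) *\<^sub>R (x + y)) z \<le> dist x y / 2"
  by (simp add: gball_def midpoint_def)

abbreviation "PM A \<equiv> Pi\<^sub>M A (\<lambda>_. \<mu>)"

lemma component_measurable[measurable (raw)]:
  "i \<in> A \<Longrightarrow> (\<lambda>\<omega>. \<omega> i) \<in> borel_measurable (PM A)"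
  using measurable_component_singleton[of i A "\<lambda>_. \<mu>"] by (simp cong: measurable_cong_sets)

lemma mem_gball_measurable[measurable (raw)]:
  assumes [measurable]: "a \<in> borel_measurable M" "b \<in> borel_measurable M" "c \<in> borel_measurable M"
  shows "Measurable.pred M (\<lambda>z. c z \<in> gball (a z) (b z))"
  unfolding mem_gball_iff by measurable

lemma g_measurable[measurable]:
  assumes "i < n" "j < n"
  shows "g n \<beta> i j \<in> borel_measurable (PM {..<n})"
proof -
  have [measurable]: "(\<lambda>\<omega>. \<omega> k) \<in> borel_measurable (PM {..<n})" if "k < n" for k
    using that by (intro component_measurable) auto
  have [measurable]: "Measurable.pred (PM {..<n}) (\<lambda>\<omega>. \<forall>k\<in>{..<n} - {i, j}. \<omega> k \<notin> gball (\<omega> i) (\<omega> j))"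
    using assms by (intro pred_intros_finite) (auto intro!: mem_gball_measurable component_measurable pred_intros_logic)
  show ?thesis unfolding g_def using assms by measurable
qed

text \<open>Given the coordinates in \<open>E\<close>, each of the other n - card E points
  independently misses the region with probability one minus its mass.\<close>

lemma nn_integral_empty_region:
  assumes E: "E \<subseteq> {..<n}"
    and psi[measurable]: "\<psi> \<in> borel_measurable (PM E)"
    and B[measurable]: "Measurable.pred (PM E \<Otimes>\<^sub>M \<mu>) (\<lambda>z. snd z \<in> B (fst z))"
    and Bm: "\<And>e. B e \<in> sets borel"
  shows "(\<integral>\<^sup>+\<omega>. \<psi> (restrict \<omega> E) * (if \<forall>k\<in>{..<n} - E. \<omega> k \<notin> B (restrict \<omega> E) then 1 else 0) \<partial>PM {..<n})
    = (\<integral>\<^sup>+e. \<psi> e * ennreal ((1 - measure \<mu> (B e)) ^ (n - card E)) \<partial>PM E)"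
proof -
  have m: "(\<lambda>(e, z). indicator (- B e) z :: ennreal) \<in> borel_measurable (PM E \<Otimes>\<^sub>M \<mu>)"
    unfolding indicator_def split_beta' Compl_iff by measurable
  have "(\<integral>\<^sup>+z. indicator (- B e) z \<partial>\<mu>) = ennreal (1 - measure \<mu> (B e))" for e
  proof -
    have "(\<integral>\<^sup>+z. indicator (- B e) z \<partial>\<mu>) = emeasure \<mu> (space \<mu> - B e)"
      using Bm by (subst nn_integral_indicator) (auto simp: Compl_eq_Diff_UNIV)
    also have "\<dots> = ennreal (1 - measure \<mu> (B e))"
      using Bm[of e] \<mu>.prob_compl[of "B e"] by (simp add: \<mu>.emeasure_eq_measure)
    finally show ?thesis .
  qed
  moreover have "card ({..<n} - E) = n - card E"
    using E by (simp add: card_Diff_subset finite_subset)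
  ultimately have "(\<integral>\<^sup>+e. \<psi> e * (\<integral>\<^sup>+z. indicator (- B e) z \<partial>\<mu>) ^ card ({..<n} - E) \<partial>PM E)
      = (\<integral>\<^sup>+e. \<psi> e * ennreal ((1 - measure \<mu> (B e)) ^ (n - card E)) \<partial>PM E)"
    by (simp add: ennreal_power)
  then show ?thesis
    using nn_integral_PiM_split[OF prob_space_\<mu> _ E psi m]
    by (simp add: prod_indicator_ennreal)
qed

lemma nn_integral_g:
  assumes ij: "i < n" "j < n" "i \<noteq> j"
  shows "(\<integral>\<^sup>+\<omega>. ennreal (g n \<beta> i j \<omega>) \<partial>PM {..<n}) = pair_moment \<beta> (n - 2)"
proof -
  let ?E = "{i, j}"
  have [measurable]: "(\<lambda>e. e i) \<in> borel_measurable (PM ?E)" "(\<lambda>e. e j) \<in> borel_measurable (PM ?E)"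
    by (auto intro: component_measurable)
  have [measurable]: "(\<lambda>z. snd z) \<in> borel_measurable (PM ?E \<Otimes>\<^sub>M \<mu>)"
    using measurable_snd[of "PM ?E" \<mu>] by (simp cong: measurable_cong_sets)
  have "(\<integral>\<^sup>+\<omega>. ennreal (g n \<beta> i j \<omega>) \<partial>PM {..<n})
    = (\<integral>\<^sup>+\<omega>. (\<lambda>e. ennreal (dist (e i) (e j) powr \<beta>)) (restrict \<omega> ?E) *
         (if \<forall>k\<in>{..<n} - ?E. \<omega> k \<notin> (\<lambda>e. gball (e i) (e j)) (restrict \<omega> ?E) then 1 else 0) \<partial>PM {..<n})"
    by (intro nn_integral_cong) (simp add: g_def)
  also have "\<dots> = (\<integral>\<^sup>+e. ennreal (dist (e i) (e j) powr \<beta>) * ennreal ((1 - measure \<mu> (gball (e i) (e j))) ^ (n - card ?E)) \<partial>PM ?E)"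
    by (rule nn_integral_empty_region) (use ij in \<open>auto intro!: mem_gball_measurable\<close>)
  also have "\<dots> = (\<integral>\<^sup>+e. ennreal (dist (e i) (e j) powr \<beta> * (1 - p (e i) (e j)) ^ (n - 2)) \<partial>PM ?E)"

  proof -
    have "card ?E = 2" using ij by simp
    then show ?thesis by (simp only: p_def ennreal_mult' powr_ge_zero)
  qed
  also have "\<dots> = pair_moment \<beta> (n - 2)"
    unfolding pair_moment_def
    using nn_integral_PiM_2[OF prob_space_\<mu>, of "\<lambda>x y. ennreal (dist x y powr \<beta> * (1 - p x y) ^ (n - 2))" i j] ij
    by (simp add: split_beta')
  finally show ?thesis .
qed

lemma AE_PM_K: "i \<in> A \<Longrightarrow> AE e in PM A. e i \<in> K"
  by (rule AE_PiM_component[OF prob_space_\<mu> _ AE_\<mu>_K])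

text \<open>The union has at least the average of the two ball masses, so the exponential bound
  splits into one factor per edge. The parameter n/4 is n/2 from the exponent times 1/2 from
  averaging.\<close>

lemma one_minus_union_le:
  assumes K: "x \<in> K" "y \<in> K" "z \<in> K" "w \<in> K" and m: "n / 2 \<le> real m"
  shows "dist x y powr \<beta> * dist z w powr \<beta> * (1 - measure \<mu> (gball x y \<union> gball z w)) ^ m
    \<le> W \<beta> (n / 4) x y * W \<beta> (n / 4) z w"
proof -
  let ?d = "DIM('a)"
  define r where "r = measure \<mu> (gball x y \<union> gball z w)"
  have "p x y \<le> r" "p z w \<le> r" unfolding p_def r_def by (auto intro!: \<mu>.finite_measure_mono)
  moreover have "cone_const * dist x y ^ ?d \<le> p x y" "cone_const * dist z w ^ ?d \<le> p z w" using cone_const K by auto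
  ultimately have r: "(cone_const * dist x y ^ ?d + cone_const * dist z w ^ ?d) / 2 \<le> r" by simp
  have r1: "r \<le> 1" by (simp add: r_def)
  have "(1 - r) ^ m \<le> exp (- r) ^ m"
    using exp_ge_add_one_self[of "- r"] r1 by (intro power_mono) auto
  also have "\<dots> = exp (- (m * r))" by (simp flip: exp_of_nat_mult)
  also have "\<dots> \<le> exp (- (n / 2 * ((cone_const * dist x y ^ ?d + cone_const * dist z w ^ ?d) / 2)))"

  proof -
    have "n / 2 * ((cone_const * dist x y ^ ?d + cone_const * dist z w ^ ?d) / 2) \<le> m * r"
      using m r cone_const_pos by (intro mult_mono) auto
    then show ?thesis by simp
  qed
  also have "\<dots> = exp (- (cone_const * (n / 4) * dist x y ^ ?d)) * exp (- (cone_const * (n / 4) * dist z w ^ ?d))"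
    by (simp add: field_simps flip: exp_add)
  finally have "dist x y powr \<beta> * dist z w powr \<beta> * (1 - r) ^ m
     \<le> dist x y powr \<beta> * dist z w powr \<beta> * (exp (- (cone_const * (n / 4) * dist x y ^ ?d)) * exp (- (cone_const * (n / 4) * dist z w ^ ?d)))"
    by (intro mult_left_mono) auto
  then show ?thesis by (simp add: W_def r_def mult_ac)
qed

text \<open>Reduces the diagonal part of the second moment to a first moment with doubled
  exponent.\<close>

lemma g_square: "(g n \<beta> i j \<omega>)\<^sup>2 = g n (2 * \<beta>) i j \<omega>"
  by (simp add: g_def power2_eq_square flip: powr_add)

definition W_bound :: "real \<Rightarrow> nat \<Rightarrow> real" where
  "W_bound \<beta> n = W_const \<beta> * (n / 4) powr (- 1 - \<beta> / DIM('a))"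

lemma W_bound_nonneg: "0 \<le> \<beta> \<Longrightarrow> 0 \<le> W_bound \<beta> n"
  unfolding W_bound_def using W_const_nonneg by (intro mult_nonneg_nonneg) auto

lemma nn_integral_W_bound:
  assumes "n > 0" "\<beta> \<ge> 0"
  shows "(\<integral>\<^sup>+y. ennreal (W \<beta> (n / 4) x y) \<partial>\<mu>) \<le> ennreal (W_bound \<beta> n)"
  unfolding W_bound_def using assms by (intro nn_integral_W_le) auto

lemma snd_PM_measurable: "(\<lambda>z. snd z) \<in> borel_measurable (PM E \<Otimes>\<^sub>M \<mu>)"
  using measurable_snd[of "PM E" \<mu>] by (simp cong: measurable_cong_sets)

lemma fst_PM_measurable: "i \<in> E \<Longrightarrow> (\<lambda>z. fst z i) \<in> borel_measurable (PM E \<Otimes>\<^sub>M \<mu>)"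
  by (rule measurable_compose[OF measurable_fst component_measurable])

text \<open>Only an inequality holds: each edge also requires the endpoints of the other edge that
  it does not share to lie outside its ball, and this requirement is dropped. The set
  \<open>E\<close> has three or four elements according to whether the edges share a vertex.\<close>

lemma nn_integral_g_two_edges:
  assumes E: "E \<subseteq> {..<n}" "{i, j, k, l} = E"
  shows "(\<integral>\<^sup>+\<omega>. ennreal (g n \<beta> i j \<omega>) * ennreal (g n \<beta> k l \<omega>) \<partial>PM {..<n})
    \<le> (\<integral>\<^sup>+e. ennreal (dist (e i) (e j) powr \<beta> * dist (e k) (e l) powr \<beta>) *
          ennreal ((1 - measure \<mu> (gball (e i) (e j) \<union> gball (e k) (e l))) ^ (n - card E)) \<partial>PM E)"
proof -
  have in_E: "i \<in> E" "j \<in> E" "k \<in> E" "l \<in> E" using E(2) by auto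
  have [measurable]: "(\<lambda>e. e i) \<in> borel_measurable (PM E)" "(\<lambda>e. e j) \<in> borel_measurable (PM E)"
    "(\<lambda>e. e k) \<in> borel_measurable (PM E)" "(\<lambda>e. e l) \<in> borel_measurable (PM E)"
    using in_E by (auto intro: component_measurable)
  have "(\<integral>\<^sup>+\<omega>. ennreal (g n \<beta> i j \<omega>) * ennreal (g n \<beta> k l \<omega>) \<partial>PM {..<n})
    \<le> (\<integral>\<^sup>+\<omega>. (\<lambda>e. ennreal (dist (e i) (e j) powr \<beta> * dist (e k) (e l) powr \<beta>)) (restrict \<omega> E) *
         (if \<forall>k'\<in>{..<n} - E. \<omega> k' \<notin> (\<lambda>e. gball (e i) (e j) \<union> gball (e k) (e l)) (restrict \<omega> E) then 1 else 0) \<partial>PM {..<n})"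
  proof (rule nn_integral_mono)
    fix \<omega>
    show "ennreal (g n \<beta> i j \<omega>) * ennreal (g n \<beta> k l \<omega>)
      \<le> (\<lambda>e. ennreal (dist (e i) (e j) powr \<beta> * dist (e k) (e l) powr \<beta>)) (restrict \<omega> E) *
         (if \<forall>k'\<in>{..<n} - E. \<omega> k' \<notin> (\<lambda>e. gball (e i) (e j) \<union> gball (e k) (e l)) (restrict \<omega> E) then 1 else 0)"
      using E(2) in_E by (auto simp: g_def ennreal_mult)
  qed
  also have "\<dots> = (\<integral>\<^sup>+e. ennreal (dist (e i) (e j) powr \<beta> * dist (e k) (e l) powr \<beta>) *
          ennreal ((1 - measure \<mu> (gball (e i) (e j) \<union> gball (e k) (e l))) ^ (n - card E)) \<partial>PM E)"
  proof (rule nn_integral_empty_region[OF E(1)])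
    show "Measurable.pred (PM E \<Otimes>\<^sub>M \<mu>) (\<lambda>z. snd z \<in> gball (fst z i) (fst z j) \<union> gball (fst z k) (fst z l))"
      unfolding Un_iff using in_E
      by (intro pred_intros_logic mem_gball_measurable snd_PM_measurable fst_PM_measurable)
  qed auto
  finally show ?thesis .
qed

lemma nn_integral_W_W:
  "(\<integral>\<^sup>+x. \<integral>\<^sup>+y. \<integral>\<^sup>+z. ennreal (W \<beta> s x y) * ennreal (W \<beta> s x z) \<partial>\<mu> \<partial>\<mu> \<partial>\<mu>)
    = (\<integral>\<^sup>+x. (\<integral>\<^sup>+y. ennreal (W \<beta> s x y) \<partial>\<mu>) * (\<integral>\<^sup>+z. ennreal (W \<beta> s x z) \<partial>\<mu>) \<partial>\<mu>)"
  by (simp add: nn_integral_cmult nn_integral_multc)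

lemma nn_integral_PM_W_W:
  assumes "i \<noteq> j" "i \<noteq> l" "j \<noteq> l"
  shows "(\<integral>\<^sup>+e. ennreal (W \<beta> s (e i) (e j)) * ennreal (W \<beta> s (e i) (e l)) \<partial>PM {i, j, l})
    = (\<integral>\<^sup>+x. (\<integral>\<^sup>+y. ennreal (W \<beta> s x y) \<partial>\<mu>) * (\<integral>\<^sup>+z. ennreal (W \<beta> s x z) \<partial>\<mu>) \<partial>\<mu>)"
  unfolding nn_integral_W_W[symmetric] using assms
  by (intro nn_integral_PiM_3[OF prob_space_\<mu>, of "\<lambda>x y z. ennreal (W \<beta> s x y) * ennreal (W \<beta> s x z)"])
     (auto simp: split_beta')

text \<open>Given the common vertex, the envelopes of the two edges are integrated separately, each
  at most \<open>W_bound\<close>. From n >= 6 on, the exponent n - 3 is at least n/2.\<close>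

lemma nn_integral_g_shared:
  assumes ij: "i < n" "j < n" "l < n" "i \<noteq> j" "i \<noteq> l" "j \<noteq> l" and n: "6 \<le> n" and \<beta>: "\<beta> \<ge> 0"
  shows "(\<integral>\<^sup>+\<omega>. ennreal (g n \<beta> i j \<omega>) * ennreal (g n \<beta> i l \<omega>) \<partial>PM {..<n}) \<le> ennreal ((W_bound \<beta> n)\<^sup>2)"
proof -
  let ?E = "{i, j, l}"
  let ?W = "W \<beta> (n / 4)"
  have card: "card ?E = 3" using ij by simp
  have m: "real n / 2 \<le> real (n - 3)" using n by (simp add: of_nat_diff)
  have [measurable]: "(\<lambda>e. e i) \<in> borel_measurable (PM ?E)" "(\<lambda>e. e j) \<in> borel_measurable (PM ?E)"
    "(\<lambda>e. e l) \<in> borel_measurable (PM ?E)"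
    by (auto intro: component_measurable)
  have "(\<integral>\<^sup>+\<omega>. ennreal (g n \<beta> i j \<omega>) * ennreal (g n \<beta> i l \<omega>) \<partial>PM {..<n})
     \<le> (\<integral>\<^sup>+e. ennreal (dist (e i) (e j) powr \<beta> * dist (e i) (e l) powr \<beta>) *
          ennreal ((1 - measure \<mu> (gball (e i) (e j) \<union> gball (e i) (e l))) ^ (n - card ?E)) \<partial>PM ?E)"
    by (rule nn_integral_g_two_edges) (use ij in auto)
  also have "\<dots> \<le> (\<integral>\<^sup>+e. ennreal (?W (e i) (e j)) * ennreal (?W (e i) (e l)) \<partial>PM ?E)"
  proof (rule nn_integral_mono_AE)
    have "AE e in PM ?E. e i \<in> K" "AE e in PM ?E. e j \<in> K" "AE e in PM ?E. e l \<in> K"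
      by (auto intro!: AE_PM_K)
    then show "AE e in PM ?E. ennreal (dist (e i) (e j) powr \<beta> * dist (e i) (e l) powr \<beta>) *
          ennreal ((1 - measure \<mu> (gball (e i) (e j) \<union> gball (e i) (e l))) ^ (n - card ?E))
        \<le> ennreal (?W (e i) (e j)) * ennreal (?W (e i) (e l))"
    proof eventually_elim
      case (elim e)
      show ?case
        using one_minus_union_le[OF elim(1,2,1,3) m, of \<beta>]
        unfolding card by (simp add: W_nonneg ennreal_leI flip: ennreal_mult)
    qed
  qed
  also have "\<dots> = (\<integral>\<^sup>+x. (\<integral>\<^sup>+y. ennreal (?W x y) \<partial>\<mu>) * (\<integral>\<^sup>+z. ennreal (?W x z) \<partial>\<mu>) \<partial>\<mu>)"
    using ij by (intro nn_integral_PM_W_W) auto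
  also have "\<dots> \<le> (\<integral>\<^sup>+x. ennreal (W_bound \<beta> n) * ennreal (W_bound \<beta> n) \<partial>\<mu>)"
    using nn_integral_W_bound n \<beta> by (intro nn_integral_mono mult_mono) auto
  also have "\<dots> = ennreal ((W_bound \<beta> n)\<^sup>2)"
    using W_bound_nonneg[OF \<beta>] by (simp add: \<mu>.emeasure_space_1[simplified] power2_eq_square ennreal_mult)
  finally show ?thesis .
qed

lemma emeasure_\<mu>_cball_le:
  assumes "0 \<le> r"
  shows "emeasure \<mu> (cball x r) \<le> ennreal (c2 * (ubv TYPE('a) * r ^ DIM('a)))"
proof -
  have "emeasure \<mu> (cball x r) = (\<integral>\<^sup>+z. ennreal (f z) * indicator (cball x r) z \<partial>lborel)"
    unfolding \<mu>_def by (subst emeasure_density) auto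
  also have "\<dots> \<le> (\<integral>\<^sup>+z. ennreal c2 * indicator (cball x r) z \<partial>lborel)"
    using f_le by (intro nn_integral_mono mult_right_mono ennreal_leI) auto
  also have "\<dots> = ennreal c2 * ennreal (ubv TYPE('a) * r ^ DIM('a))"
    using emeasure_cball[OF assms, of x] by (subst nn_integral_cmult_indicator) auto
  finally show ?thesis using c2_pos by (simp add: ennreal_mult')
qed

text \<open>Chosen so that the ball of radius 2r has mass at most \<open>near_const\<close> times
  r^d.\<close>

definition near_const :: real where
  "near_const = c2 * (ubv TYPE('a) * 2 ^ DIM('a))"

lemma near_const_nonneg: "0 \<le> near_const"
  using c2_pos by (simp add: near_const_def)

text \<open>Confining \<open>z\<close> to a ball of radius 2|x-y| contributes a factor |x-y|^d,
  which raises the exponent from \<beta> to \<beta> + d. The corresponding \<open>W_bound\<close> is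
  smaller by the order 1/n, and this gain makes intersecting balls negligible.\<close>

lemma nn_integral_W_near:
  fixes \<beta> :: real
  assumes n: "n > 0" and \<beta>: "\<beta> \<ge> 0"
  shows "(\<integral>\<^sup>+x. \<integral>\<^sup>+y. \<integral>\<^sup>+z. ennreal (W \<beta> (n / 4) x y) * indicator (cball x (2 * dist x y)) z \<partial>\<mu> \<partial>\<mu> \<partial>\<mu>)
    \<le> ennreal (near_const * W_bound (\<beta> + DIM('a)) n)"
proof -
  let ?W = "W \<beta> (n / 4)" and ?W' = "W (\<beta> + DIM('a)) (n / 4)"
  have "(\<integral>\<^sup>+z. ennreal (?W x y) * indicator (cball x (2 * dist x y)) z \<partial>\<mu>) \<le> ennreal near_const * ennreal (?W' x y)" for x y
  proof -
    have "(\<integral>\<^sup>+z. ennreal (?W x y) * indicator (cball x (2 * dist x y)) z \<partial>\<mu>)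
        = ennreal (?W x y) * emeasure \<mu> (cball x (2 * dist x y))"
      by (rule nn_integral_cmult_indicator) simp
    also have "\<dots> \<le> ennreal (?W x y) * ennreal (c2 * (ubv TYPE('a) * (2 * dist x y) ^ DIM('a)))"
      by (intro mult_left_mono emeasure_\<mu>_cball_le) auto
    also have "\<dots> = ennreal (?W x y * (c2 * (ubv TYPE('a) * (2 * dist x y) ^ DIM('a))))"
      using W_nonneg by (simp add: ennreal_mult')
    also have "?W x y * (c2 * (ubv TYPE('a) * (2 * dist x y) ^ DIM('a))) = near_const * ?W' x y"
    proof (cases "x = y")
      case True
      then show ?thesis by (simp add: W_def)
    next
      case False
      then have "dist x y powr (\<beta> + DIM('a)) = dist x y powr \<beta> * dist x y ^ DIM('a)"
        by (simp add: powr_add powr_realpow)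
      then show ?thesis by (simp add: W_def near_const_def power_mult_distrib mult_ac)
    qed
    finally show ?thesis using near_const_nonneg W_nonneg by (simp add: ennreal_mult)
  qed
  then have "(\<integral>\<^sup>+x. \<integral>\<^sup>+y. \<integral>\<^sup>+z. ennreal (?W x y) * indicator (cball x (2 * dist x y)) z \<partial>\<mu> \<partial>\<mu> \<partial>\<mu>)
      \<le> (\<integral>\<^sup>+x. \<integral>\<^sup>+y. ennreal near_const * ennreal (?W' x y) \<partial>\<mu> \<partial>\<mu>)"
    by (intro nn_integral_mono)
  also have "\<dots> = (\<integral>\<^sup>+x. ennreal near_const * (\<integral>\<^sup>+y. ennreal (?W' x y) \<partial>\<mu>) \<partial>\<mu>)"
    by (simp add: nn_integral_cmult)
  also have "\<dots> \<le> (\<integral>\<^sup>+x. ennreal near_const * ennreal (W_bound (\<beta> + DIM('a)) n) \<partial>\<mu>)"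
    using n \<beta> by (intro nn_integral_mono mult_left_mono nn_integral_W_bound) auto
  also have "\<dots> = ennreal (near_const * W_bound (\<beta> + DIM('a)) n)"
    using near_const_nonneg by (simp add: \<mu>.emeasure_space_1[simplified] ennreal_mult')
  finally show ?thesis .
qed

text \<open>Disjoint balls give the product term. If the balls share a point t, then |x-z| <= |x-t|
  + |z-t| <= |x-y| + |z-w|, at most twice the longer edge. Hence one of the two indicators equals 1,
  and the envelope of \<open>one_minus_union_le\<close> applies.\<close>

lemma two_edges_le:
  fixes \<beta> n :: real and m :: nat
  assumes K: "x \<in> K" "y \<in> K" "z \<in> K" "w \<in> K" and m: "n / 2 \<le> real m"
  defines "A \<equiv> \<lambda>x y. dist x y powr \<beta> * (1 - p x y) ^ m"
  shows "ennreal (dist x y powr \<beta> * dist z w powr \<beta>) * ennreal ((1 - measure \<mu> (gball x y \<union> gball z w)) ^ m)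
    \<le> ennreal (A x y) * ennreal (A z w)
      + (indicator (cball x (2 * dist x y)) z + indicator (cball z (2 * dist z w)) x)
         * (ennreal (W \<beta> (n / 4) x y) * ennreal (W \<beta> (n / 4) z w))"
proof (cases "gball x y \<inter> gball z w = {}")
  case True
  then have u: "measure \<mu> (gball x y \<union> gball z w) = p x y + p z w"
    unfolding p_def by (intro \<mu>.finite_measure_Union) auto
  have "p x y + p z w \<le> 1" using \<mu>.prob_le_1[of "gball x y \<union> gball z w"] by (simp add: u)
  moreover have "1 - (p x y + p z w) \<le> (1 - p x y) * (1 - p z w)"
    using mult_nonneg_nonneg[OF p_nonneg p_nonneg, of x y z w] by (simp add: algebra_simps)
  ultimately have "(1 - (p x y + p z w)) ^ m \<le> ((1 - p x y) * (1 - p z w)) ^ m"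
    by (intro power_mono) auto
  then have "dist x y powr \<beta> * dist z w powr \<beta> * (1 - (p x y + p z w)) ^ m
      \<le> dist x y powr \<beta> * dist z w powr \<beta> * ((1 - p x y) * (1 - p z w)) ^ m"
    by (intro mult_left_mono) auto
  also have "\<dots> = A x y * A z w" by (simp add: A_def power_mult_distrib mult_ac)
  finally have "ennreal (dist x y powr \<beta> * dist z w powr \<beta> * (1 - (p x y + p z w)) ^ m) \<le> ennreal (A x y * A z w)"
    by (rule ennreal_leI)
  moreover have "0 \<le> A x y" unfolding A_def using p_le_1 by simp
  ultimately show ?thesis
    unfolding u by (simp add: ennreal_mult' add_increasing2)
next
  case False
  then obtain t where t: "t \<in> gball x y" "t \<in> gball z w" by auto
  have near: "dist a t \<le> dist a b" if "t \<in> gball a b" for a b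
  proof -
    have "dist a t \<le> dist a (midpoint a b) + dist (midpoint a b) t" by (rule dist_triangle)
    also have "\<dots> \<le> dist a b / 2 + dist a b / 2"
      using that by (intro add_mono) (auto simp: gball_def dist_midpoint)
    finally show ?thesis by simp
  qed
  have "dist x z \<le> dist x t + dist z t" by (rule dist_triangle2)
  also have "\<dots> \<le> dist x y + dist z w" using near t by (intro add_mono) auto
  finally have "z \<in> cball x (2 * dist x y) \<or> x \<in> cball z (2 * dist z w)"
    by (auto simp: dist_commute)
  then have one: "(1::ennreal) \<le> indicator (cball x (2 * dist x y)) z + indicator (cball z (2 * dist z w)) x"
    by (auto simp: indicator_def)
  have "ennreal (dist x y powr \<beta> * dist z w powr \<beta>) * ennreal ((1 - measure \<mu> (gball x y \<union> gball z w)) ^ m)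
     \<le> ennreal (W \<beta> (n / 4) x y) * ennreal (W \<beta> (n / 4) z w)"
    using one_minus_union_le[OF K m, of \<beta>] by (simp add: W_nonneg ennreal_leI flip: ennreal_mult)
  also have "\<dots> \<le> (indicator (cball x (2 * dist x y)) z + indicator (cball z (2 * dist z w)) x)
         * (ennreal (W \<beta> (n / 4) x y) * ennreal (W \<beta> (n / 4) z w))"
    using mult_right_mono[OF one] by (metis mult_1 zero_le)
  also have "\<dots> \<le> ennreal (A x y) * ennreal (A z w) + \<dots>" by simp
  finally show ?thesis .
qed

definition near :: "'a \<Rightarrow> 'a \<Rightarrow> 'a \<Rightarrow> ennreal" where
  "near x y = indicator (cball x (2 * dist x y))"

lemma near_measurable[measurable (raw)]:
  assumes [measurable]: "a \<in> borel_measurable M" "b \<in> borel_measurable M" "c \<in> borel_measurable M"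
  shows "(\<lambda>u. near (a u) (b u) (c u)) \<in> borel_measurable M"
  unfolding near_def indicator_def mem_cball by measurable

lemma nn_integral_near_first:
  fixes \<beta> :: real
  assumes n0: "n > 0" and \<beta>: "\<beta> \<ge> 0"
  shows "(\<integral>\<^sup>+x. \<integral>\<^sup>+y. \<integral>\<^sup>+z. \<integral>\<^sup>+w. ennreal (W \<beta> (n / 4) x y) * near x y z * ennreal (W \<beta> (n / 4) z w) \<partial>\<mu> \<partial>\<mu> \<partial>\<mu> \<partial>\<mu>)
    \<le> ennreal (W_bound \<beta> n) * ennreal (near_const * W_bound (\<beta> + DIM('a)) n)" (is "_ \<le> ?B * ?C")
proof -
  let ?W = "\<lambda>x y. ennreal (W \<beta> (n / 4) x y)"
  have "(\<integral>\<^sup>+x. \<integral>\<^sup>+y. \<integral>\<^sup>+z. \<integral>\<^sup>+w. ?W x y * near x y z * ?W z w \<partial>\<mu> \<partial>\<mu> \<partial>\<mu> \<partial>\<mu>)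
    = (\<integral>\<^sup>+x. \<integral>\<^sup>+y. \<integral>\<^sup>+z. ?W x y * near x y z * (\<integral>\<^sup>+w. ?W z w \<partial>\<mu>) \<partial>\<mu> \<partial>\<mu> \<partial>\<mu>)"
    by (simp add: nn_integral_cmult)
  also have "\<dots> \<le> (\<integral>\<^sup>+x. \<integral>\<^sup>+y. \<integral>\<^sup>+z. ?W x y * near x y z * ?B \<partial>\<mu> \<partial>\<mu> \<partial>\<mu>)"
    by (intro nn_integral_mono mult_left_mono nn_integral_W_bound n0 \<beta>) auto
  also have "\<dots> = (\<integral>\<^sup>+x. \<integral>\<^sup>+y. \<integral>\<^sup>+z. ?W x y * near x y z \<partial>\<mu> \<partial>\<mu> \<partial>\<mu>) * ?B"
    by (simp add: nn_integral_multc)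
  also have "\<dots> \<le> ?C * ?B"
    unfolding near_def by (intro mult_right_mono nn_integral_W_near n0 \<beta>) auto
  finally show ?thesis by (simp add: mult.commute)
qed

text \<open>Here \<open>x\<close> is the confined point: \<open>y\<close> is integrated out first,
  and two exchanges then move the integral over \<open>x\<close> innermost, which brings it to the
  form of \<open>nn_integral_W_near\<close>.\<close>

lemma nn_integral_near_second:
  fixes \<beta> :: real
  assumes n0: "n > 0" and \<beta>: "\<beta> \<ge> 0"
  shows "(\<integral>\<^sup>+x. \<integral>\<^sup>+y. \<integral>\<^sup>+z. \<integral>\<^sup>+w. ennreal (W \<beta> (n / 4) x y) * (ennreal (W \<beta> (n / 4) z w) * near z w x) \<partial>\<mu> \<partial>\<mu> \<partial>\<mu> \<partial>\<mu>)
    \<le> ennreal (W_bound \<beta> n) * ennreal (near_const * W_bound (\<beta> + DIM('a)) n)" (is "_ \<le> ?B * ?C")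
proof -
  let ?W = "\<lambda>x y. ennreal (W \<beta> (n / 4) x y)"
  have psf: "pair_sigma_finite \<mu> \<mu>"
    by (intro pair_sigma_finite.intro \<mu>.sigma_finite_measure_axioms)
  have "(\<integral>\<^sup>+x. \<integral>\<^sup>+y. \<integral>\<^sup>+z. \<integral>\<^sup>+w. ?W x y * (?W z w * near z w x) \<partial>\<mu> \<partial>\<mu> \<partial>\<mu> \<partial>\<mu>)
    = (\<integral>\<^sup>+x. (\<integral>\<^sup>+y. ?W x y \<partial>\<mu>) * (\<integral>\<^sup>+z. \<integral>\<^sup>+w. ?W z w * near z w x \<partial>\<mu> \<partial>\<mu>) \<partial>\<mu>)"
    by (simp add: nn_integral_cmult nn_integral_multc)
  also have "\<dots> \<le> (\<integral>\<^sup>+x. ?B * (\<integral>\<^sup>+z. \<integral>\<^sup>+w. ?W z w * near z w x \<partial>\<mu> \<partial>\<mu>) \<partial>\<mu>)"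
    by (intro nn_integral_mono mult_right_mono nn_integral_W_bound n0 \<beta>) auto
  also have "\<dots> = ?B * (\<integral>\<^sup>+x. \<integral>\<^sup>+z. \<integral>\<^sup>+w. ?W z w * near z w x \<partial>\<mu> \<partial>\<mu> \<partial>\<mu>)"
    by (simp add: nn_integral_cmult)
  also have "(\<integral>\<^sup>+x. \<integral>\<^sup>+z. \<integral>\<^sup>+w. ?W z w * near z w x \<partial>\<mu> \<partial>\<mu> \<partial>\<mu>)
      = (\<integral>\<^sup>+z. \<integral>\<^sup>+x. \<integral>\<^sup>+w. ?W z w * near z w x \<partial>\<mu> \<partial>\<mu> \<partial>\<mu>)"
    by (rule pair_sigma_finite.Fubini'[OF psf]) measurable
  also have "\<dots> = (\<integral>\<^sup>+z. \<integral>\<^sup>+w. \<integral>\<^sup>+x. ?W z w * near z w x \<partial>\<mu> \<partial>\<mu> \<partial>\<mu>)"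
    by (intro nn_integral_cong pair_sigma_finite.Fubini'[OF psf]) measurable
  also have "?B * \<dots> \<le> ?B * ?C"
    unfolding near_def by (intro mult_left_mono nn_integral_W_near n0 \<beta>) auto
  finally show ?thesis .
qed

lemma nn_integral_PM_two_edges_bound:
  fixes \<beta> :: real and n m :: nat
  assumes ij: "i \<noteq> j" "i \<noteq> k" "i \<noteq> l" "j \<noteq> k" "j \<noteq> l" "k \<noteq> l"
    and n0: "n > 0" and \<beta>: "\<beta> \<ge> 0"
  defines "A \<equiv> \<lambda>x y. ennreal (dist x y powr \<beta> * (1 - p x y) ^ m)"
    and "W' \<equiv> \<lambda>x y. ennreal (W \<beta> (n / 4) x y)"
  shows "(\<integral>\<^sup>+e. A (e i) (e j) * A (e k) (e l)
        + (near (e i) (e j) (e k) + near (e k) (e l) (e i)) * (W' (e i) (e j) * W' (e k) (e l)) \<partial>PM {i, j, k, l})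
     \<le> (pair_moment \<beta> m)\<^sup>2 + 2 * (ennreal (W_bound \<beta> n) * ennreal (near_const * W_bound (\<beta> + DIM('a)) n))"
proof -
  let ?A = "\<lambda>x y. ennreal (dist x y powr \<beta> * (1 - p x y) ^ m)"
  let ?W = "\<lambda>x y. ennreal (W \<beta> (n / 4) x y)"
  let ?F = "\<lambda>x y z w. ?A x y * ?A z w + (?W x y * near x y z * ?W z w + ?W x y * (?W z w * near z w x))"
  have "A x y * A z w + (near x y z + near z w x) * (W' x y * W' z w) = ?F x y z w" for x y z w
    unfolding A_def W'_def by (simp add: distrib_right mult_ac)
  then have "(\<integral>\<^sup>+e. A (e i) (e j) * A (e k) (e l)
        + (near (e i) (e j) (e k) + near (e k) (e l) (e i)) * (W' (e i) (e j) * W' (e k) (e l)) \<partial>PM {i, j, k, l})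
     = (\<integral>\<^sup>+e. ?F (e i) (e j) (e k) (e l) \<partial>PM {i, j, k, l})"
    by (simp only:)
  also have "\<dots> = (\<integral>\<^sup>+x. \<integral>\<^sup>+y. \<integral>\<^sup>+z. \<integral>\<^sup>+w. ?F x y z w \<partial>\<mu> \<partial>\<mu> \<partial>\<mu> \<partial>\<mu>)"
  proof (rule nn_integral_PiM_4[OF prob_space_\<mu>, of ?F])
    show "(\<lambda>(x, y, z, w). ?F x y z w) \<in> borel_measurable (\<mu> \<Otimes>\<^sub>M \<mu> \<Otimes>\<^sub>M \<mu> \<Otimes>\<^sub>M \<mu>)"
      unfolding split_beta' by measurable
  qed (use ij in auto)
  also have "\<dots> = (\<integral>\<^sup>+x. \<integral>\<^sup>+y. \<integral>\<^sup>+z. \<integral>\<^sup>+w. ?A x y * ?A z w \<partial>\<mu> \<partial>\<mu> \<partial>\<mu> \<partial>\<mu>)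
      + ((\<integral>\<^sup>+x. \<integral>\<^sup>+y. \<integral>\<^sup>+z. \<integral>\<^sup>+w. ?W x y * near x y z * ?W z w \<partial>\<mu> \<partial>\<mu> \<partial>\<mu> \<partial>\<mu>)
      + (\<integral>\<^sup>+x. \<integral>\<^sup>+y. \<integral>\<^sup>+z. \<integral>\<^sup>+w. ?W x y * (?W z w * near z w x) \<partial>\<mu> \<partial>\<mu> \<partial>\<mu> \<partial>\<mu>))"
    by (simp add: nn_integral_add)
  also have "(\<integral>\<^sup>+x. \<integral>\<^sup>+y. \<integral>\<^sup>+z. \<integral>\<^sup>+w. ?A x y * ?A z w \<partial>\<mu> \<partial>\<mu> \<partial>\<mu> \<partial>\<mu>) = (pair_moment \<beta> m)\<^sup>2"
    by (simp add: pair_moment_def nn_integral_cmult nn_integral_multc power2_eq_square)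
  finally show ?thesis
    using add_left_mono[OF add_mono[OF nn_integral_near_first[OF n0 \<beta>] nn_integral_near_second[OF n0 \<beta>]],
        of "(pair_moment \<beta> m)\<^sup>2"]
    by (simp only: mult_2)
qed

text \<open>The first summand is the exact product of two one-edge moments and carries the limit;
  the second collects the intersecting balls. From n >= 8 on, the exponent n - 4 is at least
  n/2.\<close>

lemma nn_integral_g_disjoint:
  fixes \<beta> :: real
  assumes ij: "i < n" "j < n" "k < n" "l < n" "i \<noteq> j" "i \<noteq> k" "i \<noteq> l" "j \<noteq> k" "j \<noteq> l" "k \<noteq> l"
    and n: "8 \<le> n" and \<beta>: "\<beta> \<ge> 0"
  shows "(\<integral>\<^sup>+\<omega>. ennreal (g n \<beta> i j \<omega>) * ennreal (g n \<beta> k l \<omega>) \<partial>PM {..<n})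
    \<le> (pair_moment \<beta> (n - 4))\<^sup>2 + 2 * ennreal (W_bound \<beta> n * (near_const * W_bound (\<beta> + DIM('a)) n))"
proof -
  let ?E = "{i, j, k, l}"
  let ?W = "\<lambda>x y. ennreal (W \<beta> (n / 4) x y)"
  let ?A = "\<lambda>x y. ennreal (dist x y powr \<beta> * (1 - p x y) ^ (n - 4))"
  let ?F = "\<lambda>x y z w. ?A x y * ?A z w + (near x y z + near z w x) * (?W x y * ?W z w)"
  have card: "card ?E = 4" using ij by simp
  have m: "real n / 2 \<le> real (n - 4)" using n by (simp add: of_nat_diff)
  have "(\<integral>\<^sup>+\<omega>. ennreal (g n \<beta> i j \<omega>) * ennreal (g n \<beta> k l \<omega>) \<partial>PM {..<n})
     \<le> (\<integral>\<^sup>+e. ennreal (dist (e i) (e j) powr \<beta> * dist (e k) (e l) powr \<beta>) *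
          ennreal ((1 - measure \<mu> (gball (e i) (e j) \<union> gball (e k) (e l))) ^ (n - card ?E)) \<partial>PM ?E)"
    by (rule nn_integral_g_two_edges) (use ij in auto)
  also have "\<dots> \<le> (\<integral>\<^sup>+e. ?F (e i) (e j) (e k) (e l) \<partial>PM ?E)"
  proof (rule nn_integral_mono_AE)
    have "AE e in PM ?E. e i \<in> K" "AE e in PM ?E. e j \<in> K" "AE e in PM ?E. e k \<in> K" "AE e in PM ?E. e l \<in> K"
      by (auto intro!: AE_PM_K)
    then show "AE e in PM ?E. ennreal (dist (e i) (e j) powr \<beta> * dist (e k) (e l) powr \<beta>) *
          ennreal ((1 - measure \<mu> (gball (e i) (e j) \<union> gball (e k) (e l))) ^ (n - card ?E))
        \<le> ?F (e i) (e j) (e k) (e l)"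
      unfolding card near_def by eventually_elim (rule two_edges_le[OF _ _ _ _ m])
  qed
  also have "\<dots> \<le> (pair_moment \<beta> (n - 4))\<^sup>2 + 2 * (ennreal (W_bound \<beta> n) * ennreal (near_const * W_bound (\<beta> + DIM('a)) n))"
    by (rule nn_integral_PM_two_edges_bound) (use ij n \<beta> in auto)
  also have "ennreal (W_bound \<beta> n) * ennreal (near_const * W_bound (\<beta> + DIM('a)) n)
      = ennreal (W_bound \<beta> n * (near_const * W_bound (\<beta> + DIM('a)) n))"
    using W_bound_nonneg[OF \<beta>] by (simp add: ennreal_mult')
  finally show ?thesis .
qed

end

section \<open>Moments of the total weight\<close>

lemma sum_if_fst_eq:
  "i < n \<Longrightarrow> (\<Sum>k<n. \<Sum>l<n. if k = i then T else 0) = of_nat n * (T :: ennreal)"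
  by (subst sum.swap) (simp add: sum.delta)

lemma sum_if_snd_eq:
  "i < n \<Longrightarrow> (\<Sum>k<n. \<Sum>l<n. if l = i then T else 0) = of_nat n * (T :: ennreal)"
  by (simp add: sum.delta)

lemma sum_if_both_eq:
  fixes n :: nat
  assumes "i < n" "j < n"
  shows "(\<Sum>k<n. \<Sum>l<n. if k = i \<and> l = j then T else 0) = (T :: ennreal)"
proof -
  have "(\<Sum>k<n. \<Sum>l<n. if k = i \<and> l = j then T else 0) = (\<Sum>k<n. if k = i then (\<Sum>l<n. if l = j then T else 0) else 0)"
    by (intro sum.cong) auto
  also have "\<dots> = T" using assms by (simp add: sum.delta)
  finally show ?thesis .
qed

lemma nn_integral_quadruple_sum:
  assumes m: "\<And>i j k l. i < n \<Longrightarrow> j < n \<Longrightarrow> k < n \<Longrightarrow> l < n \<Longrightarrow> F i j k l \<in> borel_measurable M"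
  shows "(\<integral>\<^sup>+e. (\<Sum>i<n. \<Sum>j<n. \<Sum>k<n. \<Sum>l<n. F i j k l e) \<partial>M)
    = (\<Sum>i<n. \<Sum>j<n. \<Sum>k<n. \<Sum>l<n. \<integral>\<^sup>+e. F i j k l e \<partial>M)"
proof -
  have 1: "(\<integral>\<^sup>+e. (\<Sum>l<n. F i j k l e) \<partial>M) = (\<Sum>l<n. \<integral>\<^sup>+e. F i j k l e \<partial>M)"
    if "i < n" "j < n" "k < n" for i j k
    using that m by (intro nn_integral_sum) auto
  have 2: "(\<integral>\<^sup>+e. (\<Sum>k<n. \<Sum>l<n. F i j k l e) \<partial>M) = (\<Sum>k<n. \<Sum>l<n. \<integral>\<^sup>+e. F i j k l e \<partial>M)"
    if "i < n" "j < n" for i j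
    using that m by (subst nn_integral_sum) (auto simp: 1 intro!: borel_measurable_sum)
  have 3: "(\<integral>\<^sup>+e. (\<Sum>j<n. \<Sum>k<n. \<Sum>l<n. F i j k l e) \<partial>M) = (\<Sum>j<n. \<Sum>k<n. \<Sum>l<n. \<integral>\<^sup>+e. F i j k l e \<partial>M)"
    if "i < n" for i
    using that m by (subst nn_integral_sum) (auto simp: 2 intro!: borel_measurable_sum)
  show ?thesis
    using m by (subst nn_integral_sum) (auto simp: 3 intro!: borel_measurable_sum)
qed

lemma summand_le_sum7:
  fixes a b c d e f g :: ennreal
  shows "a \<le> a + (b + (c + (d + (e + (f + g)))))" "b \<le> a + (b + (c + (d + (e + (f + g)))))"
    "c \<le> a + (b + (c + (d + (e + (f + g)))))" "d \<le> a + (b + (c + (d + (e + (f + g)))))"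
    "e \<le> a + (b + (c + (d + (e + (f + g)))))" "f \<le> a + (b + (c + (d + (e + (f + g)))))"
    "g \<le> a + (b + (c + (d + (e + (f + g)))))"
  by (rule add_increasing2[OF zero_le order_refl],
      rule add_increasing[OF zero_le add_increasing2[OF zero_le order_refl]],
      rule add_increasing[OF zero_le add_increasing[OF zero_le add_increasing2[OF zero_le order_refl]]],
      rule add_increasing[OF zero_le add_increasing[OF zero_le add_increasing[OF zero_le add_increasing2[OF zero_le order_refl]]]],
      rule add_increasing[OF zero_le add_increasing[OF zero_le add_increasing[OF zero_le add_increasing[OF zero_le add_increasing2[OF zero_le order_refl]]]]],
      rule add_increasing[OF zero_le add_increasing[OF zero_le add_increasing[OF zero_le add_increasing[OF zero_le add_increasing[OF zero_le add_increasing2[OF zero_le order_refl]]]]]],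
      rule add_increasing[OF zero_le add_increasing[OF zero_le add_increasing[OF zero_le add_increasing[OF zero_le add_increasing[OF zero_le add_increasing[OF zero_le order_refl]]]]]])

context convex_density
begin

text \<open>The weight transferred to the product space; it equals \<open>gabriel_weight\<close>
  when the points are distinct, so all moments are computed under \<open>PM {..<n}\<close>.\<close>

definition G :: "real \<Rightarrow> nat \<Rightarrow> (nat \<Rightarrow> 'a) \<Rightarrow> real" where
  "G \<beta> n e = (\<Sum>i<n. \<Sum>j<n. if i \<noteq> j then g n \<beta> i j e else 0) / 2"

lemma G_nonneg: "0 \<le> G \<beta> n e"
  unfolding G_def by (intro divide_nonneg_nonneg sum_nonneg) (auto simp: g_nonneg)

lemma G_measurable[measurable]: "G \<beta> n \<in> borel_measurable (PM {..<n})"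
  unfolding G_def by (intro borel_measurable_divide borel_measurable_sum) (auto simp: g_measurable)

lemma pair_measurable:
  "i < n \<Longrightarrow> j < n \<Longrightarrow> (\<lambda>e. ennreal (if i \<noteq> j then g n \<beta> i j e else 0)) \<in> borel_measurable (PM {..<n})"
  by (cases "i = j") (auto simp: g_measurable)

lemma ennreal_2_G: "2 * ennreal (G \<beta> n e) = (\<Sum>i<n. \<Sum>j<n. ennreal (if i \<noteq> j then g n \<beta> i j e else 0))"
proof -
  have "2 * ennreal (G \<beta> n e) = ennreal (2 * G \<beta> n e)"
    using G_nonneg by (simp add: ennreal_mult)
  also have "2 * G \<beta> n e = (\<Sum>i<n. \<Sum>j<n. if i \<noteq> j then g n \<beta> i j e else 0)"
    by (simp add: G_def)
  also have "ennreal \<dots> = (\<Sum>i<n. \<Sum>j<n. ennreal (if i \<noteq> j then g n \<beta> i j e else 0))"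
    by (simp add: sum_ennreal sum_nonneg g_nonneg)
  finally show ?thesis .
qed

lemma first_moment:
  "2 * (\<integral>\<^sup>+e. ennreal (G \<beta> n e) \<partial>PM {..<n}) = ennreal (real n * (real n - 1)) * pair_moment \<beta> (n - 2)"
proof -
  have "2 * (\<integral>\<^sup>+e. ennreal (G \<beta> n e) \<partial>PM {..<n}) = (\<integral>\<^sup>+e. 2 * ennreal (G \<beta> n e) \<partial>PM {..<n})"
    by (rule nn_integral_cmult[symmetric]) measurable
  also have "\<dots> = (\<Sum>i<n. \<Sum>j<n. \<integral>\<^sup>+e. ennreal (if i \<noteq> j then g n \<beta> i j e else 0) \<partial>PM {..<n})"
    unfolding ennreal_2_G
    by (subst nn_integral_sum) (auto intro!: sum.cong nn_integral_sum borel_measurable_sum pair_measurable)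
  also have "\<dots> = (\<Sum>i<n. \<Sum>j<n. if j = i then 0 else pair_moment \<beta> (n - 2))"
    by (intro sum.cong) (auto simp: nn_integral_g)
  also have "\<dots> = (\<Sum>i<n. of_nat (n - 1) * pair_moment \<beta> (n - 2))"
  proof (intro sum.cong refl)
    fix i assume i: "i \<in> {..<n}"
    have "(\<Sum>j<n. if j = i then 0 else pair_moment \<beta> (n - 2)) = (\<Sum>j\<in>{..<n} - {i}. pair_moment \<beta> (n - 2))"
      by (intro sum.mono_neutral_cong_right) auto
    then show "(\<Sum>j<n. if j = i then 0 else pair_moment \<beta> (n - 2)) = of_nat (n - 1) * pair_moment \<beta> (n - 2)"
      using i by (simp add: card_Diff_singleton)
  qed
  also have "\<dots> = (of_nat n * of_nat (n - 1)) * pair_moment \<beta> (n - 2)"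
    by (simp add: mult.assoc)
  also have "of_nat n * of_nat (n - 1) = ennreal (real n * (real n - 1))"
    by (cases n) (auto simp: ennreal_of_nat_eq_real_of_nat ennreal_mult')
  finally show ?thesis .
qed

definition disjoint_edges_bound :: "real \<Rightarrow> nat \<Rightarrow> ennreal" where
  "disjoint_edges_bound \<beta> n = (pair_moment \<beta> (n - 4))\<^sup>2 + 2 * ennreal (W_bound \<beta> n * (near_const * W_bound (\<beta> + DIM('a)) n))"
definition shared_vertex_bound :: "real \<Rightarrow> nat \<Rightarrow> ennreal" where
  "shared_vertex_bound \<beta> n = ennreal ((W_bound \<beta> n)\<^sup>2)"
definition same_edge_bound :: "real \<Rightarrow> nat \<Rightarrow> ennreal" where
  "same_edge_bound \<beta> n = pair_moment (2 * \<beta>) (n - 2)"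

text \<open>All patterns in which two ordered pairs can overlap are added up, whether or not they
  exclude each other. The overcounting only affects lower order terms and makes the right side easy
  to sum over all indices.\<close>

lemma nn_integral_pair_product_le:
  assumes n: "8 \<le> n" and \<beta>: "\<beta> \<ge> 0" and ij: "i < n" "j < n" "k < n" "l < n"
  shows "(\<integral>\<^sup>+e. ennreal (if i \<noteq> j then g n \<beta> i j e else 0) * ennreal (if k \<noteq> l then g n \<beta> k l e else 0) \<partial>PM {..<n})
    \<le> disjoint_edges_bound \<beta> n + ((if k = i then shared_vertex_bound \<beta> n else 0) + ((if k = j then shared_vertex_bound \<beta> n else 0)
      + ((if l = i then shared_vertex_bound \<beta> n else 0) + ((if l = j then shared_vertex_bound \<beta> n else 0)
      + ((if k = i \<and> l = j then same_edge_bound \<beta> n else 0) + (if k = j \<and> l = i then same_edge_bound \<beta> n else 0))))))"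
    (is "?I \<le> ?R")
proof (cases "i \<noteq> j \<and> k \<noteq> l")
  case False
  then have "?I = 0" by auto
  then show ?thesis by (simp only: zero_le)
next
  case True
  have n6: "6 \<le> n" using n by simp
  have I: "?I = (\<integral>\<^sup>+e. ennreal (g n \<beta> i j e) * ennreal (g n \<beta> k l e) \<partial>PM {..<n})"
    using True by simp
  have sq: "(\<integral>\<^sup>+e. ennreal (g n \<beta> i j e) * ennreal (g n \<beta> i j e) \<partial>PM {..<n}) = same_edge_bound \<beta> n" if "i < n" "j < n" "i \<noteq> j" for i j

  proof -
    have "ennreal (g n \<beta> i j e) * ennreal (g n \<beta> i j e) = ennreal (g n (2 * \<beta>) i j e)" for e
      using g_nonneg by (simp add: g_square[symmetric] power2_eq_square flip: ennreal_mult)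
    then show ?thesis using nn_integral_g[OF that] by (simp add: same_edge_bound_def)
  qed
  note shared = nn_integral_g_shared[OF _ _ _ _ _ _ n6 \<beta>, folded shared_vertex_bound_def]
  consider "k = i \<and> l = j" | "k = j \<and> l = i" | "k = i \<and> l \<noteq> j" | "k = j \<and> l \<noteq> i" | "l = i \<and> k \<noteq> j" | "l = j \<and> k \<noteq> i"
    | "k \<noteq> i \<and> k \<noteq> j \<and> l \<noteq> i \<and> l \<noteq> j" by argo
  then show ?thesis
  proof cases
    case 1
    then have "?I = same_edge_bound \<beta> n" unfolding I using sq[OF ij(1,2)] True by simp
    then have "?I \<le> (if k = i \<and> l = j then same_edge_bound \<beta> n else 0)" using 1 by simp
    then show ?thesis by (rule order_trans[OF _ summand_le_sum7(6)])
  next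
    case 2
    then have "?I = same_edge_bound \<beta> n" unfolding I using sq[OF ij(1,2)] True by (simp add: g_commute[of n \<beta> j i])
    then have "?I \<le> (if k = j \<and> l = i then same_edge_bound \<beta> n else 0)" using 2 by simp
    then show ?thesis by (rule order_trans[OF _ summand_le_sum7(7)])
  next
    case 3
    then have "(\<integral>\<^sup>+e. ennreal (g n \<beta> i j e) * ennreal (g n \<beta> i l e) \<partial>PM {..<n}) \<le> shared_vertex_bound \<beta> n"
      using True ij by (intro shared) auto
    then have "?I \<le> shared_vertex_bound \<beta> n" unfolding I using 3 by simp
    then have "?I \<le> (if k = i then shared_vertex_bound \<beta> n else 0)" using 3 by simp
    then show ?thesis by (rule order_trans[OF _ summand_le_sum7(2)])
  next
    case 4
    then have "(\<integral>\<^sup>+e. ennreal (g n \<beta> j i e) * ennreal (g n \<beta> j l e) \<partial>PM {..<n}) \<le> shared_vertex_bound \<beta> n"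
      using True ij by (intro shared) auto
    then have "?I \<le> shared_vertex_bound \<beta> n" unfolding I using 4 by (simp add: g_commute[of n \<beta> i j])
    then have "?I \<le> (if k = j then shared_vertex_bound \<beta> n else 0)" using 4 by simp
    then show ?thesis by (rule order_trans[OF _ summand_le_sum7(3)])
  next
    case 5
    then have "(\<integral>\<^sup>+e. ennreal (g n \<beta> i j e) * ennreal (g n \<beta> i k e) \<partial>PM {..<n}) \<le> shared_vertex_bound \<beta> n"
      using True ij by (intro shared) auto
    then have "?I \<le> shared_vertex_bound \<beta> n" unfolding I using 5 by (simp add: g_commute[of n \<beta> k i])
    then have "?I \<le> (if l = i then shared_vertex_bound \<beta> n else 0)" using 5 by simp
    then show ?thesis by (rule order_trans[OF _ summand_le_sum7(4)])
  next
    case 6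
    then have "(\<integral>\<^sup>+e. ennreal (g n \<beta> j i e) * ennreal (g n \<beta> j k e) \<partial>PM {..<n}) \<le> shared_vertex_bound \<beta> n"
      using True ij by (intro shared) auto
    then have "?I \<le> shared_vertex_bound \<beta> n" unfolding I using 6 by (simp add: g_commute[of n \<beta> i j] g_commute[of n \<beta> k j])
    then have "?I \<le> (if l = j then shared_vertex_bound \<beta> n else 0)" using 6 by simp
    then show ?thesis by (rule order_trans[OF _ summand_le_sum7(5)])
  next
    case 7
    then have "?I \<le> disjoint_edges_bound \<beta> n" 
      unfolding I disjoint_edges_bound_def using True ij n \<beta> by (intro nn_integral_g_disjoint) auto
    then show ?thesis by (rule order_trans[OF _ summand_le_sum7(1)])
  qed
qed

text \<open>There are at most n^4 index quadruples, four ways to share one vertex with n^3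
  quadruples each, and two ways to repeat the edge with n^2 each. Bounding the number of disjoint
  pairs by n^4 leaves the leading coefficient sharp.\<close>

lemma second_moment_le:
  assumes n: "8 \<le> n" and \<beta>: "\<beta> \<ge> 0"
  shows "4 * (\<integral>\<^sup>+e. ennreal ((G \<beta> n e)\<^sup>2) \<partial>PM {..<n})
    \<le> of_nat n ^ 4 * disjoint_edges_bound \<beta> n + 4 * of_nat n ^ 3 * shared_vertex_bound \<beta> n + 2 * of_nat n ^ 2 * same_edge_bound \<beta> n"
proof -
  let ?a = "\<lambda>i j e. ennreal (if i \<noteq> j then g n \<beta> i j e else 0)"
  have "4 * (\<integral>\<^sup>+e. ennreal ((G \<beta> n e)\<^sup>2) \<partial>PM {..<n}) = (\<integral>\<^sup>+e. 4 * ennreal ((G \<beta> n e)\<^sup>2) \<partial>PM {..<n})"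
    by (rule nn_integral_cmult[symmetric]) measurable
  also have "\<dots> = (\<integral>\<^sup>+e. (\<Sum>i<n. \<Sum>j<n. \<Sum>k<n. \<Sum>l<n. ?a i j e * ?a k l e) \<partial>PM {..<n})"
  proof (rule nn_integral_cong)
    fix e
    have "4 * ennreal ((G \<beta> n e)\<^sup>2) = (2 * ennreal (G \<beta> n e)) * (2 * ennreal (G \<beta> n e))"

    proof -
      have "(2 * x) * (2 * x) = (2 * 2) * (x * x)" for x :: ennreal by (simp only: mult_ac)
      then show ?thesis using G_nonneg by (simp add: power2_eq_square ennreal_mult)
    qed
    also have "\<dots> = (\<Sum>i<n. \<Sum>j<n. \<Sum>k<n. \<Sum>l<n. ?a i j e * ?a k l e)"
      unfolding ennreal_2_G by (simp only: sum_distrib_right, simp only: sum_distrib_left)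
    finally show "4 * ennreal ((G \<beta> n e)\<^sup>2) = (\<Sum>i<n. \<Sum>j<n. \<Sum>k<n. \<Sum>l<n. ?a i j e * ?a k l e)" .
  qed
  also have "\<dots> = (\<Sum>i<n. \<Sum>j<n. \<Sum>k<n. \<Sum>l<n. \<integral>\<^sup>+e. ?a i j e * ?a k l e \<partial>PM {..<n})"
    by (rule nn_integral_quadruple_sum) (intro borel_measurable_times_ennreal pair_measurable; assumption)
  also have "\<dots> \<le> (\<Sum>i<n. \<Sum>j<n. \<Sum>k<n. \<Sum>l<n. 
      disjoint_edges_bound \<beta> n + ((if k = i then shared_vertex_bound \<beta> n else 0) + ((if k = j then shared_vertex_bound \<beta> n else 0)
      + ((if l = i then shared_vertex_bound \<beta> n else 0) + ((if l = j then shared_vertex_bound \<beta> n else 0)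
      + ((if k = i \<and> l = j then same_edge_bound \<beta> n else 0) + (if k = j \<and> l = i then same_edge_bound \<beta> n else 0)))))))"
    by (intro sum_mono nn_integral_pair_product_le n \<beta>) (simp_all only: lessThan_iff)
  also have "\<dots> = (\<Sum>i<n. \<Sum>j<n. of_nat n * (of_nat n * disjoint_edges_bound \<beta> n) + (of_nat n * shared_vertex_bound \<beta> n + (of_nat n * shared_vertex_bound \<beta> n
      + (of_nat n * shared_vertex_bound \<beta> n + (of_nat n * shared_vertex_bound \<beta> n + (same_edge_bound \<beta> n + same_edge_bound \<beta> n))))))"
  proof (intro sum.cong refl)
    fix i j assume "i \<in> {..<n}" "j \<in> {..<n}"
    then have ij: "i < n" "j < n" by auto
    show "(\<Sum>k<n. \<Sum>l<n. 
      disjoint_edges_bound \<beta> n + ((if k = i then shared_vertex_bound \<beta> n else 0) + ((if k = j then shared_vertex_bound \<beta> n else 0)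
      + ((if l = i then shared_vertex_bound \<beta> n else 0) + ((if l = j then shared_vertex_bound \<beta> n else 0)
      + ((if k = i \<and> l = j then same_edge_bound \<beta> n else 0) + (if k = j \<and> l = i then same_edge_bound \<beta> n else 0)))))))
     = of_nat n * (of_nat n * disjoint_edges_bound \<beta> n) + (of_nat n * shared_vertex_bound \<beta> n + (of_nat n * shared_vertex_bound \<beta> n
      + (of_nat n * shared_vertex_bound \<beta> n + (of_nat n * shared_vertex_bound \<beta> n + (same_edge_bound \<beta> n + same_edge_bound \<beta> n)))))"
      unfolding sum.distrib sum_if_fst_eq[OF ij(1)] sum_if_fst_eq[OF ij(2)] sum_if_snd_eq[OF ij(1)]
        sum_if_snd_eq[OF ij(2)] sum_if_both_eq[OF ij] sum_if_both_eq[OF ij(2,1)]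
      by (simp only: sum_constant card_lessThan)
  qed
  also have "\<dots> = of_nat n * (of_nat n * (of_nat n * (of_nat n * disjoint_edges_bound \<beta> n) + (of_nat n * shared_vertex_bound \<beta> n + (of_nat n * shared_vertex_bound \<beta> n
      + (of_nat n * shared_vertex_bound \<beta> n + (of_nat n * shared_vertex_bound \<beta> n + (same_edge_bound \<beta> n + same_edge_bound \<beta> n)))))))"
    by (simp only: sum_constant card_lessThan)
  also have "\<dots> = of_nat n ^ 4 * disjoint_edges_bound \<beta> n + 4 * of_nat n ^ 3 * shared_vertex_bound \<beta> n + 2 * of_nat n ^ 2 * same_edge_bound \<beta> n"
  proof -
    have *: "a * (a * (a * (a * x) + (a * y + (a * y + (a * y + (a * y + (z + z)))))))
      = a ^ 4 * x + 4 * a ^ 3 * y + 2 * a ^ 2 * z" for a x y z :: ennreal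
    proof -
      have "4 * a ^ 3 * y = a ^ 3 * y + (a ^ 3 * y + (a ^ 3 * y + a ^ 3 * y))"
        "2 * a ^ 2 * z = a ^ 2 * z + a ^ 2 * z"
        by (simp_all only: mult_2 numeral_Bit0 numeral_One distrib_right mult_1_left add.assoc)
      then show ?thesis
        by (simp add: distrib_left power4_eq_xxxx power3_eq_cube power2_eq_square mult.assoc add.assoc)
    qed
    show ?thesis by (rule *)
  qed
  finally show ?thesis .
qed

section \<open>Limits of the normalised moments\<close>

text \<open>The limit for ordered pairs, twice the one for edges.\<close>

definition lim_const :: "real \<Rightarrow> real" where
  "lim_const \<beta> = ubv TYPE('a) powr (- \<beta> / DIM('a)) * 2 powr (real DIM('a) + \<beta>) * Gamma (1 + \<beta> / DIM('a))
         * (LINT x:K|lborel. f x powr ((real DIM('a) - \<beta>) / DIM('a)))"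

lemma lim_const_nonneg:
  fixes \<beta> :: real
  assumes "\<beta> \<ge> 0"
  shows "0 \<le> lim_const \<beta>"
  unfolding lim_const_def set_lebesgue_integral_def using assms
  by (intro mult_nonneg_nonneg Gamma_real_nonneg add_pos_nonneg Bochner_Integration.integral_nonneg) auto

definition nscale :: "real \<Rightarrow> nat \<Rightarrow> real" where
  "nscale \<beta> n = real n powr ((\<beta> - real DIM('a)) / DIM('a))"

lemma nscale_alt: fixes \<beta> :: real shows "nscale \<beta> n = real n powr (\<beta> / DIM('a) - 1)"
  by (simp add: nscale_def diff_divide_distrib)

lemma first_moment_tendsto:
  fixes \<beta> :: real
  assumes \<beta>: "\<beta> \<ge> 0"
  shows "(\<lambda>n. \<integral>\<^sup>+e. ennreal (nscale \<beta> n * G \<beta> n e) \<partial>PM {..<n}) \<longlonglongrightarrow> ennreal (lim_const \<beta> / 2)"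
proof -
  let ?A = "\<lambda>n. ennreal (real n powr (1 + \<beta> / DIM('a))) * pair_moment \<beta> (n - 2)"
  have eq: "(\<integral>\<^sup>+e. ennreal (nscale \<beta> n * G \<beta> n e) \<partial>PM {..<n}) = ennreal ((1 - 1 / n) / 2) * ?A n" if n: "n > 0" for n
  proof -
    have "(\<integral>\<^sup>+e. ennreal (nscale \<beta> n * G \<beta> n e) \<partial>PM {..<n}) = (\<integral>\<^sup>+e. ennreal (nscale \<beta> n) * ennreal (G \<beta> n e) \<partial>PM {..<n})"
      using G_nonneg by (intro nn_integral_cong) (simp add: ennreal_mult nscale_def)
    also have "\<dots> = ennreal (nscale \<beta> n) * (\<integral>\<^sup>+e. ennreal (G \<beta> n e) \<partial>PM {..<n})"
      by (rule nn_integral_cmult) measurable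
    also have "\<dots> = ennreal (nscale \<beta> n / 2) * (2 * (\<integral>\<^sup>+e. ennreal (G \<beta> n e) \<partial>PM {..<n}))"
    proof -
      have "ennreal (nscale \<beta> n) = ennreal (nscale \<beta> n / 2) * 2"
        using ennreal_mult'[of 2 "nscale \<beta> n / 2"] by (simp add: nscale_def mult.commute)
      then show ?thesis by (simp add: mult.assoc)
    qed
    also have "\<dots> = ennreal (nscale \<beta> n / 2 * (real n * (real n - 1))) * pair_moment \<beta> (n - 2)"
      unfolding first_moment by (subst ennreal_mult') (auto simp: nscale_def mult.assoc)
    \<comment> \<open>There are n(n-1) ordered pairs, whereas the one-edge moment is normalised for
      n^2 of them; the quotient 1 - 1/n disappears in the limit.\<close>
    also have "nscale \<beta> n / 2 * (real n * (real n - 1)) = (1 - 1 / n) / 2 * real n powr (1 + \<beta> / DIM('a))"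
    proof -
      have "real n powr (1 + \<beta> / DIM('a)) = nscale \<beta> n * real n * real n"
        using n by (simp add: nscale_alt powr_add powr_diff)
      then show ?thesis using n by (simp add: field_simps)
    qed
    also have "ennreal \<dots> = ennreal ((1 - 1 / n) / 2) * ennreal (real n powr (1 + \<beta> / DIM('a)))"
      by (rule ennreal_mult'') simp
    finally show ?thesis by (simp add: mult.assoc)
  qed
  have "(\<lambda>n. ennreal ((1 - 1 / real n) / 2) * ?A n) \<longlonglongrightarrow> ennreal ((1 - 0) / 2) * ennreal (lim_const \<beta>)"
    unfolding lim_const_def
    by (intro tendsto_mult_ennreal pair_moment_tendsto \<beta> tendsto_ennrealI tendsto_intros lim_const_over_n) auto
  also have "ennreal ((1 - 0) / 2) * ennreal (lim_const \<beta>) = ennreal (lim_const \<beta> / 2)"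
    using ennreal_mult'[of "1/2" "lim_const \<beta>"] by simp
  finally show ?thesis
    by (rule Lim_transform_eventually) (use eq in \<open>auto simp: eventually_sequentially intro!: exI[of _ 1]\<close>)
qed

lemma W_bound_eq:
  fixes \<beta> :: real
  assumes "n > 0"
  shows "W_bound \<beta> n = W_const \<beta> * 4 powr (1 + \<beta> / DIM('a)) * real n powr (- 1 - \<beta> / DIM('a))"
proof -
  have "(real n / 4) powr (- t) = real n powr (- t) * 4 powr t" for t
    by (simp add: powr_divide powr_minus_divide)
  from this[of "1 + \<beta> / DIM('a)"]
  have "(real n / 4) powr (- 1 - \<beta> / DIM('a)) = real n powr (- 1 - \<beta> / DIM('a)) * 4 powr (1 + \<beta> / DIM('a))"
    by simp
  then show ?thesis by (simp add: W_bound_def mult_ac)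
qed

text \<open>The squared scale is n^(2\<beta>/d-2). Times n^4 it is exactly the square of the
  normalisation of \<open>pair_moment\<close>, so the leading term converges to the squared limit.
  In each of the other terms the powers of n leave a factor 1/n.\<close>

lemma second_moment_tendsto:
  fixes \<beta> :: real
  assumes \<beta>: "\<beta> \<ge> 0"
  obtains R where "R \<longlonglongrightarrow> ennreal ((lim_const \<beta> / 2)\<^sup>2)"
    "\<And>n. 8 \<le> n \<Longrightarrow> (\<integral>\<^sup>+e. ennreal ((nscale \<beta> n * G \<beta> n e)\<^sup>2) \<partial>PM {..<n}) \<le> R n"
proof -
  let ?d = "DIM('a)"
  define A where "A = (\<lambda>n. ennreal (real n powr (1 + \<beta> / ?d)) * pair_moment \<beta> (n - 4))"
  define A' where "A' = (\<lambda>n. ennreal (real n powr (1 + (2 * \<beta>) / ?d)) * pair_moment (2 * \<beta>) (n - 2))"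
  define C where "C = (\<lambda>\<beta>. W_const \<beta> * 4 powr (1 + \<beta> / ?d))"
  define D4 where "D4 = C \<beta> * (near_const * C (\<beta> + ?d))"
  define D3 where "D3 = (C \<beta>)\<^sup>2"
  \<comment> \<open>\<open>A n * A n\<close> comes from disjoint edges, \<open>D4\<close> from
    intersecting balls, \<open>D3\<close> from a shared vertex and \<open>A'\<close> from a repeated
    edge; 1/4 is the square of the half in \<open>G\<close>.\<close>
  define R where "R = (\<lambda>n. ennreal (1 / 4) * (A n * A n + 2 * ennreal (D4 / n) + 4 * ennreal (D3 / n) + 2 * (ennreal (1 / n) * A' n)))"
  have C: "0 \<le> C \<beta>" if "\<beta> \<ge> 0" for \<beta> unfolding C_def using W_const_nonneg[OF that] by simp
  have D4: "0 \<le> D4" unfolding D4_def using C[OF \<beta>] C[of "\<beta> + ?d"] near_const_nonneg \<beta> by simp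
  have R_lim: "R \<longlonglongrightarrow> ennreal ((lim_const \<beta> / 2)\<^sup>2)"
  proof -
    have A: "A \<longlonglongrightarrow> ennreal (lim_const \<beta>)"
      unfolding A_def lim_const_def by (rule pair_moment_tendsto[OF \<beta>])
    have A': "A' \<longlonglongrightarrow> ennreal (lim_const (2 * \<beta>))"
      unfolding A'_def lim_const_def by (rule pair_moment_tendsto) (use \<beta> in simp)
    have c: "(\<lambda>n. ennreal (c / real n)) \<longlonglongrightarrow> ennreal 0" for c
      by (intro tendsto_ennrealI lim_const_over_n)
    have "R \<longlonglongrightarrow> ennreal (1 / 4) * (ennreal (lim_const \<beta>) * ennreal (lim_const \<beta>) + 2 * ennreal 0 + 4 * ennreal 0
        + 2 * (ennreal 0 * ennreal (lim_const (2 * \<beta>))))"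
      unfolding R_def
      by (intro tendsto_mult_ennreal tendsto_add tendsto_const A A' c) auto
    also have "ennreal (1 / 4) * (ennreal (lim_const \<beta>) * ennreal (lim_const \<beta>) + 2 * ennreal 0 + 4 * ennreal 0
        + 2 * (ennreal 0 * ennreal (lim_const (2 * \<beta>)))) = ennreal ((lim_const \<beta> / 2)\<^sup>2)"
      using lim_const_nonneg[OF \<beta>] by (simp add: power2_eq_square flip: ennreal_mult)
    finally show ?thesis .
  qed
  have "(\<integral>\<^sup>+e. ennreal ((nscale \<beta> n * G \<beta> n e)\<^sup>2) \<partial>PM {..<n}) \<le> R n" if n: "8 \<le> n" for n
  proof -
    define s where "s = (nscale \<beta> n)\<^sup>2"
    have n0: "real n > 0" using n by simp
    have s0: "0 \<le> s" by (simp add: s_def)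
    have n1: "n > 0" using n by simp
    have p4: "real n ^ 4 = real n powr 4" and p3: "real n ^ 3 = real n powr 3" and p2: "real n ^ 2 = real n powr 2"
      using n0 by (simp_all add: powr_numeral)
    have sn: "ennreal s * of_nat n ^ k = ennreal (s * real n ^ k)" for k
      using s0 by (simp add: ennreal_of_nat_eq_real_of_nat ennreal_power ennreal_mult)
    have s_eq: "s = real n powr (2 * \<beta> / ?d - 2)"

    proof -
      have "2 * \<beta> / ?d - 2 = (\<beta> / ?d - 1) + (\<beta> / ?d - 1)" by simp
      then show ?thesis unfolding s_def nscale_alt power2_eq_square powr_add[symmetric] by (rule arg_cong[OF sym])
    qed
    have "(\<integral>\<^sup>+e. ennreal ((nscale \<beta> n * G \<beta> n e)\<^sup>2) \<partial>PM {..<n}) = (\<integral>\<^sup>+e. ennreal s * ennreal ((G \<beta> n e)\<^sup>2) \<partial>PM {..<n})"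
      by (intro nn_integral_cong) (simp add: s_def power_mult_distrib ennreal_mult)
    also have "\<dots> = ennreal s * (\<integral>\<^sup>+e. ennreal ((G \<beta> n e)\<^sup>2) \<partial>PM {..<n})"
      by (rule nn_integral_cmult) measurable
    also have "\<dots> = ennreal (1 / 4) * (ennreal s * (4 * (\<integral>\<^sup>+e. ennreal ((G \<beta> n e)\<^sup>2) \<partial>PM {..<n})))"
    proof -
      have "ennreal (1 / 4) * 4 = ennreal (1 / 4 * 4)" by (subst ennreal_mult) auto
      then have q: "ennreal (1 / 4) * 4 = 1" by simp
      have "ennreal (1 / 4) * (ennreal s * (4 * x)) = (ennreal (1 / 4) * 4) * (ennreal s * x)" for x
        by (simp only: mult_ac)
      then show ?thesis unfolding q by (simp only: mult_1_left)
    qed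
    also have "\<dots> \<le> ennreal (1 / 4) * (ennreal s * (of_nat n ^ 4 * disjoint_edges_bound \<beta> n + 4 * of_nat n ^ 3 * shared_vertex_bound \<beta> n + 2 * of_nat n ^ 2 * same_edge_bound \<beta> n))"
      by (intro mult_left_mono second_moment_le n \<beta>) auto
    also have "ennreal s * (of_nat n ^ 4 * disjoint_edges_bound \<beta> n + 4 * of_nat n ^ 3 * shared_vertex_bound \<beta> n + 2 * of_nat n ^ 2 * same_edge_bound \<beta> n)
      = ennreal s * of_nat n ^ 4 * (pair_moment \<beta> (n - 4))\<^sup>2
        + 2 * (ennreal s * of_nat n ^ 4 * ennreal (W_bound \<beta> n * (near_const * W_bound (\<beta> + ?d) n)))
        + 4 * (ennreal s * of_nat n ^ 3 * ennreal ((W_bound \<beta> n)\<^sup>2))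
        + 2 * (ennreal s * of_nat n ^ 2 * pair_moment (2 * \<beta>) (n - 2))"
      unfolding disjoint_edges_bound_def shared_vertex_bound_def same_edge_bound_def by (simp only: distrib_left mult_ac add_ac)
    also have "ennreal s * of_nat n ^ 4 * (pair_moment \<beta> (n - 4))\<^sup>2 = A n * A n"
    proof -
      have e: "2 * \<beta> / ?d - 2 + 4 = (1 + \<beta> / ?d) + (1 + \<beta> / ?d)" by simp
      have "s * real n ^ 4 = real n powr (1 + \<beta> / ?d) * real n powr (1 + \<beta> / ?d)"
        by (simp only: s_eq p4 powr_add[symmetric] e)
      then have "ennreal s * of_nat n ^ 4 = ennreal (real n powr (1 + \<beta> / ?d)) * ennreal (real n powr (1 + \<beta> / ?d))"
        by (simp only: sn ennreal_mult powr_ge_zero)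
      then show ?thesis unfolding A_def power2_eq_square by (simp only: mult_ac)
    qed
    also have "ennreal s * of_nat n ^ 4 * ennreal (W_bound \<beta> n * (near_const * W_bound (\<beta> + ?d) n)) = ennreal (D4 / n)"
    proof -
      have e: "(2 * \<beta> / ?d - 2) + 4 + ((- 1 - \<beta> / ?d) + (- 1 - (\<beta> + ?d) / ?d)) = - 1"
        by (simp add: add_divide_distrib)
      have E: "real n powr (2 * \<beta> / ?d - 2) * real n powr 4 * (real n powr (- 1 - \<beta> / ?d) * real n powr (- 1 - (\<beta> + ?d) / ?d)) = 1 / n"
        unfolding powr_add[symmetric] e using n0 by (simp add: powr_minus_divide)
      have "s * real n ^ 4 * (W_bound \<beta> n * (near_const * W_bound (\<beta> + ?d) n)) = D4 * (1 / n)"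
        unfolding E[symmetric] s_eq p4 D4_def C_def W_bound_eq[OF n1] by (simp only: mult_ac)
      then show ?thesis
        unfolding sn using s0 by (subst ennreal_mult'[symmetric]) (simp_all only: mult_nonneg_nonneg zero_le_power of_nat_0_le_iff times_divide_eq_right mult_1_right)
    qed
    also have "ennreal s * of_nat n ^ 3 * ennreal ((W_bound \<beta> n)\<^sup>2) = ennreal (D3 / n)"
    proof -
      have e: "(2 * \<beta> / ?d - 2) + 3 + ((- 1 - \<beta> / ?d) + (- 1 - \<beta> / ?d)) = - 1" by simp
      have E: "real n powr (2 * \<beta> / ?d - 2) * real n powr 3 * (real n powr (- 1 - \<beta> / ?d) * real n powr (- 1 - \<beta> / ?d)) = 1 / n"
        unfolding powr_add[symmetric] e using n0 by (simp add: powr_minus_divide)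
      have "s * real n ^ 3 * (W_bound \<beta> n)\<^sup>2 = D3 * (1 / n)"
        unfolding E[symmetric] s_eq p3 D3_def C_def W_bound_eq[OF n1] power2_eq_square by (simp only: mult_ac)
      then show ?thesis
        unfolding sn using s0 by (subst ennreal_mult'[symmetric]) (simp_all only: mult_nonneg_nonneg zero_le_power of_nat_0_le_iff times_divide_eq_right mult_1_right)
    qed
    also have "ennreal s * of_nat n ^ 2 * pair_moment (2 * \<beta>) (n - 2) = ennreal (1 / n) * A' n"
    proof -
      have e: "(2 * \<beta> / ?d - 2) + 2 = - 1 + (1 + (2 * \<beta>) / ?d)" by simp
      have "s * real n ^ 2 = real n powr (- 1) * real n powr (1 + (2 * \<beta>) / ?d)"
        by (simp only: s_eq p2 powr_add[symmetric] e)
      also have "real n powr (- 1) = 1 / n" using n0 by (simp add: powr_minus_divide)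
      finally have "ennreal s * of_nat n ^ 2 = ennreal (1 / n) * ennreal (real n powr (1 + (2 * \<beta>) / ?d))"
        by (simp only: sn ennreal_mult'' powr_ge_zero)
      then show ?thesis unfolding A'_def by (simp only: mult.assoc)
    qed
    finally show ?thesis by (simp add: R_def)
  qed
  with R_lim that show thesis by blast
qed

end

section \<open>Independent samples\<close>

locale gabriel_sample = convex_density f K c1 c2 + S: prob_space M
  for f :: "'a::euclidean_space \<Rightarrow> real" and K c1 c2 and M :: "'m measure" +
  fixes X :: "nat \<Rightarrow> 'm \<Rightarrow> 'a" and \<alpha> :: real
  assumes X_measurable[measurable]: "\<And>i. X i \<in> borel_measurable M"
    and X_distr: "\<And>i. distr M borel (X i) = \<mu>"
    and X_indep: "S.indep_vars (\<lambda>_. borel) X UNIV"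
    and \<alpha>: "\<alpha> \<ge> 0"
begin

lemma distr_sample:
  assumes "I \<noteq> {}"
  shows "distr M (Pi\<^sub>M I (\<lambda>_. borel)) (\<lambda>\<omega>. \<lambda>i\<in>I. X i \<omega>) = PM I"
proof -
  have "S.indep_vars (\<lambda>_. borel) X I"
    by (rule S.indep_vars_subset[OF X_indep]) simp
  then have "distr M (Pi\<^sub>M I (\<lambda>_. borel)) (\<lambda>\<omega>. \<lambda>i\<in>I. X i \<omega>) = (\<Pi>\<^sub>M i\<in>I. distr M borel (X i))"
    using S.indep_vars_iff_distr_eq_PiM[where I=I and X=X and M'="\<lambda>_. borel"] assms X_measurable by simp
  then show ?thesis by (simp add: X_distr)
qed

lemma nn_integral_sample:
  assumes "I \<noteq> {}" and F: "F \<in> borel_measurable (PM I)"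
  shows "(\<integral>\<^sup>+\<omega>. F (\<lambda>i\<in>I. X i \<omega>) \<partial>M) = (\<integral>\<^sup>+e. F e \<partial>PM I)"
proof -
  have "sets (PM I) = sets (Pi\<^sub>M I (\<lambda>_. borel))" by (intro sets_PiM_cong) auto
  then have F': "F \<in> borel_measurable (Pi\<^sub>M I (\<lambda>_. borel))"
    using F by (simp cong: measurable_cong_sets)
  have "(\<lambda>\<omega>. \<lambda>i\<in>I. X i \<omega>) \<in> measurable M (Pi\<^sub>M I (\<lambda>_. borel))"
    by (rule measurable_restrict) (rule X_measurable)
  then show ?thesis
    unfolding distr_sample[OF assms(1), symmetric] using F' by (subst nn_integral_distr) auto
qed

text \<open>A measure with a Lebesgue density has no atoms. Coincidence is written as
  \<open>dist x y = 0\<close>, a form for which measurability in both arguments follows from that of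
  the distance.\<close>

lemma nn_integral_\<mu>_singleton: "(\<integral>\<^sup>+y. (if dist x y = 0 then 1 else 0) \<partial>\<mu>) = 0"
proof -
  have "(\<integral>\<^sup>+y. (if dist x y = 0 then 1 else 0) \<partial>\<mu>) = (\<integral>\<^sup>+y. ennreal (f y) * (if dist x y = 0 then 1 else 0) \<partial>lborel)"
    by (rule nn_integral_\<mu>) measurable
  also have "\<dots> = 0"
  proof (subst nn_integral_0_iff_AE)
    have "AE y in lborel. y \<noteq> x" by (rule AE_lborel_singleton)
    then show "AE y in lborel. ennreal (f y) * (if dist x y = 0 then 1 else 0) = 0"
      by eventually_elim auto
  qed measurable
  finally show ?thesis .
qed

lemma AE_X_distinct:
  assumes "i \<noteq> j"
  shows "AE \<omega> in M. X i \<omega> \<noteq> X j \<omega>"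
proof -
  let ?F = "\<lambda>e. if dist (e i) (e j) = 0 then 1 else 0 :: ennreal"
  have m: "?F \<in> borel_measurable (PM {i, j})"
  proof -
    have [measurable]: "(\<lambda>e. e i) \<in> borel_measurable (PM {i, j})" "(\<lambda>e. e j) \<in> borel_measurable (PM {i, j})"
      by (auto intro: component_measurable)
    show ?thesis by measurable
  qed
  have "(\<integral>\<^sup>+\<omega>. ?F (\<lambda>k\<in>{i, j}. X k \<omega>) \<partial>M) = (\<integral>\<^sup>+e. ?F e \<partial>PM {i, j})"
    by (rule nn_integral_sample[OF _ m]) simp
  also have "\<dots> = (\<integral>\<^sup>+x. \<integral>\<^sup>+y. (if dist x y = 0 then 1 else 0) \<partial>\<mu> \<partial>\<mu>)"
    using nn_integral_PiM_2[OF prob_space_\<mu>, of "\<lambda>x y. if dist x y = 0 then 1 else 0" i j] assms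
    by (simp add: split_beta')
  also have "\<dots> = 0" by (simp only: nn_integral_\<mu>_singleton nn_integral_const mult_zero_left)
  finally have "(\<integral>\<^sup>+\<omega>. (if dist (X i \<omega>) (X j \<omega>) = 0 then 1 else 0) \<partial>M) = 0" by simp
  then have "AE \<omega> in M. (if dist (X i \<omega>) (X j \<omega>) = 0 then 1 else 0 :: ennreal) = 0"
    by (subst (asm) nn_integral_0_iff_AE) measurable
  then show ?thesis by eventually_elim (auto split: if_splits)
qed

lemma AE_X_K: "AE \<omega> in M. X i \<omega> \<in> K"
proof -
  have "AE x in distr M borel (X i). x \<in> K" unfolding X_distr by (rule AE_\<mu>_K)
  then show ?thesis by (subst (asm) AE_distr_iff) auto
qed

definition Y :: "nat \<Rightarrow> 'm \<Rightarrow> real" where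
  "Y n \<omega> = nscale \<alpha> n * gabriel_weight \<alpha> ((\<lambda>i. X i \<omega>) ` {0..<n})"

text \<open>The convergence statement asks for measurability of the weight itself, and almost sure
  equality with the formula for distinct points does not give it for an arbitrary probability space.
  So the formula valid for repeated points is used, with coincidences expressed by
  distances.\<close>

lemma Y_measurable[measurable]: "Y n \<in> borel_measurable M"
proof -
  have eq: "gabriel_adj ((\<lambda>i. X i \<omega>) ` {0..<n}) (X i \<omega>) (X j \<omega>) \<longleftrightarrow>
      dist (X i \<omega>) (X j \<omega>) \<noteq> 0 \<and> (\<forall>k\<in>{..<n}. dist (X k \<omega>) (X i \<omega>) = 0 \<or> dist (X k \<omega>) (X j \<omega>) = 0
         \<or> X k \<omega> \<notin> gball (X i \<omega>) (X j \<omega>))" if "i < n" "j < n" for i j \<omega>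
    using that by (auto simp: gabriel_adj_def gball_def)
  have "Y n = (\<lambda>\<omega>. nscale \<alpha> n * ((\<Sum>i<n. \<Sum>j<n.
    if (dist (X i \<omega>) (X j \<omega>) \<noteq> 0 \<and> (\<forall>k\<in>{..<n}. dist (X k \<omega>) (X i \<omega>) = 0 \<or> dist (X k \<omega>) (X j \<omega>) = 0
         \<or> X k \<omega> \<notin> gball (X i \<omega>) (X j \<omega>)))
       \<and> (\<forall>k\<in>{..<i}. dist (X k \<omega>) (X i \<omega>) \<noteq> 0) \<and> (\<forall>k\<in>{..<j}. dist (X k \<omega>) (X j \<omega>) \<noteq> 0)
    then dist (X i \<omega>) (X j \<omega>) powr \<alpha> else 0) / 2))"
    unfolding Y_def gabriel_weight_image
    by (intro ext arg_cong2[where f="(*)"] arg_cong2[where f="(/)"] sum.cong refl if_cong)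
       (simp_all add: eq Ball_def)
  also have "\<dots> \<in> borel_measurable M" by measurable
  finally show ?thesis .
qed

lemma Y_eq:
  assumes "inj_on (\<lambda>i. X i \<omega>) {0..<n}"
  shows "Y n \<omega> = nscale \<alpha> n * G \<alpha> n (\<lambda>i\<in>{..<n}. X i \<omega>)"
  unfolding Y_def G_def gabriel_weight_image_inj[OF assms] g_def gball_def
  by (intro arg_cong2[where f="(*)"] arg_cong2[where f="(/)"] sum.cong refl) auto

lemma AE_inj: "AE \<omega> in M. inj_on (\<lambda>i. X i \<omega>) {0..<n}"
proof -
  have "AE \<omega> in M. \<forall>i\<in>{0..<n}. \<forall>j\<in>{0..<n}. i \<noteq> j \<longrightarrow> X i \<omega> \<noteq> X j \<omega>"
    using AE_X_distinct by (intro AE_finite_allI) auto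
  then show ?thesis by eventually_elim (auto simp: inj_on_def)
qed

lemma AE_Y_eq: "AE \<omega> in M. Y n \<omega> = nscale \<alpha> n * G \<alpha> n (\<lambda>i\<in>{..<n}. X i \<omega>)"
  using AE_inj by eventually_elim (rule Y_eq)

lemma Y_nonneg: "0 \<le> Y n \<omega>"
  unfolding Y_def nscale_def gabriel_weight_def by (intro mult_nonneg_nonneg sum_nonneg) auto

text \<open>Almost surely all points lie in the bounded set \<open>K\<close>, and since \<alpha> >=
  0 every edge term is at most a power of a bound on its distances. This yields integrability of
  \<open>Y n\<close> and of its square.\<close>

lemma AE_Y_bounded: obtains B where "AE \<omega> in M. norm (Y n \<omega>) \<le> B"
proof -
  obtain D where D: "\<And>x y. x \<in> K \<Longrightarrow> y \<in> K \<Longrightarrow> dist x y \<le> D"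
    using K_bounded unfolding bounded_two_points by auto
  have "AE \<omega> in M. \<forall>i\<in>{..<n}. X i \<omega> \<in> K"
    using AE_X_K by (intro AE_finite_allI) auto
  with AE_Y_eq[of n] have "AE \<omega> in M. norm (Y n \<omega>) \<le> nscale \<alpha> n * ((\<Sum>i<n. \<Sum>j<n. D powr \<alpha>) / 2)"
  proof eventually_elim
    case (elim \<omega>)
    have "(\<Sum>i<n. \<Sum>j<n. if i \<noteq> j then g n \<alpha> i j (\<lambda>i\<in>{..<n}. X i \<omega>) else 0) \<le> (\<Sum>i<n. \<Sum>j<n. D powr \<alpha>)"
    proof (intro sum_mono)
      fix i j assume "i \<in> {..<n}" "j \<in> {..<n}"
      then have "dist (X i \<omega>) (X j \<omega>) powr \<alpha> \<le> D powr \<alpha>"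
        using elim(2) D \<alpha> by (intro powr_mono2) auto
      then show "(if i \<noteq> j then g n \<alpha> i j (\<lambda>i\<in>{..<n}. X i \<omega>) else 0) \<le> D powr \<alpha>"
        using \<open>i \<in> _\<close> \<open>j \<in> _\<close> by (simp add: g_def)
    qed
    then have "G \<alpha> n (\<lambda>i\<in>{..<n}. X i \<omega>) \<le> (\<Sum>i<n. \<Sum>j<n. D powr \<alpha>) / 2"
      unfolding G_def by (rule divide_right_mono) simp
    then have "nscale \<alpha> n * G \<alpha> n (\<lambda>i\<in>{..<n}. X i \<omega>) \<le> nscale \<alpha> n * ((\<Sum>i<n. \<Sum>j<n. D powr \<alpha>) / 2)"
      by (rule mult_left_mono) (simp add: nscale_def)
    then show ?case
      using Y_nonneg[of n \<omega>] unfolding elim(1) real_norm_def by (simp only: abs_of_nonneg)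
  qed
  then show ?thesis by (rule that)
qed

lemma Y_integrable: "integrable M (Y n)"
proof -
  obtain B where "AE \<omega> in M. norm (Y n \<omega>) \<le> B" by (rule AE_Y_bounded)
  then show ?thesis by (rule S.integrable_const_bound) simp
qed

lemma Y_square_integrable: "integrable M (\<lambda>\<omega>. (Y n \<omega>)\<^sup>2)"
proof -
  obtain B where "AE \<omega> in M. norm (Y n \<omega>) \<le> B" by (rule AE_Y_bounded)
  then have "AE \<omega> in M. norm ((Y n \<omega>)\<^sup>2) \<le> B\<^sup>2"
  proof eventually_elim
    case (elim \<omega>)
    then show ?case using power_mono[OF elim norm_ge_zero, of 2] by simp
  qed
  then show ?thesis by (rule S.integrable_const_bound) simp
qed

lemma expectation_tendsto: "(\<lambda>n. S.expectation (Y n)) \<longlonglongrightarrow> lim_const \<alpha> / 2"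
proof -
  have eq: "ennreal (S.expectation (Y n)) = (\<integral>\<^sup>+e. ennreal (nscale \<alpha> n * G \<alpha> n e) \<partial>PM {..<n})" if "n > 0" for n
  proof -
    have "ennreal (S.expectation (Y n)) = (\<integral>\<^sup>+\<omega>. ennreal (Y n \<omega>) \<partial>M)"
      using Y_integrable Y_nonneg by (intro nn_integral_eq_integral[symmetric]) auto
    also have "\<dots> = (\<integral>\<^sup>+\<omega>. (\<lambda>e. ennreal (nscale \<alpha> n * G \<alpha> n e)) (\<lambda>i\<in>{..<n}. X i \<omega>) \<partial>M)"
      by (rule nn_integral_cong_AE) (use AE_Y_eq[of n] in eventually_elim, simp)
    also have "\<dots> = (\<integral>\<^sup>+e. ennreal (nscale \<alpha> n * G \<alpha> n e) \<partial>PM {..<n})"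
      by (rule nn_integral_sample) (use that in \<open>auto simp: lessThan_empty_iff\<close>)
    finally show ?thesis .
  qed
  have "(\<lambda>n. ennreal (S.expectation (Y n))) \<longlonglongrightarrow> ennreal (lim_const \<alpha> / 2)"
    using first_moment_tendsto[OF \<alpha>]
    by (rule Lim_transform_eventually) (use eq in \<open>auto simp: eventually_sequentially intro!: exI[of _ 1]\<close>)
  then show ?thesis
    using lim_const_nonneg[OF \<alpha>] Y_nonneg by (subst (asm) tendsto_ennreal_iff) auto
qed

lemma L2_limit: "(\<lambda>n. S.expectation (\<lambda>\<omega>. (Y n \<omega> - lim_const \<alpha> / 2)\<^sup>2)) \<longlonglongrightarrow> 0"
proof -
  define c where "c = lim_const \<alpha> / 2"
  have c: "0 \<le> c" using lim_const_nonneg[OF \<alpha>] by (simp add: c_def)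
  obtain R where R: "R \<longlonglongrightarrow> ennreal (c\<^sup>2)"
    "\<And>n. 8 \<le> n \<Longrightarrow> (\<integral>\<^sup>+e. ennreal ((nscale \<alpha> n * G \<alpha> n e)\<^sup>2) \<partial>PM {..<n}) \<le> R n"
    unfolding c_def using second_moment_tendsto[OF \<alpha>] by blast
  have second: "ennreal (S.expectation (\<lambda>\<omega>. (Y n \<omega>)\<^sup>2)) \<le> R n" if "8 \<le> n" for n
  proof -
    have "ennreal (S.expectation (\<lambda>\<omega>. (Y n \<omega>)\<^sup>2)) = (\<integral>\<^sup>+\<omega>. ennreal ((Y n \<omega>)\<^sup>2) \<partial>M)"
      using Y_square_integrable by (intro nn_integral_eq_integral[symmetric]) auto
    also have "\<dots> = (\<integral>\<^sup>+\<omega>. (\<lambda>e. ennreal ((nscale \<alpha> n * G \<alpha> n e)\<^sup>2)) (\<lambda>i\<in>{..<n}. X i \<omega>) \<partial>M)"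
      by (rule nn_integral_cong_AE) (use AE_Y_eq[of n] in eventually_elim, simp)
    also have "\<dots> = (\<integral>\<^sup>+e. ennreal ((nscale \<alpha> n * G \<alpha> n e)\<^sup>2) \<partial>PM {..<n})"
      by (rule nn_integral_sample) (use that in \<open>auto simp: lessThan_empty_iff\<close>)
    also have "\<dots> \<le> R n" by (rule R(2)[OF that])
    finally show ?thesis .
  qed
  have R': "(\<lambda>n. enn2real (R n)) \<longlonglongrightarrow> c\<^sup>2"
    using R(1) by (rule tendsto_enn2real) simp
  \<comment> \<open>\<open>enn2real\<close> sends infinity to 0, so the bound passes to the reals
    only where \<open>R n\<close> is finite, which holds eventually because its limit is
    finite.\<close>
  have "\<forall>\<^sub>F n in sequentially. R n < \<top>"
    by (rule order_tendstoD(2)[OF R(1)]) simp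
  then have "\<forall>\<^sub>F n in sequentially. S.expectation (\<lambda>\<omega>. (Y n \<omega>)\<^sup>2) \<le> enn2real (R n)"
    using eventually_ge_at_top[of 8]
  proof eventually_elim
    case (elim n)
    show ?case using enn2real_mono[OF second[OF elim(2)] elim(1)] by simp
  qed
  then have upper: "\<forall>\<^sub>F n in sequentially. S.expectation (\<lambda>\<omega>. (Y n \<omega> - c)\<^sup>2)
     \<le> enn2real (R n) - 2 * c * S.expectation (Y n) + c\<^sup>2"
  proof eventually_elim
    case (elim n)
    have "S.expectation (\<lambda>\<omega>. (Y n \<omega> - c)\<^sup>2) = S.expectation (\<lambda>\<omega>. (Y n \<omega>)\<^sup>2 - 2 * c * Y n \<omega> + c\<^sup>2)"
      by (intro Bochner_Integration.integral_cong) (auto simp: power2_diff)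
    also have "\<dots> = S.expectation (\<lambda>\<omega>. (Y n \<omega>)\<^sup>2) - 2 * c * S.expectation (Y n) + c\<^sup>2"
      using Y_integrable Y_square_integrable by (simp add: S.prob_space)
    finally show ?case using elim by simp
  qed
  have "(\<lambda>n. enn2real (R n) - 2 * c * S.expectation (Y n) + c\<^sup>2) \<longlonglongrightarrow> c\<^sup>2 - 2 * c * c + c\<^sup>2"
    by (intro tendsto_intros R' expectation_tendsto[folded c_def])
  then have lim: "(\<lambda>n. enn2real (R n) - 2 * c * S.expectation (Y n) + c\<^sup>2) \<longlonglongrightarrow> 0"
    by (simp add: power2_eq_square)
  show ?thesis
    unfolding c_def[symmetric] by (rule tendsto_sandwich[OF _ upper tendsto_const lim]) simp
qed

end

theorem theorem6:
  fixes M :: "'m measure"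
    and X :: "nat \<Rightarrow> 'm \<Rightarrow> 'a::euclidean_space"
    and f :: "'a \<Rightarrow> real"
    and K :: "'a set"
    and \<alpha> :: real
  assumes "prob_space M"
    and "\<alpha> \<ge> 0"
    and indep: "prob_space.indep_vars M (\<lambda>_. borel) X UNIV"
    and distr: "\<And>i. distributed M lborel (X i) (\<lambda>x. ennreal (f x))"
    and C1_poly: "polyhedron K" "convex K"
    and C1_supp: "\<And>x. x \<notin> K \<Longrightarrow> f x = 0"
    and C1_bdd: "\<exists>c1 c2. 0 < c1 \<and> c1 \<le> c2 \<and> (\<forall>x \<in> K. c1 \<le> f x \<and> f x \<le> c2)"
  shows "L2_converges M
           (\<lambda>n \<omega>. real n powr ((\<alpha> - real DIM('a)) / real DIM('a))
                    * gabriel_weight \<alpha> ((\<lambda>i. X i \<omega>) ` {0..<n}))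
           ((pi powr (real DIM('a) / 2) / Gamma (1 + real DIM('a) / 2))
                 powr (- \<alpha> / real DIM('a))
            * 2 powr (real DIM('a) + \<alpha> - 1)
            * Gamma (1 + \<alpha> / real DIM('a))
            * (LINT x:K|lborel. f x powr ((real DIM('a) - \<alpha>) / real DIM('a))))"
proof -
  interpret prob_space M by fact
  obtain c1 c2 where c: "0 < c1" "c1 \<le> c2" "\<forall>x \<in> K. c1 \<le> f x \<and> f x \<le> c2"
    using C1_bdd by blast
  have f_nonneg: "0 \<le> f x" for x
    using C1_supp[of x] c by (cases "x \<in> K") (auto intro: order_trans[of 0 c1])
  have X: "X i \<in> borel_measurable M" for i
    using distributed_measurable[OF distr[of i]] by simp
  have distr': "distr M lborel (X i) = density lborel (\<lambda>x. ennreal (f x))" for i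
    by (rule distributed_distr_eq_density[OF distr])
  interpret convex_density f K c1 c2
  proof
    have "(\<lambda>x. ennreal (f x)) \<in> borel_measurable lborel"
      by (rule distributed_borel_measurable[OF distr])
    \<comment> \<open>The distribution assumption gives measurability of
      \<open>ennreal (f x)\<close> only; nonnegativity recovers \<open>f\<close> from it.\<close>
    then have "(\<lambda>x. enn2real (ennreal (f x))) \<in> borel_measurable lborel" by measurable
    then show "f \<in> borel_measurable borel" using f_nonneg by simp
    show "closed K" by (rule polyhedron_imp_closed[OF C1_poly(1)])
    have "(\<integral>\<^sup>+x. ennreal (f x) \<partial>lborel) = emeasure (density lborel (\<lambda>x. ennreal (f x))) UNIV"
      using \<open>(\<lambda>x. ennreal (f x)) \<in> _\<close> by (subst emeasure_density) auto
    also have "\<dots> = emeasure (distr M lborel (X 0)) UNIV" by (simp only: distr')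
    also have "\<dots> = 1" using X[of 0] by (subst emeasure_distr) (auto simp: emeasure_space_1)
    finally show "(\<integral>\<^sup>+x. ennreal (f x) \<partial>lborel) = 1" .
  qed (use c C1_poly C1_supp in auto)
  interpret gabriel_sample f K c1 c2 M X \<alpha>
  proof
    have "distr M borel (X i) = distr M lborel (X i)" for i by (rule distr_cong) auto
    then show "distr M borel (X i) = \<mu>" for i by (simp add: distr' \<mu>_def)
  qed (use X indep assms(2) in auto)
  have v: "pi powr (real DIM('a) / 2) / Gamma (1 + real DIM('a) / 2) = unit_ball_vol (real DIM('a))"
    by (simp add: unit_ball_vol_def add.commute)
  \<comment> \<open>The -1 in the exponent is the half that turns ordered pairs into edges.\<close>
  have two: "2 powr (real DIM('a) + \<alpha> - 1) = 2 powr (real DIM('a) + \<alpha>) / 2"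
    by (simp add: powr_diff)
  have const: "(pi powr (real DIM('a) / 2) / Gamma (1 + real DIM('a) / 2)) powr (- \<alpha> / real DIM('a))
            * 2 powr (real DIM('a) + \<alpha> - 1) * Gamma (1 + \<alpha> / real DIM('a))
            * (LINT x:K|lborel. f x powr ((real DIM('a) - \<alpha>) / real DIM('a))) = lim_const \<alpha> / 2"
    unfolding v two lim_const_def by simp
  show ?thesis
    unfolding L2_converges_def const
    using Y_measurable Y_square_integrable L2_limit unfolding Y_def nscale_def by blast
qed

end
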